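(* Let $R$ be a commutative ring and $n\ge 0$ an integer. The connected components of $\mathbb{P}^n_R$, regarded as reduced induced closed subschemes, are exactly of the form $\mathbb{P}^n_{R/I}$ where $I$ is a radical ideal of $R$ such that $V(I)$ is a connected component of $\operatorname{Spec}(R)$.
   Context: For a commutative ring $A$, $\mathbb{P}^n_A=\operatorname{Proj}A[x_0,\ldots,x_n]$ with the standard grading. For an ideal $I$ of $R$, $\mathbb{P}^n_{R/I}\simeq\mathbb{P}^n_R\times_{\operatorname{Spec}(R)}\operatorname{Spec}(R/I)$ is regarded as a closed subscheme of $\mathbb{P}^n_R$, and $V(I)$ is the set of primes of $R$ containing $I$. A connected component is a closed subset and is given its unique reduced closed subscheme structure. Connected spaces are nonempty by convention. *)

theory Defs
  imports "HOL-Algebra.QuotRing" "HOL-Library.Multiset" "HOL-Analysis.Abstract_Topology_2"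
begin

section \<open>Spectra\<close>

definition spec :: "('a, 'm) ring_scheme \<Rightarrow> 'a set set" where
  "spec R = {P. primeideal P R}"

definition zero_locus :: "('a, 'm) ring_scheme \<Rightarrow> 'a set \<Rightarrow> 'a set set" where
  "zero_locus R E = {P \<in> spec R. E \<subseteq> P}"

definition spec_top :: "('a, 'm) ring_scheme \<Rightarrow> 'a set topology" where
  "spec_top R = topology (\<lambda>U. \<exists>E \<subseteq> carrier R. U = spec R - zero_locus R E)"

text \<open>The family above really is a topology, so that the abstraction function \<^const>\<open>topology\<close> is
  not applied outside its domain.\<close>

lemma istopology_spec:
  "istopology (\<lambda>U. \<exists>E \<subseteq> carrier R. U = spec R - zero_locus R E)"
  unfolding istopology_def
proof (intro conjI allI impI)
  fix U V
  assume "\<exists>E \<subseteq> carrier R. U = spec R - zero_locus R E" "\<exists>E \<subseteq> carrier R. V = spec R - zero_locus R E"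
  then obtain E F where EF: "E \<subseteq> carrier R" "F \<subseteq> carrier R"
    and U: "U = spec R - zero_locus R E" and V: "V = spec R - zero_locus R F" by blast
  define G where "G = {g \<in> carrier R. \<exists>e\<in>E. \<exists>f\<in>F. g = e \<otimes>\<^bsub>R\<^esub> f}"
  have "(E \<subseteq> P \<or> F \<subseteq> P) \<longleftrightarrow> G \<subseteq> P" if "P \<in> spec R" for P
  proof -
    interpret primeideal P R using that by (simp add: spec_def)
    show ?thesis
    proof
      assume "E \<subseteq> P \<or> F \<subseteq> P"
      then show "G \<subseteq> P"
      proof (intro subsetI)
        fix g assume "g \<in> G"
        then obtain e f where ef: "e \<in> E" "f \<in> F" "g = e \<otimes>\<^bsub>R\<^esub> f" unfolding G_def by blast
        then have "e \<in> carrier R" "f \<in> carrier R" using EF by auto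
        then show "g \<in> P"
          using \<open>E \<subseteq> P \<or> F \<subseteq> P\<close> ef I_l_closed[of f e] I_r_closed[of e f] by auto
      qed
    next
      assume G: "G \<subseteq> P"
      show "E \<subseteq> P \<or> F \<subseteq> P"
      proof (rule ccontr)
        assume "\<not> ?thesis"
        then obtain e f where ef: "e \<in> E" "e \<notin> P" "f \<in> F" "f \<notin> P" by blast
        then have car: "e \<in> carrier R" "f \<in> carrier R" using EF by auto
        then have "e \<otimes>\<^bsub>R\<^esub> f \<in> P" using G ef by (auto simp: G_def)
        then show False using I_prime[OF car] ef by blast
      qed
    qed
  qed
  then have "U \<inter> V = spec R - zero_locus R G" unfolding U V zero_locus_def by blast
  moreover have "G \<subseteq> carrier R" by (auto simp: G_def)
  ultimately show "\<exists>E \<subseteq> carrier R. U \<inter> V = spec R - zero_locus R E" by blast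
next
  fix K
  assume K: "\<forall>U\<in>K. \<exists>E \<subseteq> carrier R. U = spec R - zero_locus R E"
  define F where "F = \<Union>{E. E \<subseteq> carrier R \<and> spec R - zero_locus R E \<in> K}"
  have "\<Union>K = spec R - zero_locus R F"
  proof (intro equalityI subsetI)
    fix x assume "x \<in> \<Union>K"
    then obtain U where U: "U \<in> K" "x \<in> U" by blast
    then obtain E where "E \<subseteq> carrier R" "U = spec R - zero_locus R E" using K by metis
    then show "x \<in> spec R - zero_locus R F"
      using U unfolding F_def zero_locus_def by auto
  next
    fix x assume x: "x \<in> spec R - zero_locus R F"
    then have "\<not> F \<subseteq> x" by (simp add: zero_locus_def)
    then obtain E where "E \<subseteq> carrier R" "spec R - zero_locus R E \<in> K" "\<not> E \<subseteq> x"
      unfolding F_def by auto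
    moreover have "x \<in> spec R - zero_locus R E"
      using x \<open>\<not> E \<subseteq> x\<close> by (simp add: zero_locus_def)
    ultimately show "x \<in> \<Union>K" by (rule_tac UnionI)
  qed
  moreover have "F \<subseteq> carrier R" unfolding F_def by auto
  ultimately show "\<exists>E \<subseteq> carrier R. \<Union>K = spec R - zero_locus R E" by (intro exI[of _ F] conjI)
qed

lemma openin_spec_top:
  "openin (spec_top R) U \<longleftrightarrow> (\<exists>E \<subseteq> carrier R. U = spec R - zero_locus R E)"
  unfolding spec_top_def topology_inverse'[OF istopology_spec] by (rule refl)

definition radical_ideal :: "'a set \<Rightarrow> ('a, 'm) ring_scheme \<Rightarrow> bool" where
  "radical_ideal I R \<longleftrightarrow>
     ideal I R \<and> (\<forall>a \<in> carrier R. \<forall>k::nat. a [^]\<^bsub>R\<^esub> k \<in> I \<longrightarrow> a \<in> I)"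


section \<open>Locally ringed spaces\<close>

record ('p, 's) ringed_space =
  points :: "'p topology"
  sections :: "'p set \<Rightarrow> 's ring"
  restr :: "'p set \<Rightarrow> 'p set \<Rightarrow> 's \<Rightarrow> 's"  \<comment> \<open>\<open>restr U V\<close> goes from sections over \<open>U\<close> to sections over \<open>V \<subseteq> U\<close>\<close>

definition presheaf_of_rings :: "('p, 's) ringed_space \<Rightarrow> bool" where
  "presheaf_of_rings X \<longleftrightarrow>
     (\<forall>U. openin (points X) U \<longrightarrow> cring (sections X U)) \<and>
     (\<forall>U V. openin (points X) U \<and> openin (points X) V \<and> V \<subseteq> U \<longrightarrow>
        restr X U V \<in> ring_hom (sections X U) (sections X V)) \<and>
     (\<forall>U. openin (points X) U \<longrightarrow> (\<forall>s \<in> carrier (sections X U). restr X U U s = s)) \<and>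
     (\<forall>U V W. openin (points X) U \<and> openin (points X) V \<and> openin (points X) W \<and> W \<subseteq> V \<and> V \<subseteq> U \<longrightarrow>
        (\<forall>s \<in> carrier (sections X U). restr X V W (restr X U V s) = restr X U W s))"

definition sheaf_of_rings :: "('p, 's) ringed_space \<Rightarrow> bool" where
  "sheaf_of_rings X \<longleftrightarrow> presheaf_of_rings X \<and>
     (\<forall>\<U> s. (\<forall>U \<in> \<U>. openin (points X) U \<and> s U \<in> carrier (sections X U)) \<and>
        (\<forall>U \<in> \<U>. \<forall>V \<in> \<U>. restr X U (U \<inter> V) (s U) = restr X V (U \<inter> V) (s V)) \<longrightarrow>
        (\<exists>!t. t \<in> carrier (sections X (\<Union>\<U>)) \<and> (\<forall>U \<in> \<U>. restr X (\<Union>\<U>) U t = s U)))"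

definition germ :: "('p, 's) ringed_space \<Rightarrow> 'p \<Rightarrow> 'p set \<Rightarrow> 's \<Rightarrow> ('p set \<times> 's) set" where
  "germ X x U s = {(V, t). openin (points X) V \<and> x \<in> V \<and> t \<in> carrier (sections X V) \<and>
     (\<exists>W. openin (points X) W \<and> x \<in> W \<and> W \<subseteq> U \<inter> V \<and> restr X U W s = restr X V W t)}"

text \<open>As usual for quotients, the operations are given on representatives; the unions are over
  families that are constant once \<open>X\<close> is a presheaf.\<close>

definition stalk :: "('p, 's) ringed_space \<Rightarrow> 'p \<Rightarrow> ('p set \<times> 's) set ring" where
  "stalk X x = \<lparr>
     carrier = {germ X x U s | U s. openin (points X) U \<and> x \<in> U \<and> s \<in> carrier (sections X U)},
     monoid.mult = (\<lambda>A B. \<Union>(U, s)\<in>A. \<Union>(V, t)\<in>B.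
       germ X x (U \<inter> V) (restr X U (U \<inter> V) s \<otimes>\<^bsub>sections X (U \<inter> V)\<^esub> restr X V (U \<inter> V) t)),
     one = germ X x (topspace (points X)) \<one>\<^bsub>sections X (topspace (points X))\<^esub>,
     zero = germ X x (topspace (points X)) \<zero>\<^bsub>sections X (topspace (points X))\<^esub>,
     add = (\<lambda>A B. \<Union>(U, s)\<in>A. \<Union>(V, t)\<in>B.
       germ X x (U \<inter> V) (restr X U (U \<inter> V) s \<oplus>\<^bsub>sections X (U \<inter> V)\<^esub> restr X V (U \<inter> V) t))\<rparr>"

definition local_ring :: "('a, 'm) ring_scheme \<Rightarrow> bool" where
  "local_ring A \<longleftrightarrow> cring A \<and> (\<exists>!M. maximalideal M A)"

definition local_hom :: "('a, 'm) ring_scheme \<Rightarrow> ('b, 'k) ring_scheme \<Rightarrow> ('a \<Rightarrow> 'b) \<Rightarrow> bool" where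
  "local_hom A B h \<longleftrightarrow> h \<in> ring_hom A B \<and>
     (\<forall>M N. maximalideal M A \<and> maximalideal N B \<longrightarrow> h ` M \<subseteq> N)"

definition locally_ringed_space :: "('p, 's) ringed_space \<Rightarrow> bool" where
  "locally_ringed_space X \<longleftrightarrow>
     sheaf_of_rings X \<and> (\<forall>x \<in> topspace (points X). local_ring (stalk X x))"

text \<open>A morphism from \<open>Z\<close> to \<open>X\<close>; \<open>comorph f U\<close> maps sections of \<open>X\<close> over \<open>U\<close> to sections of \<open>Z\<close>
  over the preimage of \<open>U\<close>.\<close>

record ('q, 't, 'p, 's) ringed_morphism =
  pt_map :: "'q \<Rightarrow> 'p"
  comorph :: "'p set \<Rightarrow> 's \<Rightarrow> 't"

definition preim :: "('q, 't) ringed_space \<Rightarrow> ('q, 't, 'p, 's) ringed_morphism \<Rightarrow> 'p set \<Rightarrow> 'q set" where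
  "preim Z f U = {z \<in> topspace (points Z). pt_map f z \<in> U}"

definition stalk_map :: "('q, 't) ringed_space \<Rightarrow> ('q, 't, 'p, 's) ringed_morphism \<Rightarrow> 'q
    \<Rightarrow> ('p set \<times> 's) set \<Rightarrow> ('q set \<times> 't) set" where
  "stalk_map Z f z A = (\<Union>(U, s)\<in>A. germ Z z (preim Z f U) (comorph f U s))"

definition lrs_morphism :: "('q, 't) ringed_space \<Rightarrow> ('p, 's) ringed_space
    \<Rightarrow> ('q, 't, 'p, 's) ringed_morphism \<Rightarrow> bool" where
  "lrs_morphism Z X f \<longleftrightarrow>
     locally_ringed_space Z \<and> locally_ringed_space X \<and>
     continuous_map (points Z) (points X) (pt_map f) \<and>
     (\<forall>U. openin (points X) U \<longrightarrow>
        comorph f U \<in> ring_hom (sections X U) (sections Z (preim Z f U))) \<and>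
     (\<forall>U V. openin (points X) U \<and> openin (points X) V \<and> V \<subseteq> U \<longrightarrow>
        (\<forall>s \<in> carrier (sections X U).
           comorph f V (restr X U V s) = restr Z (preim Z f U) (preim Z f V) (comorph f U s))) \<and>
     (\<forall>z \<in> topspace (points Z).
        local_hom (stalk X (pt_map f z)) (stalk Z z) (stalk_map Z f z))"


section \<open>Closed subschemes\<close>

definition comorph_kernel :: "('q, 't) ringed_space \<Rightarrow> ('p, 's) ringed_space
    \<Rightarrow> ('q, 't, 'p, 's) ringed_morphism \<Rightarrow> 'p set \<Rightarrow> 's set" where
  "comorph_kernel Z X f U =
     {s \<in> carrier (sections X U). comorph f U s = \<zero>\<^bsub>sections Z (preim Z f U)\<^esub>}"

text \<open>Closed immersions in the sense of the Stacks Project (Tags 01HK and 01IO): a homeomorphism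
  onto a closed subset, surjective on sheaves, whose ideal sheaf is locally generated by sections.
  If \<open>X\<close> is a scheme, then the last condition says exactly that the ideal sheaf is quasi-coherent,
  i.e. that \<open>Z\<close> is a scheme too; so over a scheme \<open>X\<close> these are the closed immersions of schemes.\<close>

definition closed_immersion :: "('q, 't) ringed_space \<Rightarrow> ('p, 's) ringed_space
    \<Rightarrow> ('q, 't, 'p, 's) ringed_morphism \<Rightarrow> bool" where
  "closed_immersion Z X f \<longleftrightarrow>
     lrs_morphism Z X f \<and>
     embedding_map (points Z) (points X) (pt_map f) \<and>
     closedin (points X) (pt_map f ` topspace (points Z)) \<and>
     (\<forall>U t x. openin (points X) U \<and> t \<in> carrier (sections Z (preim Z f U)) \<and> x \<in> U \<longrightarrow>
        (\<exists>V. openin (points X) V \<and> x \<in> V \<and> V \<subseteq> U \<and>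
           (\<exists>s \<in> carrier (sections X V).
              comorph f V s = restr Z (preim Z f U) (preim Z f V) t))) \<and>
     (\<forall>x \<in> topspace (points X). \<exists>U. openin (points X) U \<and> x \<in> U \<and>
        (\<exists>G \<subseteq> comorph_kernel Z X f U.
           \<forall>V s y. openin (points X) V \<and> V \<subseteq> U \<and> s \<in> comorph_kernel Z X f V \<and> y \<in> V \<longrightarrow>
             (\<exists>W. openin (points X) W \<and> y \<in> W \<and> W \<subseteq> V \<and>
                restr X V W s \<in> genideal (sections X W) (restr X U W ` G))))"

definition reduced_space :: "('p, 's) ringed_space \<Rightarrow> bool" where
  "reduced_space X \<longleftrightarrow>
     (\<forall>U. openin (points X) U \<longrightarrow> (\<forall>s \<in> carrier (sections X U). \<forall>k::nat.
        s [^]\<^bsub>sections X U\<^esub> k = \<zero>\<^bsub>sections X U\<^esub> \<longrightarrow> s = \<zero>\<^bsub>sections X U\<^esub>))"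

text \<open>\<open>f : Z \<rightarrow> X\<close> is the reduced induced closed subscheme structure on the closed subset \<open>C\<close>. For a
  scheme \<open>X\<close> this determines \<open>(Z, f)\<close> up to unique isomorphism over \<open>X\<close>.\<close>

definition reduced_induced_subscheme :: "('p, 's) ringed_space \<Rightarrow> 'p set \<Rightarrow> ('q, 't) ringed_space
    \<Rightarrow> ('q, 't, 'p, 's) ringed_morphism \<Rightarrow> bool" where
  "reduced_induced_subscheme X C Z f \<longleftrightarrow>
     closed_immersion Z X f \<and> reduced_space Z \<and> pt_map f ` topspace (points Z) = C"


section \<open>Proj of a graded ring\<close>

record 'a graded_ring = "'a ring" +
  hpart :: "nat \<Rightarrow> 'a set"  \<comment> \<open>homogeneous parts\<close>

definition homogeneous_ideal :: "('a, 'm) graded_ring_scheme \<Rightarrow> 'a set \<Rightarrow> bool" where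
  "homogeneous_ideal S P \<longleftrightarrow> ideal P S \<and> P = genideal S (P \<inter> (\<Union>d. hpart S d))"

definition irrelevant_ideal :: "('a, 'm) graded_ring_scheme \<Rightarrow> 'a set" where
  "irrelevant_ideal S = genideal S (\<Union>d\<in>{0<..}. hpart S d)"

definition proj_set :: "('a, 'm) graded_ring_scheme \<Rightarrow> 'a set set" where
  "proj_set S = {P \<in> spec S. homogeneous_ideal S P \<and> \<not> irrelevant_ideal S \<subseteq> P}"

text \<open>The fraction \<open>a/b\<close> in the homogeneous localization at \<open>P\<close>: the class of all \<open>(c, e)\<close>, with
  \<open>c, e\<close> homogeneous of equal degree and \<open>e \<notin> P\<close>, such that \<open>u (a e - c b) = 0\<close> for some
  homogeneous \<open>u \<notin> P\<close>.\<close>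

definition hfrac :: "('a, 'm) graded_ring_scheme \<Rightarrow> 'a set \<Rightarrow> 'a \<Rightarrow> 'a \<Rightarrow> ('a \<times> 'a) set" where
  "hfrac S P a b = {(c, e). (\<exists>d. c \<in> hpart S d \<and> e \<in> hpart S d) \<and> e \<notin> P \<and>
     (\<exists>u \<in> (\<Union>d. hpart S d) - P. u \<otimes>\<^bsub>S\<^esub> (a \<otimes>\<^bsub>S\<^esub> e) = u \<otimes>\<^bsub>S\<^esub> (c \<otimes>\<^bsub>S\<^esub> b))}"

definition hlocalization :: "('a, 'm) graded_ring_scheme \<Rightarrow> 'a set \<Rightarrow> ('a \<times> 'a) set ring" where
  "hlocalization S P = \<lparr>
     carrier = {hfrac S P a b | a b. (\<exists>d. a \<in> hpart S d \<and> b \<in> hpart S d) \<and> b \<notin> P},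
     monoid.mult = (\<lambda>A B. \<Union>(a, b)\<in>A. \<Union>(c, e)\<in>B. hfrac S P (a \<otimes>\<^bsub>S\<^esub> c) (b \<otimes>\<^bsub>S\<^esub> e)),
     one = hfrac S P \<one>\<^bsub>S\<^esub> \<one>\<^bsub>S\<^esub>,
     zero = hfrac S P \<zero>\<^bsub>S\<^esub> \<one>\<^bsub>S\<^esub>,
     add = (\<lambda>A B. \<Union>(a, b)\<in>A. \<Union>(c, e)\<in>B.
       hfrac S P ((a \<otimes>\<^bsub>S\<^esub> e) \<oplus>\<^bsub>S\<^esub> (c \<otimes>\<^bsub>S\<^esub> b)) (b \<otimes>\<^bsub>S\<^esub> e))\<rparr>"

definition proj_top :: "('a, 'm) graded_ring_scheme \<Rightarrow> 'a set topology" where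
  "proj_top S = subtopology (spec_top S) (proj_set S)"

text \<open>Sections over \<open>U\<close> are the functions assigning to each \<open>P \<in> U\<close> an element of the homogeneous
  localization at \<open>P\<close> which are locally given by one fraction.\<close>

definition proj_sections :: "('a, 'm) graded_ring_scheme \<Rightarrow> 'a set set
    \<Rightarrow> ('a set \<Rightarrow> ('a \<times> 'a) set) ring" where
  "proj_sections S U = \<lparr>
     carrier = {s \<in> (\<Pi>\<^sub>E P\<in>U. carrier (hlocalization S P)).
       \<forall>P\<in>U. \<exists>V. openin (proj_top S) V \<and> P \<in> V \<and> V \<subseteq> U \<and>
         (\<exists>a b. (\<exists>d. a \<in> hpart S d \<and> b \<in> hpart S d) \<and> (\<forall>Q\<in>V. b \<notin> Q \<and> s Q = hfrac S Q a b))},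
     monoid.mult = (\<lambda>s t. \<lambda>P\<in>U. s P \<otimes>\<^bsub>hlocalization S P\<^esub> t P),
     one = (\<lambda>P\<in>U. \<one>\<^bsub>hlocalization S P\<^esub>),
     zero = (\<lambda>P\<in>U. \<zero>\<^bsub>hlocalization S P\<^esub>),
     add = (\<lambda>s t. \<lambda>P\<in>U. s P \<oplus>\<^bsub>hlocalization S P\<^esub> t P)\<rparr>"

definition Proj :: "('a, 'm) graded_ring_scheme \<Rightarrow> ('a set, 'a set \<Rightarrow> ('a \<times> 'a) set) ringed_space" where
  "Proj S = \<lparr>points = proj_top S, sections = proj_sections S, restr = (\<lambda>U V s. restrict s V)\<rparr>"

text \<open>The morphism \<open>Proj T \<rightarrow> Proj S\<close> induced by a surjective graded homomorphism \<open>h : S \<rightarrow> T\<close>: on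
  points \<open>Q \<mapsto> h\<^sup>-\<^sup>1(Q)\<close>, on sections \<open>a/b \<mapsto> h(a)/h(b)\<close>.\<close>

definition Proj_map :: "('a, 'm) graded_ring_scheme \<Rightarrow> ('b, 'k) graded_ring_scheme \<Rightarrow> ('a \<Rightarrow> 'b)
    \<Rightarrow> ('b set, 'b set \<Rightarrow> ('b \<times> 'b) set, 'a set, 'a set \<Rightarrow> ('a \<times> 'a) set) ringed_morphism" where
  "Proj_map S T h = (let \<phi> = (\<lambda>Q. {a \<in> carrier S. h a \<in> Q}) in
     \<lparr>pt_map = \<phi>,
      comorph = (\<lambda>U s. \<lambda>Q\<in>{Q \<in> proj_set T. \<phi> Q \<in> U}. \<Union>(a, b)\<in>s (\<phi> Q). hfrac T Q (h a) (h b))\<rparr>)"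


section \<open>Projective space\<close>

text \<open>The polynomial ring in \<open>x\<^sub>0, \<dots>, x\<^sub>n\<close> with its standard grading. Monomials are
  multisets of variable indices, as in \<open>HOL-Algebra.Indexed_Polynomials\<close>, and a polynomial is
  its coefficient function.\<close>

definition mpoly_ring :: "('a, 'm) ring_scheme \<Rightarrow> nat \<Rightarrow> (nat multiset \<Rightarrow> 'a) graded_ring" where
  "mpoly_ring R n = (let
     polys = {p. (\<forall>m. p m \<in> carrier R) \<and> finite {m. p m \<noteq> \<zero>\<^bsub>R\<^esub>} \<and>
                 (\<forall>m. p m \<noteq> \<zero>\<^bsub>R\<^esub> \<longrightarrow> set_mset m \<subseteq> {0..n})} in
   \<lparr>carrier = polys,
    monoid.mult = (\<lambda>p q m. \<Oplus>\<^bsub>R\<^esub>k\<in>{k. k \<subseteq># m}. p k \<otimes>\<^bsub>R\<^esub> q (m - k)),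
    one = (\<lambda>m. if m = {#} then \<one>\<^bsub>R\<^esub> else \<zero>\<^bsub>R\<^esub>),
    zero = (\<lambda>m. \<zero>\<^bsub>R\<^esub>),
    add = (\<lambda>p q m. p m \<oplus>\<^bsub>R\<^esub> q m),
    hpart = (\<lambda>d. {p \<in> polys. \<forall>m. p m \<noteq> \<zero>\<^bsub>R\<^esub> \<longrightarrow> size m = d})\<rparr>)"

definition projective_space :: "('a, 'm) ring_scheme \<Rightarrow> nat
    \<Rightarrow> ((nat multiset \<Rightarrow> 'a) set,
        (nat multiset \<Rightarrow> 'a) set \<Rightarrow> ((nat multiset \<Rightarrow> 'a) \<times> (nat multiset \<Rightarrow> 'a)) set) ringed_space" where
  "projective_space R n = Proj (mpoly_ring R n)"

text \<open>The canonical morphism from projective space over \<open>R/I\<close> to projective space over \<open>R\<close> (the base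
  change of \<open>Spec (R/I) \<rightarrow> Spec R\<close>), induced by reducing coefficients modulo \<open>I\<close>.\<close>

definition projective_space_incl :: "('a, 'm) ring_scheme \<Rightarrow> 'a set \<Rightarrow> nat
    \<Rightarrow> ((nat multiset \<Rightarrow> 'a set) set,
        (nat multiset \<Rightarrow> 'a set) set \<Rightarrow> ((nat multiset \<Rightarrow> 'a set) \<times> (nat multiset \<Rightarrow> 'a set)) set,
        (nat multiset \<Rightarrow> 'a) set,
        (nat multiset \<Rightarrow> 'a) set \<Rightarrow> ((nat multiset \<Rightarrow> 'a) \<times> (nat multiset \<Rightarrow> 'a)) set)
       ringed_morphism" where
  "projective_space_incl R I n =
     Proj_map (mpoly_ring R n) (mpoly_ring (R Quot I) n) (\<lambda>p m. I +>\<^bsub>R\<^esub> p m)"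

end

theory Submission
  imports Defs "HOL-Library.Multiset_Order"
begin

text \<open>Let \<open>\<pi>\<close> be the structure morphism from projective space to \<open>Spec R\<close>. Sending a prime \<open>p\<close> to the
  extended prime \<open>p[x\<^sub>0, \<dots>, x\<^sub>n]\<close> is a continuous section of \<open>\<pi>\<close> meeting every fibre in its generic
  point, so \<open>\<pi>\<close> pulls connected sets back to connected sets. Hence the connected components of
  projective space are the preimages of the components \<open>V(I)\<close> of \<open>Spec R\<close>. Reducing coefficients modulo a
  radical ideal \<open>I\<close> induces a closed immersion, with reduced source because a polynomial ring over a
  reduced ring is reduced, whose image consists of the primes containing \<open>I\<close>, i.e. is the preimage of
  \<open>V(I)\<close>.\<close>

section \<open>Homogeneous localization\<close>

text \<open>No affine charts are available: sections are functions into homogeneous localizations,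
  and \<open>closed_immersion\<close> asks for a local generating set of the ideal sheaf. Sheaf
  axioms, stalks and the immersion are therefore all computed pointwise with fractions
  \<open>a/b\<close>. The delicate points are that witnesses \<open>u\<close> must be homogeneous
  outside the prime, and that the ring operations are unions over representatives, which collapse
  only once independence of the representative is known. The polynomial ring contributes two facts:
  \<open>p[x_0, ..., x_n]\<close> is prime for prime \<open>p\<close>, and a reduced coefficient
  ring gives a reduced polynomial ring. Both come from one computation of the leading coefficient of
  a product relative to an ideal, for a linear order on monomials compatible with addition. The
  extended prime is a point of Proj because the variable \<open>x_0\<close> is present for every
  \<open>n\<close>. The ideal attached to a component \<open>D\<close> is the intersection of the
  primes in \<open>D\<close>; it recovers \<open>D\<close> because components are closed.\<close>

abbreviation homs :: "('a, 'm) graded_ring_scheme \<Rightarrow> 'a set" where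
  "homs S \<equiv> \<Union>d. hpart S d"

text \<open>The record \<open>graded_ring\<close> carries no laws. These closure properties of the
  homogeneous parts are what turns fractions of equal degree into a ring.\<close>

locale graded_cring = cring S for S :: "('a, 'm) graded_ring_scheme" (structure) +
  assumes hpart_carrier: "a \<in> hpart S d \<Longrightarrow> a \<in> carrier S"
    and hpart_zero: "\<zero> \<in> hpart S d"
    and hpart_add: "a \<in> hpart S d \<Longrightarrow> b \<in> hpart S d \<Longrightarrow> a \<oplus> b \<in> hpart S d"
    and hpart_uminus: "a \<in> hpart S d \<Longrightarrow> \<ominus> a \<in> hpart S d"
    and hpart_one: "\<one> \<in> hpart S 0"
    and hpart_mult: "a \<in> hpart S d \<Longrightarrow> b \<in> hpart S e \<Longrightarrow> a \<otimes> b \<in> hpart S (d + e)"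

text \<open>The admissible fractions \<open>a/b\<close>. The set \<open>P\<close> is a parameter, so
  that a single pair can be tested at every prime of an open set.\<close>

definition hpair :: "('a, 'm) graded_ring_scheme \<Rightarrow> 'a set \<Rightarrow> 'a \<Rightarrow> 'a \<Rightarrow> bool" where
  "hpair S P a b \<longleftrightarrow> (\<exists>d. a \<in> hpart S d \<and> b \<in> hpart S d) \<and> b \<notin> P"

locale graded_prime = graded_cring S + primeideal P S for S :: "('a, 'm) graded_ring_scheme" (structure) and P
begin

abbreviation hp :: "'a \<Rightarrow> 'a \<Rightarrow> bool" where "hp \<equiv> hpair S P"
abbreviation fr :: "'a \<Rightarrow> 'a \<Rightarrow> ('a \<times> 'a) set" where "fr \<equiv> hfrac S P"
abbreviation L :: "('a \<times> 'a) set ring" where "L \<equiv> hlocalization S P"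

lemma one_notin: "\<one> \<notin> P"
  using I_notcarr one_imp_carrier by blast

lemma homs_one: "\<one> \<in> homs S - P"
  using hpart_one one_notin by blast

lemma homs_mult: "u \<in> homs S - P \<Longrightarrow> v \<in> homs S - P \<Longrightarrow> u \<otimes> v \<in> homs S - P"
  using hpart_mult I_prime[of u v] hpart_carrier by (auto; blast)

lemma homs_carrier: "u \<in> homs S - P \<Longrightarrow> u \<in> carrier S"
  using hpart_carrier by blast

lemma hpairD:
  assumes "hp a b"
  shows "a \<in> carrier S" "b \<in> carrier S" "b \<in> homs S - P"
  using assms hpart_carrier unfolding hpair_def by blast+

lemma mem_hfrac: "(c, e) \<in> fr a b \<longleftrightarrow>
    hp c e \<and> (\<exists>u\<in>homs S - P. u \<otimes> (a \<otimes> e) = u \<otimes> (c \<otimes> b))"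
  unfolding hfrac_def hpair_def by auto

lemma hfracE:
  assumes "(c, e) \<in> fr a b"
  obtains u where "u \<in> homs S - P" "u \<otimes> (a \<otimes> e) = u \<otimes> (c \<otimes> b)"
  using assms unfolding mem_hfrac by (auto; blast)

lemma hfrac_hpair: "(c, e) \<in> fr a b \<Longrightarrow> hp c e"
  by (simp add: mem_hfrac)

lemma hfrac_refl: "hp a b \<Longrightarrow> (a, b) \<in> fr a b"
  unfolding mem_hfrac using homs_one by blast

lemma hfrac_sym:
  assumes "hp a b" "(c, e) \<in> fr a b"
  shows "(a, b) \<in> fr c e"
  using assms unfolding mem_hfrac by metis

text \<open>The witness for the composite relation is \<open>u v e\<close>. The middle denominator
  \<open>e\<close> has to be cancelled; it is homogeneous and outside \<open>P\<close>, so it may be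
  absorbed into the witness.\<close>

lemma hfrac_trans:
  assumes ab: "hp a b" and ce: "(c, e) \<in> fr a b" and xy: "(x, y) \<in> fr c e"
  shows "(x, y) \<in> fr a b"
proof -
  obtain u where u: "u \<in> homs S - P" "u \<otimes> (a \<otimes> e) = u \<otimes> (c \<otimes> b)" using ce by (rule hfracE)
  obtain v where v: "v \<in> homs S - P" "v \<otimes> (c \<otimes> y) = v \<otimes> (x \<otimes> e)" using xy by (rule hfracE)
  have hp: "hp c e" "hp x y" using ce xy by (simp_all add: hfrac_hpair)
  note [simp] = hpairD(1,2)[OF ab] hpairD(1,2)[OF hp(1)] hpairD(1,2)[OF hp(2)] homs_carrier[OF u(1)] homs_carrier[OF v(1)]
  have "(u \<otimes> v \<otimes> e) \<otimes> (a \<otimes> y) = (u \<otimes> (a \<otimes> e)) \<otimes> (v \<otimes> y)"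
    by (simp add: m_ac)
  also have "\<dots> = (v \<otimes> (c \<otimes> y)) \<otimes> (u \<otimes> b)"
    unfolding u(2) by (simp add: m_ac)
  also have "\<dots> = (u \<otimes> v \<otimes> e) \<otimes> (x \<otimes> b)"
    unfolding v(2) by (simp add: m_ac)
  finally show ?thesis
    unfolding mem_hfrac using hp homs_mult[OF homs_mult[OF u(1) v(1)] hpairD(3)[OF hp(1)]] by blast
qed

lemma hfrac_eqI:
  assumes "hp a b" "(c, e) \<in> fr a b"
  shows "fr c e = fr a b"
proof -
  have ce: "hp c e" using assms by (simp add: hfrac_hpair)
  have "(x, y) \<in> fr c e \<longleftrightarrow> (x, y) \<in> fr a b" for x y
    using hfrac_trans[OF assms] hfrac_trans[OF ce hfrac_sym[OF assms]] by blast
  then show ?thesis by (simp add: set_eq_iff)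
qed

lemma hfrac_eq_iff:
  assumes "hp a b" "hp c e"
  shows "fr a b = fr c e \<longleftrightarrow> (\<exists>u\<in>homs S - P. u \<otimes> (a \<otimes> e) = u \<otimes> (c \<otimes> b))"
  using hfrac_eqI[OF assms(1), of c e] hfrac_refl[OF assms(2)] assms(2) mem_hfrac[of c e a b] by blast

lemma hfrac_cross_eq:
  assumes "hp a b" "hp c e" "a \<otimes> e = c \<otimes> b"
  shows "fr a b = fr c e"
  using assms homs_one by (auto simp: hfrac_eq_iff)

lemma hpair_mult: "hp a b \<Longrightarrow> hp c e \<Longrightarrow> hp (a \<otimes> c) (b \<otimes> e)"
  unfolding hpair_def using hpart_mult I_prime hpart_carrier by metis

lemma hpair_add:
  assumes "hp a b" "hp c e"
  shows "hp (a \<otimes> e \<oplus> c \<otimes> b) (b \<otimes> e)"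
proof -
  obtain d d' where d: "a \<in> hpart S d" "b \<in> hpart S d" "c \<in> hpart S d'" "e \<in> hpart S d'" "b \<notin> P" "e \<notin> P"
    using assms unfolding hpair_def by blast
  have "a \<otimes> e \<in> hpart S (d + d')" "c \<otimes> b \<in> hpart S (d + d')" "b \<otimes> e \<in> hpart S (d + d')"
    using d hpart_mult add.commute by metis+
  moreover have "b \<otimes> e \<notin> P" using d I_prime hpart_carrier by blast
  ultimately show ?thesis
    unfolding hpair_def by (intro conjI exI[of _ "d + d'"]) (auto intro: hpart_add)
qed

lemma hpair_uminus: "hp a b \<Longrightarrow> hp (\<ominus> a) b"
  unfolding hpair_def using hpart_uminus by blast

lemma hpair_one: "hp \<one> \<one>" and hpair_zero: "hp \<zero> \<one>"
  unfolding hpair_def using hpart_one hpart_zero one_notin by blast+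

lemma L_carrier: "carrier L = {fr a b | a b. hp a b}"
  by (simp add: hlocalization_def hpair_def)

lemma L_carrierE:
  assumes "v \<in> carrier L" obtains a b where "hp a b" "v = fr a b"
  using assms L_carrier by auto

lemma L_carrierI: "hp a b \<Longrightarrow> fr a b \<in> carrier L"
  unfolding L_carrier by blast

lemma L_one: "\<one>\<^bsub>L\<^esub> = fr \<one> \<one>" and L_zero: "\<zero>\<^bsub>L\<^esub> = fr \<zero> \<one>"
  by (simp_all add: hlocalization_def)

text \<open>The operation is a union over all pairs of representatives. It collapses to one class
  because every pair yields the same class, with witness \<open>u v\<close>, and because both index
  classes are nonempty by \<open>hfrac_refl\<close>.\<close>

lemma L_mult:
  assumes ab: "hp a b" and ce: "hp c e"
  shows "fr a b \<otimes>\<^bsub>L\<^esub> fr c e = fr (a \<otimes> c) (b \<otimes> e)"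
proof -
  have *: "fr (a' \<otimes> c') (b' \<otimes> e') = fr (a \<otimes> c) (b \<otimes> e)"
    if ab': "(a', b') \<in> fr a b" and ce': "(c', e') \<in> fr c e" for a' b' c' e'
  proof -
    obtain u where u: "u \<in> homs S - P" "u \<otimes> (a \<otimes> b') = u \<otimes> (a' \<otimes> b)" using ab' by (rule hfracE)
    obtain v where v: "v \<in> homs S - P" "v \<otimes> (c \<otimes> e') = v \<otimes> (c' \<otimes> e)" using ce' by (rule hfracE)
    have hp: "hp a' b'" "hp c' e'" using ab' ce' by (simp_all add: hfrac_hpair)
    note [simp] = hpairD(1,2)[OF ab] hpairD(1,2)[OF ce] hpairD(1,2)[OF hp(1)] hpairD(1,2)[OF hp(2)] homs_carrier[OF u(1)] homs_carrier[OF v(1)]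
    have "(u \<otimes> v) \<otimes> ((a \<otimes> c) \<otimes> (b' \<otimes> e')) = (u \<otimes> (a \<otimes> b')) \<otimes> (v \<otimes> (c \<otimes> e'))"
      by (simp add: m_ac)
    also have "\<dots> = (u \<otimes> v) \<otimes> ((a' \<otimes> c') \<otimes> (b \<otimes> e))"
      unfolding u(2) v(2) by (simp add: m_ac)
    finally show ?thesis
      using hfrac_eq_iff[OF hpair_mult[OF ab ce] hpair_mult[OF hp]] homs_mult[OF u(1) v(1)] by metis
  qed
  have "fr a b \<otimes>\<^bsub>L\<^esub> fr c e = (\<Union>(a, b)\<in>fr a b. \<Union>(c, e)\<in>fr c e. fr (a \<otimes> c) (b \<otimes> e))"
    by (simp add: hlocalization_def)
  then show ?thesis using * hfrac_refl[OF ab] hfrac_refl[OF ce] by fast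
qed

lemma L_add:
  assumes ab: "hp a b" and ce: "hp c e"
  shows "fr a b \<oplus>\<^bsub>L\<^esub> fr c e = fr (a \<otimes> e \<oplus> c \<otimes> b) (b \<otimes> e)"
proof -
  have *: "fr (a' \<otimes> e' \<oplus> c' \<otimes> b') (b' \<otimes> e') = fr (a \<otimes> e \<oplus> c \<otimes> b) (b \<otimes> e)"
    if ab': "(a', b') \<in> fr a b" and ce': "(c', e') \<in> fr c e" for a' b' c' e'
  proof -
    obtain u where u: "u \<in> homs S - P" "u \<otimes> (a \<otimes> b') = u \<otimes> (a' \<otimes> b)" using ab' by (rule hfracE)
    obtain v where v: "v \<in> homs S - P" "v \<otimes> (c \<otimes> e') = v \<otimes> (c' \<otimes> e)" using ce' by (rule hfracE)
    have hp: "hp a' b'" "hp c' e'" using ab' ce' by (simp_all add: hfrac_hpair)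
    note [simp] = hpairD(1,2)[OF ab] hpairD(1,2)[OF ce] hpairD(1,2)[OF hp(1)] hpairD(1,2)[OF hp(2)] homs_carrier[OF u(1)] homs_carrier[OF v(1)]
    have "(u \<otimes> v) \<otimes> ((a \<otimes> e \<oplus> c \<otimes> b) \<otimes> (b' \<otimes> e')) =
        (u \<otimes> (a \<otimes> b')) \<otimes> (v \<otimes> (e \<otimes> e')) \<oplus> (v \<otimes> (c \<otimes> e')) \<otimes> (u \<otimes> (b \<otimes> b'))"
      by (simp add: m_ac l_distr r_distr)
    also have "\<dots> = (u \<otimes> v) \<otimes> ((a' \<otimes> e' \<oplus> c' \<otimes> b') \<otimes> (b \<otimes> e))"
      unfolding u(2) v(2) by (simp add: m_ac l_distr r_distr)
    finally show ?thesis
      using hfrac_eq_iff[OF hpair_add[OF ab ce] hpair_add[OF hp]] homs_mult[OF u(1) v(1)] by metis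
  qed
  have "fr a b \<oplus>\<^bsub>L\<^esub> fr c e = (\<Union>(a, b)\<in>fr a b. \<Union>(c, e)\<in>fr c e. fr (a \<otimes> e \<oplus> c \<otimes> b) (b \<otimes> e))"
    by (simp add: hlocalization_def)
  then show ?thesis using * hfrac_refl[OF ab] hfrac_refl[OF ce] by fast
qed

text \<open>Turns vanishing at a point into an equation in \<open>S\<close>; reducedness and the
  description of the ideal sheaf both start from it.\<close>

lemma hfrac_eq_zero_iff:
  assumes "hp a b"
  shows "fr a b = \<zero>\<^bsub>L\<^esub> \<longleftrightarrow> (\<exists>u\<in>homs S - P. u \<otimes> a = \<zero>)"
proof -
  have "u \<otimes> (a \<otimes> \<one>) = u \<otimes> (\<zero> \<otimes> b) \<longleftrightarrow> u \<otimes> a = \<zero>" if "u \<in> homs S - P" for u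
    using that hpairD[OF assms] homs_carrier by simp
  then show ?thesis unfolding L_zero hfrac_eq_iff[OF assms hpair_zero] by blast
qed

lemma L_add_uminus:
  assumes "hp a b"
  shows "fr (\<ominus> a) b \<oplus>\<^bsub>L\<^esub> fr a b = \<zero>\<^bsub>L\<^esub>"
proof -
  note [simp] = hpairD(1,2)[OF assms]
  have "fr (\<ominus> a \<otimes> b \<oplus> a \<otimes> b) (b \<otimes> b) = fr \<zero> \<one>"
    using assms hpair_uminus
    by (intro hfrac_cross_eq hpair_add hpair_zero) (simp_all add: l_minus l_neg)
  then show ?thesis using assms by (simp add: L_add hpair_uminus L_zero)
qed

lemma L_cring: "cring L"
proof (intro cringI abelian_groupI comm_monoidI)
  fix x y assume "x \<in> carrier L" "y \<in> carrier L"
  then obtain a b c e where xy: "hp a b" "x = fr a b" "hp c e" "y = fr c e" by (metis L_carrierE)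
  note [simp] = hpairD(1,2)[OF xy(1)] hpairD(1,2)[OF xy(3)]
  show "x \<oplus>\<^bsub>L\<^esub> y \<in> carrier L" "x \<otimes>\<^bsub>L\<^esub> y \<in> carrier L"
    using xy by (simp_all add: L_add L_mult L_carrierI hpair_add hpair_mult)
  show "x \<oplus>\<^bsub>L\<^esub> y = y \<oplus>\<^bsub>L\<^esub> x" "x \<otimes>\<^bsub>L\<^esub> y = y \<otimes>\<^bsub>L\<^esub> x"
    using xy by (simp_all add: L_add L_mult m_comm a_comm)
next
  fix x y z assume "x \<in> carrier L" "y \<in> carrier L" "z \<in> carrier L"
  then obtain a b c e f g where xy: "hp a b" "x = fr a b" "hp c e" "y = fr c e" "hp f g" "z = fr f g"
    by (metis L_carrierE)
  note [simp] = hpairD(1,2)[OF xy(1)] hpairD(1,2)[OF xy(3)] hpairD(1,2)[OF xy(5)]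
  show "x \<otimes>\<^bsub>L\<^esub> y \<otimes>\<^bsub>L\<^esub> z = x \<otimes>\<^bsub>L\<^esub> (y \<otimes>\<^bsub>L\<^esub> z)"
    using xy by (simp add: L_mult hpair_mult m_assoc)
  have "x \<oplus>\<^bsub>L\<^esub> y \<oplus>\<^bsub>L\<^esub> z = fr ((a \<otimes> e \<oplus> c \<otimes> b) \<otimes> g \<oplus> f \<otimes> (b \<otimes> e)) (b \<otimes> e \<otimes> g)"
    using xy by (simp add: L_add hpair_add)
  also have "\<dots> = fr (a \<otimes> (e \<otimes> g) \<oplus> (c \<otimes> g \<oplus> f \<otimes> e) \<otimes> b) (b \<otimes> (e \<otimes> g))"
    by (rule arg_cong2[where f = fr]) (simp_all add: m_ac a_ac l_distr r_distr)
  also have "\<dots> = x \<oplus>\<^bsub>L\<^esub> (y \<oplus>\<^bsub>L\<^esub> z)"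
    using xy by (simp add: L_add hpair_add)
  finally show "x \<oplus>\<^bsub>L\<^esub> y \<oplus>\<^bsub>L\<^esub> z = x \<oplus>\<^bsub>L\<^esub> (y \<oplus>\<^bsub>L\<^esub> z)" .
  have "(x \<oplus>\<^bsub>L\<^esub> y) \<otimes>\<^bsub>L\<^esub> z = fr ((a \<otimes> e \<oplus> c \<otimes> b) \<otimes> f) (b \<otimes> e \<otimes> g)"
    using xy by (simp add: L_add L_mult hpair_add)
  \<comment> \<open>For associativity both sides are literally the same fraction; here the
    denominators \<open>b e g\<close> and \<open>b g e g\<close> differ, so cross-multiplication is
    required.\<close>
  also have "\<dots> = fr (a \<otimes> f \<otimes> (e \<otimes> g) \<oplus> c \<otimes> f \<otimes> (b \<otimes> g)) (b \<otimes> g \<otimes> (e \<otimes> g))"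
    using xy by (intro hfrac_cross_eq hpair_add hpair_mult) (simp_all add: m_ac l_distr r_distr)
  also have "\<dots> = x \<otimes>\<^bsub>L\<^esub> z \<oplus>\<^bsub>L\<^esub> y \<otimes>\<^bsub>L\<^esub> z"
    using xy by (simp add: L_add L_mult hpair_mult)
  finally show "(x \<oplus>\<^bsub>L\<^esub> y) \<otimes>\<^bsub>L\<^esub> z = x \<otimes>\<^bsub>L\<^esub> z \<oplus>\<^bsub>L\<^esub> y \<otimes>\<^bsub>L\<^esub> z" .
next
  fix x assume "x \<in> carrier L"
  then obtain a b where x: "hp a b" "x = fr a b" by (metis L_carrierE)
  note [simp] = hpairD(1,2)[OF x(1)]
  show "\<zero>\<^bsub>L\<^esub> \<oplus>\<^bsub>L\<^esub> x = x" "\<one>\<^bsub>L\<^esub> \<otimes>\<^bsub>L\<^esub> x = x"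
    using x by (simp_all add: L_add L_mult L_zero L_one hpair_zero hpair_one)
  show "\<exists>y\<in>carrier L. y \<oplus>\<^bsub>L\<^esub> x = \<zero>\<^bsub>L\<^esub>"
    using L_add_uminus[OF x(1)] x hpair_uminus L_carrierI by blast
qed (simp_all add: L_zero L_one L_carrierI hpair_zero hpair_one)

definition L_max :: "('a \<times> 'a) set set" where
  "L_max = {fr a b | a b. hp a b \<and> a \<in> P}"

text \<open>Whether the numerator lies in \<open>P\<close> does not depend on the representative:
  the cross relation puts \<open>u a e\<close> into \<open>P\<close>, and \<open>u\<close> and
  \<open>e\<close> lie outside this prime.\<close>

lemma mem_L_max:
  assumes "hp a b" shows "fr a b \<in> L_max \<longleftrightarrow> a \<in> P"
proof
  assume "fr a b \<in> L_max"
  then obtain c e where ce: "fr a b = fr c e" "hp c e" "c \<in> P" unfolding L_max_def by blast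
  then obtain u where u: "u \<in> homs S - P" "u \<otimes> (a \<otimes> e) = u \<otimes> (c \<otimes> b)"
    using assms by (auto simp: hfrac_eq_iff)
  have "u \<otimes> (a \<otimes> e) \<in> P"
    unfolding u(2) using ce hpairD assms u homs_carrier I_l_closed I_r_closed by simp
  then show "a \<in> P"
    using I_prime ce(2) hpairD u homs_carrier assms by (metis DiffD2 m_closed)
qed (use assms L_max_def in blast)

lemma L_max_ideal: "ideal L_max L"
proof -
  interpret L: cring L by (rule L_cring)
  show ?thesis
  proof (intro idealI L.ring_axioms)
    show "subgroup L_max (add_monoid L)"
    proof (rule L.add.subgroupI)
      show "L_max \<subseteq> carrier L" unfolding L_max_def L_carrier by blast
      have "fr \<zero> \<one> \<in> L_max" using mem_L_max[OF hpair_zero] by simp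
      then show "L_max \<noteq> {}" by blast
    next
      fix x assume "x \<in> L_max"
      then obtain a b where x: "hp a b" "x = fr a b" "a \<in> P" unfolding L_max_def by blast
      note [simp] = hpairD(1,2)[OF x(1)]
      have "\<ominus>\<^bsub>L\<^esub> x = fr (\<ominus> a) b"
        using L_add_uminus[OF x(1)] x L_carrierI hpair_uminus L.minus_equality by metis
      then show "\<ominus>\<^bsub>L\<^esub> x \<in> L_max"
        using x mem_L_max[OF hpair_uminus[OF x(1)]] by simp
    next
      fix x y assume "x \<in> L_max" "y \<in> L_max"
      then obtain a b c e where xy: "hp a b" "x = fr a b" "a \<in> P" "hp c e" "y = fr c e" "c \<in> P"
        unfolding L_max_def by blast
      then show "x \<oplus>\<^bsub>L\<^esub> y \<in> L_max"
        using mem_L_max[OF hpair_add[OF xy(1,4)]] hpairD by (simp add: L_add I_r_closed)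
    qed
  next
    fix a x assume "a \<in> L_max" "x \<in> carrier L"
    then obtain c e f g where *: "hp c e" "a = fr c e" "c \<in> P" "hp f g" "x = fr f g"
      unfolding L_max_def by (auto elim: L_carrierE)
    show "x \<otimes>\<^bsub>L\<^esub> a \<in> L_max" "a \<otimes>\<^bsub>L\<^esub> x \<in> L_max"
      using * mem_L_max[OF hpair_mult[OF *(1,4)]] mem_L_max[OF hpair_mult[OF *(4,1)]] hpairD
      by (simp_all add: L_mult I_r_closed I_l_closed)
  qed
qed

lemma L_one_notin_max: "\<one>\<^bsub>L\<^esub> \<notin> L_max"
  unfolding L_one mem_L_max[OF hpair_one] by (rule one_notin)

text \<open>Outside \<open>L_max\<close> the numerator avoids \<open>P\<close>, so
  \<open>b/a\<close> is an admissible fraction and inverts \<open>a/b\<close>.\<close>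

lemma L_units:
  assumes "v \<in> carrier L" "v \<notin> L_max"
  shows "\<exists>w\<in>carrier L. v \<otimes>\<^bsub>L\<^esub> w = \<one>\<^bsub>L\<^esub>"
proof -
  obtain a b where ab: "hp a b" "v = fr a b" using assms L_carrierE by blast
  then have "a \<notin> P" using assms mem_L_max by blast
  then have ba: "hp b a" using ab(1) unfolding hpair_def by blast
  have "fr a b \<otimes>\<^bsub>L\<^esub> fr b a = \<one>\<^bsub>L\<^esub>"
    unfolding L_mult[OF ab(1) ba] L_one
    using hpair_mult[OF ab(1) ba] hpair_one hpairD(1,2)[OF ab(1)]
    by (intro hfrac_cross_eq) (simp_all add: m_comm[of a b])
  then show ?thesis using ab ba L_carrierI by blast
qed

end

text \<open>An ideal not contained in \<open>M\<close> has an element \<open>v\<close> outside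
  \<open>M\<close>, and \<open>v w = 1\<close> makes it the whole ring. Hence \<open>M\<close>
  contains every proper ideal.\<close>

lemma maximalideal_iff_of_units:
  assumes "ring A" "ideal M A" "\<one>\<^bsub>A\<^esub> \<notin> M"
    and units: "\<And>v. v \<in> carrier A \<Longrightarrow> v \<notin> M \<Longrightarrow> \<exists>w\<in>carrier A. v \<otimes>\<^bsub>A\<^esub> w = \<one>\<^bsub>A\<^esub>"
  shows "maximalideal N A \<longleftrightarrow> N = M"
proof -
  interpret ring A by fact
  interpret M: ideal M A by fact
  have sub: "J \<subseteq> M" if "ideal J A" "J \<noteq> carrier A" for J
  proof
    interpret J: ideal J A by fact
    fix v assume "v \<in> J"
    show "v \<in> M"
    proof (rule ccontr)
      assume "v \<notin> M"
      then obtain w where "w \<in> carrier A" "v \<otimes>\<^bsub>A\<^esub> w = \<one>\<^bsub>A\<^esub>"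
        using units \<open>v \<in> J\<close> J.Icarr by blast
      then have "\<one>\<^bsub>A\<^esub> \<in> J" using J.I_r_closed \<open>v \<in> J\<close> by metis
      then show False using J.one_imp_carrier that by blast
    qed
  qed
  have M: "maximalideal M A"
  proof (intro maximalidealI assms)
    show "carrier A \<noteq> M" using assms(3) by auto
    fix J assume "ideal J A" "M \<subseteq> J" "J \<subseteq> carrier A"
    then show "J = M \<or> J = carrier A" using sub by blast
  qed
  show ?thesis
  proof
    assume N: "maximalideal N A"
    then interpret N: maximalideal N A .
    have "N \<subseteq> M" using sub N.I_notcarr N.ideal_axioms by blast
    then show "N = M" using N.I_maximal[OF M.ideal_axioms] M.Icarr assms(3) by blast
  qed (use M in blast)
qed

text \<open>Membership in \<open>ring_iso\<close> says nothing about the field \<open>zero\<close>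
  of the target record, and \<open>B\<close> is not yet known to be a ring; hence the separate
  equation for zero.\<close>

lemma ring_iso_cring:
  assumes "cring A" "f \<in> ring_iso A B" "f \<zero>\<^bsub>A\<^esub> = \<zero>\<^bsub>B\<^esub>"
  shows "cring B"
  using cring.ring_iso_imp_img_cring[OF assms(1,2)] assms(3) by simp

text \<open>Surjectivity enters through absorption: a multiplier from \<open>B\<close> has to be
  lifted to \<open>A\<close>.\<close>

lemma ideal_image:
  assumes "ring_hom_ring A B h" "h ` carrier A = carrier B" "ideal M A"
  shows "ideal (h ` M) B"
proof -
  interpret ring_hom_ring A B h by fact
  interpret M: ideal M A by fact
  show ?thesis
  proof (intro idealI S.ring_axioms)
    show "subgroup (h ` M) (add_monoid B)"
    proof (rule S.add.subgroupI)
      show "h ` M \<subseteq> carrier B" using M.Icarr by auto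
      show "h ` M \<noteq> {}" using M.zero_closed by blast
    next
      fix x assume "x \<in> h ` M"
      then obtain a where "a \<in> M" "x = h a" by blast
      then show "\<ominus>\<^bsub>B\<^esub> x \<in> h ` M" by (intro image_eqI[of _ _ "\<ominus>\<^bsub>A\<^esub> a"]) (auto simp: M.Icarr M.a_inv_closed)
    next
      fix x y assume "x \<in> h ` M" "y \<in> h ` M"
      then obtain a b where "a \<in> M" "x = h a" "b \<in> M" "y = h b" by blast
      then show "x \<oplus>\<^bsub>B\<^esub> y \<in> h ` M" by (intro image_eqI[of _ _ "a \<oplus>\<^bsub>A\<^esub> b"]) (auto simp: M.Icarr)
    qed
  next
    fix a x assume "a \<in> h ` M" "x \<in> carrier B"
    then obtain b y where b: "b \<in> M" "a = h b" "y \<in> carrier A" "x = h y"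
      using assms(2) by blast
    show "x \<otimes>\<^bsub>B\<^esub> a \<in> h ` M"
      using b by (intro image_eqI[of _ _ "y \<otimes>\<^bsub>A\<^esub> b"]) (auto simp: M.Icarr M.I_l_closed)
    show "a \<otimes>\<^bsub>B\<^esub> x \<in> h ` M"
      using b by (intro image_eqI[of _ _ "b \<otimes>\<^bsub>A\<^esub> y"]) (auto simp: M.Icarr M.I_r_closed)
  qed
qed

text \<open>Reduces the condition of \<open>reduced_space\<close>, which speaks of all exponents, to
  squares.\<close>

lemma nilpotent_zero:
  assumes "cring A" and sq: "\<And>s. s \<in> carrier A \<Longrightarrow> s \<otimes>\<^bsub>A\<^esub> s = \<zero>\<^bsub>A\<^esub> \<Longrightarrow> s = \<zero>\<^bsub>A\<^esub>"
    and s: "s \<in> carrier A" "s [^]\<^bsub>A\<^esub> (k::nat) = \<zero>\<^bsub>A\<^esub>"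
  shows "s = \<zero>\<^bsub>A\<^esub>"
proof -
  interpret cring A by fact
  show ?thesis using s(2)
  proof (induction k rule: less_induct)
    case (less k)
    consider "k = 0" | "k = 1" | "k \<ge> 2" by linarith
    then show ?case
    proof cases
      assume "k = 0"
      then have "\<one>\<^bsub>A\<^esub> = \<zero>\<^bsub>A\<^esub>" using less.prems by simp
      then show ?thesis using s(1) l_one l_null by metis
    next
      assume "k = 1" then show ?thesis using less.prems s(1) by simp
    next
      assume k: "k \<ge> 2"
      \<comment> \<open>Half of \<open>k\<close>, rounded up: \<open>2 j \<ge> k\<close> makes the
        square of the \<open>j\<close>-th power vanish. For exponents 0 and 1 this \<open>j\<close>
        would not be smaller than \<open>k\<close>, which is why they are separate cases.\<close>
      define j where "j = (k + 1) div 2"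
      have j: "j < k" "k \<le> j + j" using k unfolding j_def by linarith+
      have "s [^]\<^bsub>A\<^esub> (j + j) = s [^]\<^bsub>A\<^esub> k \<otimes>\<^bsub>A\<^esub> s [^]\<^bsub>A\<^esub> (j + j - k)"
        using s(1) j(2) nat_pow_mult[of s k "j + j - k"] by simp
      then have "s [^]\<^bsub>A\<^esub> j \<otimes>\<^bsub>A\<^esub> s [^]\<^bsub>A\<^esub> j = \<zero>\<^bsub>A\<^esub>"
        using s(1) less.prems by (simp add: nat_pow_mult)
      then have "s [^]\<^bsub>A\<^esub> j = \<zero>\<^bsub>A\<^esub>" using sq[of "s [^]\<^bsub>A\<^esub> j"] nat_pow_closed[OF s(1)] by blast
      then show ?thesis using less.IH j(1) by blast
    qed
  qed
qed

section \<open>Proj as a locally ringed space\<close>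

text \<open>The whole spectrum is open because the zero locus of \<open>carrier R\<close> is empty,
  primes being proper.\<close>

lemma topspace_spec_top: "topspace (spec_top R) = spec R"
proof -
  have "openin (spec_top R) (spec R - zero_locus R (carrier R))"
    unfolding openin_spec_top by blast
  moreover have "zero_locus R (carrier R) = {}"
  proof -
    have "\<not> carrier R \<subseteq> P" if "primeideal P R" for P
    proof
      assume "carrier R \<subseteq> P"
      moreover have "P \<subseteq> carrier R"
        using ideal.Icarr[OF primeideal.axioms(1)[OF that]] by (rule subsetI)
      ultimately show False using primeideal.I_notcarr[OF that] by simp
    qed
    then show ?thesis by (auto simp: zero_locus_def spec_def)
  qed
  ultimately have "spec R \<subseteq> topspace (spec_top R)"
    using openin_subset by fastforce
  moreover have "topspace (spec_top R) \<subseteq> spec R"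
    using openin_spec_top[of R "topspace (spec_top R)"] by auto
  ultimately show ?thesis by blast
qed

lemma topspace_proj_top: "topspace (proj_top S) = proj_set S"
  by (auto simp: proj_top_def topspace_spec_top proj_set_def)

lemma openin_proj_top:
  "openin (proj_top S) V \<longleftrightarrow> (\<exists>E\<subseteq>carrier S. V = {P \<in> proj_set S. \<not> E \<subseteq> P})"
proof -
  have "(spec S - zero_locus S E) \<inter> proj_set S = {P \<in> proj_set S. \<not> E \<subseteq> P}" for E
    by (auto simp: zero_locus_def proj_set_def)
  then show ?thesis
    unfolding proj_top_def openin_subtopology openin_spec_top by auto
qed

lemma openin_proj_subset: "openin (proj_top S) V \<Longrightarrow> V \<subseteq> proj_set S"
  by (auto simp: openin_proj_top)

lemma openin_proj_basic: "f \<in> carrier S \<Longrightarrow> openin (proj_top S) {P \<in> proj_set S. f \<notin> P}"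
  unfolding openin_proj_top by (intro exI[of _ "{f}"]) auto

lemma Proj_simps [simp]:
  "points (Proj S) = proj_top S" "sections (Proj S) = proj_sections S"
  "restr (Proj S) U V s = restrict s V"
  by (simp_all add: Proj_def)

lemma proj_sections_simps [simp]:
  "s \<otimes>\<^bsub>proj_sections S U\<^esub> t = (\<lambda>P\<in>U. s P \<otimes>\<^bsub>hlocalization S P\<^esub> t P)"
  "s \<oplus>\<^bsub>proj_sections S U\<^esub> t = (\<lambda>P\<in>U. s P \<oplus>\<^bsub>hlocalization S P\<^esub> t P)"
  "\<one>\<^bsub>proj_sections S U\<^esub> = (\<lambda>P\<in>U. \<one>\<^bsub>hlocalization S P\<^esub>)"
  "\<zero>\<^bsub>proj_sections S U\<^esub> = (\<lambda>P\<in>U. \<zero>\<^bsub>hlocalization S P\<^esub>)"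
  by (simp_all add: proj_sections_def)

definition locally_fraction ::
    "('a, 'm) graded_ring_scheme \<Rightarrow> 'a set set \<Rightarrow> ('a set \<Rightarrow> ('a \<times> 'a) set) \<Rightarrow> 'a set \<Rightarrow> bool" where
  "locally_fraction S U s P \<longleftrightarrow> (\<exists>V a b. openin (proj_top S) V \<and> P \<in> V \<and> V \<subseteq> U \<and>
     (\<forall>Q\<in>V. hpair S Q a b \<and> s Q = hfrac S Q a b))"

lemma locally_fractionI:
  assumes "openin (proj_top S) V" "P \<in> V" "V \<subseteq> U"
    "\<And>Q. Q \<in> V \<Longrightarrow> hpair S Q a b" "\<And>Q. Q \<in> V \<Longrightarrow> s Q = hfrac S Q a b"
  shows "locally_fraction S U s P"
  using assms unfolding locally_fraction_def by blast

lemma locally_fractionE: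
  assumes "locally_fraction S U s P"
  obtains V a b where "openin (proj_top S) V" "P \<in> V" "V \<subseteq> U"
    "\<And>Q. Q \<in> V \<Longrightarrow> hpair S Q a b" "\<And>Q. Q \<in> V \<Longrightarrow> s Q = hfrac S Q a b"
  using assms unfolding locally_fraction_def by blast

text \<open>The clause that each value lies in its homogeneous localization is absorbed into the
  local condition: \<open>s P\<close> is the class at \<open>P\<close> of the local fraction around
  \<open>P\<close>.\<close>

lemma sections_iff:
  "s \<in> carrier (proj_sections S U) \<longleftrightarrow> s \<in> extensional U \<and> (\<forall>P\<in>U. locally_fraction S U s P)"
    (is "?l \<longleftrightarrow> ?r")
proof
  assume ?l
  then have ext: "s \<in> extensional U"
    and *: "\<And>P. P \<in> U \<Longrightarrow> \<exists>V. openin (proj_top S) V \<and> P \<in> V \<and> V \<subseteq> U \<and>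
         (\<exists>a b. (\<exists>d. a \<in> hpart S d \<and> b \<in> hpart S d) \<and> (\<forall>Q\<in>V. b \<notin> Q \<and> s Q = hfrac S Q a b))"
    by (auto simp: proj_sections_def PiE_def)
  have "locally_fraction S U s P" if P: "P \<in> U" for P
  proof -
    obtain V a b where V: "openin (proj_top S) V" "P \<in> V" "V \<subseteq> U"
      and ab: "\<exists>d. a \<in> hpart S d \<and> b \<in> hpart S d" "\<forall>Q\<in>V. b \<notin> Q \<and> s Q = hfrac S Q a b"
      using *[OF P] by blast
    then show ?thesis by (intro locally_fractionI[OF V, of a b]) (auto simp: hpair_def)
  qed
  then show ?r using ext by blast
next
  assume r: ?r
  have "s P \<in> carrier (hlocalization S P) \<and> (\<exists>V. openin (proj_top S) V \<and> P \<in> V \<and> V \<subseteq> U \<and>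
         (\<exists>a b. (\<exists>d. a \<in> hpart S d \<and> b \<in> hpart S d) \<and> (\<forall>Q\<in>V. b \<notin> Q \<and> s Q = hfrac S Q a b)))"
    if "P \<in> U" for P
  proof -
    have "locally_fraction S U s P" using r that by blast
    then obtain V a b where V: "openin (proj_top S) V" "P \<in> V" "V \<subseteq> U"
      and ab: "\<And>Q. Q \<in> V \<Longrightarrow> hpair S Q a b" "\<And>Q. Q \<in> V \<Longrightarrow> s Q = hfrac S Q a b"
      by (rule locally_fractionE) blast
    have "\<exists>d. a \<in> hpart S d \<and> b \<in> hpart S d" "\<forall>Q\<in>V. b \<notin> Q \<and> s Q = hfrac S Q a b"
      using ab V by (auto simp: hpair_def)
    moreover have "s P \<in> carrier (hlocalization S P)"
      using ab[OF V(2)] unfolding hlocalization_def hpair_def by simp blast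
    ultimately show ?thesis using V by blast
  qed
  then show ?l using r by (auto simp: proj_sections_def PiE_def)
qed

lemma sections_extensional: "s \<in> carrier (proj_sections S U) \<Longrightarrow> s \<in> extensional U"
  and sections_locally_fraction: "s \<in> carrier (proj_sections S U) \<Longrightarrow> P \<in> U \<Longrightarrow> locally_fraction S U s P"
  by (auto simp: sections_iff)

lemma sections_in_L: "s \<in> carrier (proj_sections S U) \<Longrightarrow> P \<in> U \<Longrightarrow> s P \<in> carrier (hlocalization S P)"
  by (auto simp: proj_sections_def)

lemma frac_section:
  assumes U: "openin (proj_top S) U" and ab: "\<And>P. P \<in> U \<Longrightarrow> hpair S P a b"
  shows "(\<lambda>P\<in>U. hfrac S P a b) \<in> carrier (proj_sections S U)"
  unfolding sections_iff using U ab by (auto intro!: locally_fractionI[of S U _ _ a b])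

lemma restrict_section:
  assumes s: "s \<in> carrier (proj_sections S U)" and V: "openin (proj_top S) V" "V \<subseteq> U"
  shows "restrict s V \<in> carrier (proj_sections S V)"
  unfolding sections_iff
proof (intro conjI ballI)
  fix P assume P: "P \<in> V"
  then have "locally_fraction S U s P" using sections_locally_fraction[OF s] V by blast
  then obtain W a b where W: "openin (proj_top S) W" "P \<in> W" "W \<subseteq> U"
    and ab: "\<And>Q. Q \<in> W \<Longrightarrow> hpair S Q a b" "\<And>Q. Q \<in> W \<Longrightarrow> s Q = hfrac S Q a b"
    by (rule locally_fractionE) blast
  show "locally_fraction S V (restrict s V) P"
    by (rule locally_fractionI[of _ "W \<inter> V" _ _ a b]) (use W V P ab in auto)
qed simp

section \<open>Rings of sections, the sheaf property, stalks and reducedness\<close>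

context graded_cring
begin

abbreviation "X \<equiv> Proj S"

lemma proj_prime: "P \<in> proj_set S \<Longrightarrow> graded_prime S P"
  using graded_cring_axioms by (auto simp: proj_set_def spec_def graded_prime_def)

text \<open>Equality of two fractions at \<open>x\<close> is one equation
  \<open>u a e = u c b\<close> in \<open>S\<close>, and it remains a valid witness at every prime
  that avoids \<open>u\<close>, which is an open condition.\<close>

lemma section_near_eq:
  assumes s: "s \<in> carrier (proj_sections S U)" "x \<in> U" and t: "t \<in> carrier (proj_sections S V)" "x \<in> V"
    and eq: "s x = t x"
  obtains W where "openin (proj_top S) W" "x \<in> W" "W \<subseteq> U \<inter> V" "\<And>y. y \<in> W \<Longrightarrow> s y = t y"
proof -
  obtain W1 a b where W1: "openin (proj_top S) W1" "x \<in> W1" "W1 \<subseteq> U"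
    and ab: "\<And>Q. Q \<in> W1 \<Longrightarrow> hpair S Q a b" "\<And>Q. Q \<in> W1 \<Longrightarrow> s Q = hfrac S Q a b"
    using sections_locally_fraction[OF s] by (rule locally_fractionE) blast
  obtain W2 c e where W2: "openin (proj_top S) W2" "x \<in> W2" "W2 \<subseteq> V"
    and ce: "\<And>Q. Q \<in> W2 \<Longrightarrow> hpair S Q c e" "\<And>Q. Q \<in> W2 \<Longrightarrow> t Q = hfrac S Q c e"
    using sections_locally_fraction[OF t] by (rule locally_fractionE) blast
  interpret x: graded_prime S x using W1 openin_proj_subset by (blast intro: proj_prime)
  obtain u where u: "u \<in> homs S - x" "u \<otimes> (a \<otimes> e) = u \<otimes> (c \<otimes> b)"
    using eq ab[OF W1(2)] ce[OF W2(2)] x.hfrac_eq_iff by metis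
  define W where "W = W1 \<inter> W2 \<inter> {P \<in> proj_set S. u \<notin> P}"
  have "x \<in> proj_set S" using W1 openin_proj_subset by blast
  then have "openin (proj_top S) W" "x \<in> W" "W \<subseteq> U \<inter> V"
    unfolding W_def using W1 W2 u openin_proj_basic[of u S] x.homs_carrier by auto
  moreover have "s y = t y" if "y \<in> W" for y
  proof -
    interpret y: graded_prime S y using that W_def by (blast intro: proj_prime)
    have "hfrac S y a b = hfrac S y c e"
      using that u ab(1) ce(1) by (subst y.hfrac_eq_iff) (auto simp: W_def)
    then show ?thesis using that ab(2) ce(2) by (simp add: W_def)
  qed
  ultimately show ?thesis using that by blast
qed

text \<open>One closure argument for all ring operations: \<open>n\<close> and \<open>d\<close> are
  the formulas for numerator and denominator through which the pointwise operation \<open>F\<close>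
  acts on fractions. Negation is the instance that ignores the second section.\<close>

lemma section_pointwise2:
  assumes U: "openin (proj_top S) U"
    and s: "s \<in> carrier (proj_sections S U)" and t: "t \<in> carrier (proj_sections S U)"
    and F: "\<And>Q a b c e. Q \<in> U \<Longrightarrow> hpair S Q a b \<Longrightarrow> hpair S Q c e \<Longrightarrow>
      hpair S Q (n a b c e) (d a b c e) \<and>
      F Q (hfrac S Q a b) (hfrac S Q c e) = hfrac S Q (n a b c e) (d a b c e)"
  shows "(\<lambda>Q\<in>U. F Q (s Q) (t Q)) \<in> carrier (proj_sections S U)"
  unfolding sections_iff
proof (intro conjI ballI)
  fix x assume x: "x \<in> U"
  obtain W1 a b where W1: "openin (proj_top S) W1" "x \<in> W1" "W1 \<subseteq> U"
    and ab: "\<And>Q. Q \<in> W1 \<Longrightarrow> hpair S Q a b" "\<And>Q. Q \<in> W1 \<Longrightarrow> s Q = hfrac S Q a b"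
    using sections_locally_fraction[OF s x] by (rule locally_fractionE) blast
  obtain W2 c e where W2: "openin (proj_top S) W2" "x \<in> W2" "W2 \<subseteq> U"
    and ce: "\<And>Q. Q \<in> W2 \<Longrightarrow> hpair S Q c e" "\<And>Q. Q \<in> W2 \<Longrightarrow> t Q = hfrac S Q c e"
    using sections_locally_fraction[OF t x] by (rule locally_fractionE) blast
  show "locally_fraction S U (\<lambda>Q\<in>U. F Q (s Q) (t Q)) x"
  proof (rule locally_fractionI)
    show "openin (proj_top S) (W1 \<inter> W2)" "x \<in> W1 \<inter> W2" "W1 \<inter> W2 \<subseteq> U"
      using W1 W2 by auto
    fix Q assume Q: "Q \<in> W1 \<inter> W2"
    then have "Q \<in> U" using W1 by blast
    then show "hpair S Q (n a b c e) (d a b c e)"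
      "(\<lambda>Q\<in>U. F Q (s Q) (t Q)) Q = hfrac S Q (n a b c e) (d a b c e)"
      using F[of Q a b c e] ab[of Q] ce[of Q] Q by simp_all
  qed
qed simp

text \<open>The ring laws hold pointwise in the localizations; the content is that the operations
  preserve the property of being locally a fraction.\<close>

lemma sections_cring:
  assumes U: "openin (proj_top S) U"
  shows "cring (proj_sections S U)"
proof -
  let ?O = "proj_sections S U"
  have prime: "graded_prime S Q" if "Q \<in> U" for Q
    using that openin_proj_subset[OF U] proj_prime by blast
  note lc = graded_prime.L_cring[OF prime]
  note lr = cring.axioms(1)[OF lc]
  note lsimps = ring.ring_simprules[OF lr] cring.cring_simprules[OF lc]
  have mult_closed: "s \<otimes>\<^bsub>?O\<^esub> t \<in> carrier ?O" if "s \<in> carrier ?O" "t \<in> carrier ?O" for s t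
    unfolding proj_sections_simps
    by (rule section_pointwise2[OF U that, where n = "\<lambda>a b c e. a \<otimes> c" and d = "\<lambda>a b c e. b \<otimes> e"])
       (simp add: graded_prime.L_mult[OF prime] graded_prime.hpair_mult[OF prime])
  have add_closed: "s \<oplus>\<^bsub>?O\<^esub> t \<in> carrier ?O" if "s \<in> carrier ?O" "t \<in> carrier ?O" for s t
    unfolding proj_sections_simps
    by (rule section_pointwise2[OF U that, where n = "\<lambda>a b c e. a \<otimes> e \<oplus> c \<otimes> b" and d = "\<lambda>a b c e. b \<otimes> e"])
       (simp add: graded_prime.L_add[OF prime] graded_prime.hpair_add[OF prime])
  have one: "\<one>\<^bsub>?O\<^esub> \<in> carrier ?O"
    using frac_section[OF U, of \<one> \<one>] graded_prime.hpair_one[OF prime]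
    by (simp add: graded_prime.L_one[OF prime] cong: restrict_cong)
  have zero: "\<zero>\<^bsub>?O\<^esub> \<in> carrier ?O"
    using frac_section[OF U, of \<zero> \<one>] graded_prime.hpair_zero[OF prime]
    by (simp add: graded_prime.L_zero[OF prime] cong: restrict_cong)
  have uminus: "\<exists>t\<in>carrier ?O. t \<oplus>\<^bsub>?O\<^esub> s = \<zero>\<^bsub>?O\<^esub>" if s: "s \<in> carrier ?O" for s
  proof
    have "\<ominus>\<^bsub>hlocalization S Q\<^esub> (hfrac S Q a b) = hfrac S Q (\<ominus> a) b" if "Q \<in> U" "hpair S Q a b" for Q a b
    proof -
      interpret Q: graded_prime S Q using prime that by blast
      interpret L: cring "hlocalization S Q" by (rule Q.L_cring)
      show ?thesis
        using L.minus_equality[OF Q.L_add_uminus] that Q.L_carrierI Q.hpair_uminus by blast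
    qed
    then show "(\<lambda>Q\<in>U. \<ominus>\<^bsub>hlocalization S Q\<^esub> s Q) \<in> carrier ?O"
      using section_pointwise2[OF U s s, where n = "\<lambda>a b c e. \<ominus> a" and d = "\<lambda>a b c e. b"
          and F = "\<lambda>Q v w. \<ominus>\<^bsub>hlocalization S Q\<^esub> v"] graded_prime.hpair_uminus[OF prime] by simp
    show "(\<lambda>Q\<in>U. \<ominus>\<^bsub>hlocalization S Q\<^esub> s Q) \<oplus>\<^bsub>?O\<^esub> s = \<zero>\<^bsub>?O\<^esub>"
      using sections_in_L[OF s] by (auto simp: lsimps intro!: restrict_ext)
  qed
  have ext: "(\<lambda>Q\<in>U. s Q) = s" if "s \<in> carrier ?O" for s
    using sections_extensional[OF that] by (rule extensional_restrict)
  note inL = sections_in_L[of _ S U]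
  have L_l_one: "\<one>\<^bsub>hlocalization S Q\<^esub> \<otimes>\<^bsub>hlocalization S Q\<^esub> v = v"
    if "Q \<in> U" "v \<in> carrier (hlocalization S Q)" for Q v
    using monoid.l_one[OF ring.is_monoid[OF lr[OF that(1)]] that(2)] .
  show ?thesis
  proof (intro cringI abelian_groupI comm_monoidI mult_closed add_closed one zero uminus)
    fix s assume s: "s \<in> carrier ?O"
    have "\<zero>\<^bsub>?O\<^esub> \<oplus>\<^bsub>?O\<^esub> s = (\<lambda>Q\<in>U. s Q)" "\<one>\<^bsub>?O\<^esub> \<otimes>\<^bsub>?O\<^esub> s = (\<lambda>Q\<in>U. s Q)"
      using s by (simp_all add: lsimps(1-9) L_l_one inL cong: restrict_cong)
    then show "\<zero>\<^bsub>?O\<^esub> \<oplus>\<^bsub>?O\<^esub> s = s" "\<one>\<^bsub>?O\<^esub> \<otimes>\<^bsub>?O\<^esub> s = s"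
      unfolding ext[OF s] .
  qed (auto simp: lsimps inL intro!: restrict_ext)
qed


lemma restrict_ring_hom:
  assumes "openin (proj_top S) U" "openin (proj_top S) V" "V \<subseteq> U"
  shows "(\<lambda>s. restrict s V) \<in> ring_hom (proj_sections S U) (proj_sections S V)"
  using assms by (intro ring_hom_memI) (simp_all add: restrict_section inf_absorb2 subsetD[OF assms(3)] cong: restrict_cong)

lemma presheaf_Proj: "presheaf_of_rings X"
proof -
  have 1: "restr X U V \<in> ring_hom (proj_sections S U) (proj_sections S V)"
    if "openin (proj_top S) U" "openin (proj_top S) V" "V \<subseteq> U" for U V
    using restrict_ring_hom[OF that] by (simp add: Proj_def)
  show ?thesis unfolding presheaf_of_rings_def
    using 1 by (auto simp: sections_cring sections_extensional extensional_restrict inf_absorb2)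
qed

text \<open>Sections are functions subject to a local condition, so compatible families glue as
  functions and the glued function inherits the condition. Off the union of the cover all candidates
  are \<open>undefined\<close>, which completes uniqueness.\<close>

lemma sheaf_Proj: "sheaf_of_rings X"
  unfolding sheaf_of_rings_def
proof (intro conjI allI impI presheaf_Proj, elim conjE)
  fix \<U> and s :: "'a set set \<Rightarrow> 'a set \<Rightarrow> ('a \<times> 'a) set"
  assume A: "\<forall>U\<in>\<U>. openin (points X) U \<and> s U \<in> carrier (sections X U)"
    and B: "\<forall>U\<in>\<U>. \<forall>V\<in>\<U>. restr X U (U \<inter> V) (s U) = restr X V (U \<inter> V) (s V)"
  have op: "\<And>U. U \<in> \<U> \<Longrightarrow> openin (proj_top S) U"
    and sec: "\<And>U. U \<in> \<U> \<Longrightarrow> s U \<in> carrier (proj_sections S U)"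
    using A by simp_all
  have cmp: "restrict (s U) (U \<inter> V) = restrict (s V) (U \<inter> V)" if "U \<in> \<U>" "V \<in> \<U>" for U V
    using B that by (metis Proj_simps(3))
  have cmp': "s U P = s V P" if "U \<in> \<U>" "V \<in> \<U>" "P \<in> U" "P \<in> V" for U V P
    using fun_cong[OF cmp[OF that(1,2)], of P] that(3,4) by simp
  \<comment> \<open>\<open>SOME\<close> picks a member of the cover around \<open>P\<close>; by
    \<open>cmp'\<close> the value does not depend on the pick.\<close>
  define t where "t = (\<lambda>P\<in>\<Union>\<U>. s (SOME U. U \<in> \<U> \<and> P \<in> U) P)"
  have t: "t P = s U P" if "U \<in> \<U>" "P \<in> U" for U P
  proof -
    define V where "V = (SOME U. U \<in> \<U> \<and> P \<in> U)"
    have "V \<in> \<U> \<and> P \<in> V"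
      unfolding V_def by (rule someI[of _ U]) (use that in blast)
    then have "s V P = s U P" using that by (intro cmp') simp_all
    moreover have "t P = s V P" unfolding t_def V_def by (rule restrict_apply') (use that in blast)
    ultimately show ?thesis by simp
  qed
  have restr_t: "restrict t U = s U" if "U \<in> \<U>" for U
    using t[OF that] sections_extensional[OF sec[OF that]] by (auto simp: extensional_def fun_eq_iff)
  have t_sec: "t \<in> carrier (proj_sections S (\<Union>\<U>))"
    unfolding sections_iff
  proof (intro conjI ballI)
    show "t \<in> extensional (\<Union>\<U>)" by (simp add: t_def)
    fix P assume "P \<in> \<Union>\<U>"
    then obtain U where U: "U \<in> \<U>" "P \<in> U" by blast
    obtain V a b where V: "openin (proj_top S) V" "P \<in> V" "V \<subseteq> U"
      and ab: "\<And>Q. Q \<in> V \<Longrightarrow> hpair S Q a b" "\<And>Q. Q \<in> V \<Longrightarrow> s U Q = hfrac S Q a b"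
      using sections_locally_fraction[OF sec[OF U(1)] U(2)] by (rule locally_fractionE) blast
    show "locally_fraction S (\<Union>\<U>) t P"
      by (rule locally_fractionI[OF V(1,2), of _ a b]) (use U V ab t in auto)
  qed
  have uniq: "t' = t"
    if t': "t' \<in> carrier (proj_sections S (\<Union>\<U>))" "\<forall>U\<in>\<U>. restrict t' U = s U" for t'
  proof
    fix P
    show "t' P = t P"
    proof (cases "P \<in> \<Union>\<U>")
      case True
      then obtain U where U: "U \<in> \<U>" "P \<in> U" by blast
      then have "restrict t' U P = restrict t U P" using t'(2) restr_t by simp
      then show ?thesis using U by simp
    next
      case False
      then show ?thesis using sections_extensional[OF t'(1)] by (simp add: t_def extensional_def)
    qed
  qed
  show "\<exists>!t. t \<in> carrier (sections X (\<Union>\<U>)) \<and> (\<forall>U\<in>\<U>. restr X (\<Union>\<U>) U t = s U)"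
    unfolding Proj_simps
  proof (rule ex1I)
    show "t \<in> carrier (proj_sections S (\<Union>\<U>)) \<and> (\<forall>U\<in>\<U>. restrict t U = s U)"
      using t_sec restr_t by blast
  qed (use uniq in blast)
qed

text \<open>An element of a stalk, as an equivalence class, consists of all sections near the point with
  a given value there, so evaluation identifies the stalk with the homogeneous localization.\<close>

definition germ_of :: "'a set \<Rightarrow> ('a \<times> 'a) set \<Rightarrow> ('a set set \<times> ('a set \<Rightarrow> ('a \<times> 'a) set)) set" where
  "germ_of x v = {(V, t). openin (proj_top S) V \<and> x \<in> V \<and> t \<in> carrier (proj_sections S V) \<and> t x = v}"

text \<open>Two sections agree near \<open>x\<close> as soon as they agree at \<open>x\<close>, by
  \<open>section_near_eq\<close>; so the germ depends on the value alone.\<close>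

lemma germ_Proj:
  assumes "openin (proj_top S) U" "x \<in> U" "s \<in> carrier (proj_sections S U)"
  shows "germ X x U s = germ_of x (s x)"
proof -
  have "(\<exists>W. openin (proj_top S) W \<and> x \<in> W \<and> W \<subseteq> U \<inter> V \<and> restrict s W = restrict t W) \<longleftrightarrow> t x = s x"
    if V: "openin (proj_top S) V" "x \<in> V" and t: "t \<in> carrier (proj_sections S V)" for V t
  proof
    assume "\<exists>W. openin (proj_top S) W \<and> x \<in> W \<and> W \<subseteq> U \<inter> V \<and> restrict s W = restrict t W"
    then obtain W where "x \<in> W" "restrict s W = restrict t W" by blast
    then show "t x = s x" by (metis restrict_apply')
  next
    assume "t x = s x"
    then obtain W where "openin (proj_top S) W" "x \<in> W" "W \<subseteq> U \<inter> V" "\<And>y. y \<in> W \<Longrightarrow> s y = t y"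
      using section_near_eq[OF assms(3,2) t V(2)] by metis
    then show "\<exists>W. openin (proj_top S) W \<and> x \<in> W \<and> W \<subseteq> U \<inter> V \<and> restrict s W = restrict t W"
      by (intro exI[of _ W]) (auto intro!: restrict_ext)
  qed
  then have "(V, t) \<in> germ X x U s \<longleftrightarrow> (V, t) \<in> germ_of x (s x)" for V t
    unfolding germ_def germ_of_def by (simp only: mem_Collect_eq case_prod_conv Proj_simps) blast
  then show ?thesis by (simp add: set_eq_iff)
qed

text \<open>The fraction \<open>a/b\<close> representing \<open>v\<close> is meaningful on the whole
  open set of primes avoiding \<open>b\<close>. This makes every class \<open>germ_of x v\<close>
  inhabited, which the unions in \<open>stalk\<close> and the injectivity of evaluation rely
  on.\<close>

lemma germ_of_nonempty:
  assumes x: "x \<in> proj_set S" and v: "v \<in> carrier (hlocalization S x)"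
  obtains U s where "openin (proj_top S) U" "x \<in> U" "s \<in> carrier (proj_sections S U)" "s x = v"
proof -
  interpret x: graded_prime S x using proj_prime[OF x] .
  obtain a b where ab: "hpair S x a b" "v = hfrac S x a b" using v by (rule x.L_carrierE)
  define U where "U = {P \<in> proj_set S. b \<notin> P}"
  have U: "openin (proj_top S) U" "x \<in> U"
    using ab x x.hpairD(2)[OF ab(1)] openin_proj_basic by (auto simp: U_def hpair_def)
  moreover have "(\<lambda>P\<in>U. hfrac S P a b) \<in> carrier (proj_sections S U)"
    using ab(1) by (intro frac_section U) (auto simp: hpair_def U_def)
  ultimately show ?thesis using that ab by auto
qed

lemma mem_germ_of: "(U, s) \<in> germ_of x v \<longleftrightarrow>
    openin (proj_top S) U \<and> x \<in> U \<and> s \<in> carrier (proj_sections S U) \<and> s x = v"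
  by (simp add: germ_of_def)

lemma stalk_op:
  assumes x: "x \<in> proj_set S" and v: "v \<in> carrier (hlocalization S x)" and w: "w \<in> carrier (hlocalization S x)"
    and g: "\<And>U s V t. (U, s) \<in> germ_of x v \<Longrightarrow> (V, t) \<in> germ_of x w \<Longrightarrow> g U s V t = r"
  shows "(\<Union>(U, s)\<in>germ_of x v. \<Union>(V, t)\<in>germ_of x w. g U s V t) = r"
proof -
  obtain U s where "(U, s) \<in> germ_of x v" using germ_of_nonempty[OF x v] mem_germ_of by metis
  moreover obtain V t where "(V, t) \<in> germ_of x w" using germ_of_nonempty[OF x w] mem_germ_of by metis
  ultimately show ?thesis using g by fast
qed

text \<open>Proved before the stalk is known to be a ring: the isomorphism, together with the
  equation for zero, is what transports the ring axioms from the localization to the stalk by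
  \<open>ring_iso_cring\<close>.\<close>

lemma stalk_iso:
  assumes x: "x \<in> proj_set S"
  shows "germ_of x \<in> ring_iso (hlocalization S x) (stalk X x)"
    and "germ_of x \<zero>\<^bsub>hlocalization S x\<^esub> = \<zero>\<^bsub>stalk X x\<^esub>"
proof -
  interpret x: graded_prime S x using proj_prime[OF x] .
  have top: "openin (proj_top S) (proj_set S)"
    using openin_topspace[of "proj_top S"] by (simp add: topspace_proj_top)
  interpret T: cring "proj_sections S (proj_set S)" by (rule sections_cring[OF top])
  have one: "germ_of x \<one>\<^bsub>hlocalization S x\<^esub> = \<one>\<^bsub>stalk X x\<^esub>"
    using germ_Proj[OF top x T.one_closed] x by (simp add: stalk_def topspace_proj_top)
  show "germ_of x \<zero>\<^bsub>hlocalization S x\<^esub> = \<zero>\<^bsub>stalk X x\<^esub>"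
    using germ_Proj[OF top x T.zero_closed] x by (simp add: stalk_def topspace_proj_top)
  have carrier: "carrier (stalk X x) = germ_of x ` carrier (hlocalization S x)"
  proof (intro equalityI subsetI)
    fix A assume "A \<in> carrier (stalk X x)"
    then obtain U s where U: "openin (proj_top S) U" "x \<in> U" "s \<in> carrier (proj_sections S U)"
      and A: "A = germ X x U s"
      by (auto simp: stalk_def)
    show "A \<in> germ_of x ` carrier (hlocalization S x)"
      unfolding A germ_Proj[OF U] by (rule imageI) (rule sections_in_L[OF U(3,2)])
  next
    fix A assume "A \<in> germ_of x ` carrier (hlocalization S x)"
    then obtain v where v: "v \<in> carrier (hlocalization S x)" "A = germ_of x v" by blast
    obtain U s where U: "openin (proj_top S) U" "x \<in> U" "s \<in> carrier (proj_sections S U)" "s x = v"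
      using germ_of_nonempty[OF x v(1)] .
    have "A = germ X x U s" using germ_Proj[OF U(1-3)] U(4) v(2) by simp
    then show "A \<in> carrier (stalk X x)" using U by (auto simp: stalk_def)
  qed
  have inj: "inj_on (germ_of x) (carrier (hlocalization S x))"
  proof (rule inj_onI)
    fix v w assume v: "v \<in> carrier (hlocalization S x)" and eq: "germ_of x v = germ_of x w"
    obtain U s where "(U, s) \<in> germ_of x v" using germ_of_nonempty[OF x v] mem_germ_of by metis
    moreover from this have "(U, s) \<in> germ_of x w" unfolding eq .
    ultimately show "v = w" unfolding mem_germ_of by blast
  qed
  show "germ_of x \<in> ring_iso (hlocalization S x) (stalk X x)"
  proof (rule ring_iso_memI)
    show "bij_betw (germ_of x) (carrier (hlocalization S x)) (carrier (stalk X x))"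
      using inj carrier by (simp add: bij_betw_def)
    show "germ_of x \<one>\<^bsub>hlocalization S x\<^esub> = \<one>\<^bsub>stalk X x\<^esub>" by (rule one)
    show "germ_of x v \<in> carrier (stalk X x)" if "v \<in> carrier (hlocalization S x)" for v
      using that carrier by blast
    fix v w assume vw: "v \<in> carrier (hlocalization S x)" "w \<in> carrier (hlocalization S x)"
    have *: "germ X x (U \<inter> V) (restrict s (U \<inter> V) \<otimes>\<^bsub>proj_sections S (U \<inter> V)\<^esub> restrict t (U \<inter> V)) =
          germ_of x (v \<otimes>\<^bsub>hlocalization S x\<^esub> w)" (is ?m)
        "germ X x (U \<inter> V) (restrict s (U \<inter> V) \<oplus>\<^bsub>proj_sections S (U \<inter> V)\<^esub> restrict t (U \<inter> V)) =
          germ_of x (v \<oplus>\<^bsub>hlocalization S x\<^esub> w)" (is ?a)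
      if "(U, s) \<in> germ_of x v" "(V, t) \<in> germ_of x w" for U s V t
    proof -
      have UV: "openin (proj_top S) (U \<inter> V)" "x \<in> U \<inter> V" using that by (auto simp: mem_germ_of)
      interpret O: cring "proj_sections S (U \<inter> V)" by (rule sections_cring[OF UV(1)])
      have "restrict s (U \<inter> V) \<in> carrier (proj_sections S (U \<inter> V))"
        "restrict t (U \<inter> V) \<in> carrier (proj_sections S (U \<inter> V))"
        using that restrict_section UV(1) mem_germ_of by (metis inf_le1, metis inf_le2)
      note st = O.m_closed[OF this] O.a_closed[OF this]
      show ?m ?a
        using that UV(2) germ_Proj[OF UV st(1)] germ_Proj[OF UV st(2)] by (simp_all add: mem_germ_of)
    qed
    show "germ_of x (v \<otimes>\<^bsub>hlocalization S x\<^esub> w) = germ_of x v \<otimes>\<^bsub>stalk X x\<^esub> germ_of x w"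
      by (subst stalk_def) (simp add: stalk_op[OF x vw *(1), simplified])
    show "germ_of x (v \<oplus>\<^bsub>hlocalization S x\<^esub> w) = germ_of x v \<oplus>\<^bsub>stalk X x\<^esub> germ_of x w"
      by (subst stalk_def) (simp add: stalk_op[OF x vw *(2), simplified])
  qed
qed

lemma stalk_cring: "x \<in> proj_set S \<Longrightarrow> cring (stalk X x)"
  using ring_iso_cring[OF graded_prime.L_cring[OF proj_prime] stalk_iso] .

text \<open>Describing every maximal ideal serves twice: it gives the uniqueness demanded by
  \<open>local_ring\<close>, and it resolves the quantification over all pairs of maximal ideals in
  \<open>local_hom\<close>.\<close>

lemma stalk_maximalideal:
  assumes x: "x \<in> proj_set S"
  shows "maximalideal N (stalk X x) \<longleftrightarrow> N = germ_of x ` graded_prime.L_max S x"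
proof (rule maximalideal_iff_of_units)
  interpret x: graded_prime S x using proj_prime[OF x] .
  interpret L: cring "hlocalization S x" by (rule x.L_cring)
  interpret St: cring "stalk X x" using stalk_cring[OF x] .
  note iso = ring_iso_memE[OF stalk_iso(1)[OF x]]
  interpret ring_hom_ring "hlocalization S x" "stalk X x" "germ_of x"
    using stalk_iso(1)[OF x] by unfold_locales (simp add: ring_iso_def)
  show "ring (stalk X x)" by (rule St.ring_axioms)
  have im: "germ_of x ` carrier (hlocalization S x) = carrier (stalk X x)"
    and inj: "inj_on (germ_of x) (carrier (hlocalization S x))"
    using iso(5) by (auto simp: bij_betw_def)
  show "ideal (germ_of x ` x.L_max) (stalk X x)"
    using ideal_image[OF ring_hom_ring_axioms im x.L_max_ideal] .
  have sub: "x.L_max \<subseteq> carrier (hlocalization S x)" using ideal.Icarr[OF x.L_max_ideal] by blast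
  show "\<one>\<^bsub>stalk X x\<^esub> \<notin> germ_of x ` x.L_max"
    unfolding iso(4)[symmetric] using inj_on_image_mem_iff[OF inj L.one_closed sub] x.L_one_notin_max by simp
  fix A assume A: "A \<in> carrier (stalk X x)" "A \<notin> germ_of x ` x.L_max"
  then obtain v where v: "v \<in> carrier (hlocalization S x)" "A = germ_of x v" using im by blast
  then obtain w where w: "w \<in> carrier (hlocalization S x)" "v \<otimes>\<^bsub>hlocalization S x\<^esub> w = \<one>\<^bsub>hlocalization S x\<^esub>"
    using x.L_units A by blast
  then show "\<exists>B\<in>carrier (stalk X x). A \<otimes>\<^bsub>stalk X x\<^esub> B = \<one>\<^bsub>stalk X x\<^esub>"
    using v iso by (intro bexI[of _ "germ_of x w"]) (simp_all flip: iso(2,4))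
qed

lemma locally_ringed_Proj: "locally_ringed_space X"
  unfolding locally_ringed_space_def local_ring_def
  using sheaf_Proj stalk_cring by (auto simp: stalk_maximalideal topspace_proj_top)

text \<open>If the square of \<open>a/b\<close> vanishes, then \<open>u a a = 0\<close> for some
  homogeneous \<open>u\<close> outside the prime, so \<open>u a\<close> has square zero. Hence
  \<open>u a = 0\<close>, and the same \<open>u\<close> shows that \<open>a/b\<close>
  vanishes.\<close>

lemma reduced_Proj:
  assumes red: "\<And>a. a \<in> carrier S \<Longrightarrow> a \<otimes> a = \<zero> \<Longrightarrow> a = \<zero>"
  shows "reduced_space X"
proof -
  have sq: "s = \<zero>\<^bsub>proj_sections S U\<^esub>"
    if U: "openin (proj_top S) U" and s: "s \<in> carrier (proj_sections S U)"
      "s \<otimes>\<^bsub>proj_sections S U\<^esub> s = \<zero>\<^bsub>proj_sections S U\<^esub>" for U s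
  proof -
    have "s x = \<zero>\<^bsub>hlocalization S x\<^esub>" if x: "x \<in> U" for x
    proof -
      interpret x: graded_prime S x using x openin_proj_subset[OF U] proj_prime by blast
      obtain a b where ab: "hpair S x a b" "s x = hfrac S x a b"
        using sections_in_L[OF s(1) x] by (rule x.L_carrierE)
      note [simp] = x.hpairD(1,2)[OF ab(1)]
      have "hfrac S x (a \<otimes> a) (b \<otimes> b) = \<zero>\<^bsub>hlocalization S x\<^esub>"
        using fun_cong[OF s(2), of x] x ab by (simp add: x.L_mult)
      then obtain u where u: "u \<in> homs S - x" "u \<otimes> (a \<otimes> a) = \<zero>"
        using x.hfrac_eq_zero_iff[OF x.hpair_mult[OF ab(1) ab(1)]] by blast
      note [simp] = x.homs_carrier[OF u(1)]
      have "(u \<otimes> a) \<otimes> (u \<otimes> a) = u \<otimes> (u \<otimes> (a \<otimes> a))" by (simp add: m_ac)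
      then have "u \<otimes> a = \<zero>" using u(2) red[of "u \<otimes> a"] by simp
      then show ?thesis using x.hfrac_eq_zero_iff[OF ab(1)] ab(2) u(1) by blast
    qed
    then show ?thesis using sections_extensional[OF s(1)] by (auto simp: extensional_def fun_eq_iff)
  qed
  have "s = \<zero>\<^bsub>proj_sections S U\<^esub>"
    if U: "openin (proj_top S) U" and s: "s \<in> carrier (proj_sections S U)"
      "s [^]\<^bsub>proj_sections S U\<^esub> k = \<zero>\<^bsub>proj_sections S U\<^esub>" for U s and k :: nat
    by (rule nilpotent_zero[OF sections_cring[OF U] sq[OF U] s])
  then show ?thesis unfolding reduced_space_def by simp
qed

end

section \<open>Closed immersions of Proj\<close>

context graded_cring
begin

lemma hpart_pow: "a \<in> hpart S d \<Longrightarrow> a [^] (k::nat) \<in> hpart S (k * d)"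
proof (induction k)
  case (Suc k)
  then show ?case using hpart_mult[of "a [^] k" "k * d" a d] by (simp add: add.commute)
qed (simp add: hpart_one)

text \<open>An ideal containing all parts of positive degree contains the irrelevant ideal, which
  they generate. The element found here is the denominator of the local generators of the ideal
  sheaf.\<close>

lemma proj_setE_pos:
  assumes "P \<in> proj_set S"
  obtains f e where "f \<in> hpart S e" "0 < e" "f \<notin> P"
proof -
  have "ideal P S" using assms by (auto simp: proj_set_def spec_def intro: primeideal.axioms(1))
  then have "\<not> (\<Union>d\<in>{0<..}. hpart S d) \<subseteq> P"
    using genideal_minimal assms by (auto simp: proj_set_def irrelevant_ideal_def)
  then show ?thesis using that by auto
qed

end

text \<open>Surjectivity is demanded in each degree, so that a fraction lifts with numerator and
  denominator of equal degree. A kernel generated by homogeneous elements makes containment in a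
  prime testable on homogeneous elements, the only ones that can serve as witnesses.\<close>

locale graded_surj = S: graded_cring S + T: graded_cring T + ring_hom_ring S T h
  for S :: "('a, 'm) graded_ring_scheme" and T :: "('b, 'k) graded_ring_scheme" and h +
  assumes hpart_image: "h ` hpart S d = hpart T d"
    and surj: "h ` carrier S = carrier T"
    and ker_homogeneous: "a_kernel S T h = genideal S (a_kernel S T h \<inter> homs S)"
begin

abbreviation "K \<equiv> a_kernel S T h"

definition phi :: "'b set \<Rightarrow> 'a set" where "phi Q = {a \<in> carrier S. h a \<in> Q}"

definition pre :: "'a set set \<Rightarrow> 'b set set" where "pre U = {Q \<in> proj_set T. phi Q \<in> U}"

text \<open>The map induced between the homogeneous localizations at \<open>phi Q\<close> and
  \<open>Q\<close>. Isolating it exhibits the comorphism of \<open>Proj_map\<close> as this map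
  applied point by point.\<close>

definition hm :: "'b set \<Rightarrow> ('a \<times> 'a) set \<Rightarrow> ('b \<times> 'b) set" where
  "hm Q v = (\<Union>(a, b)\<in>v. hfrac T Q (h a) (h b))"

abbreviation "f \<equiv> Proj_map S T h"

lemma Proj_map_simps:
  "pt_map f = phi" "comorph f U s = (\<lambda>Q\<in>pre U. hm Q (s (phi Q)))" "preim (Proj T) f U = pre U"
  by (auto simp: Proj_map_def Let_def phi_def pre_def hm_def preim_def topspace_proj_top fun_eq_iff)

lemma K_iff: "a \<in> K \<longleftrightarrow> a \<in> carrier S \<and> h a = \<zero>\<^bsub>T\<^esub>"
  unfolding a_kernel_def' by blast

section \<open>Homogeneous primes of \<open>T\<close> as homogeneous primes of \<open>S\<close>
  containing the kernel\<close>

lemma ideal_phi: "ideal Q T \<Longrightarrow> ideal (phi Q) S"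
  unfolding phi_def by (rule ideal_vimage)

lemma K_subset_phi: "ideal Q T \<Longrightarrow> K \<subseteq> phi Q"
  by (auto simp: K_iff phi_def additive_subgroup.zero_closed ideal.axioms)

lemma image_phi: "ideal Q T \<Longrightarrow> h ` phi Q = Q"
  using surj ideal.Icarr[of Q T] by (auto simp: phi_def image_iff)

text \<open>If \<open>h a = h b\<close> with \<open>b\<close> in \<open>P\<close>, then
  \<open>a\<close> and \<open>b\<close> differ by an element of \<open>K\<close>, hence of
  \<open>P\<close>.\<close>

lemma phi_image:
  assumes "ideal P S" "K \<subseteq> P" shows "phi (h ` P) = P"
proof (intro equalityI subsetI)
  interpret P: ideal P S by fact
  fix a assume "a \<in> phi (h ` P)"
  then obtain b where a: "a \<in> carrier S" "b \<in> P" "h a = h b" by (auto simp: phi_def)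
  then have "a \<ominus>\<^bsub>S\<^esub> b \<in> K" using P.Icarr by (simp add: K_iff a_minus_def S.r_neg T.r_neg)
  then have "(a \<ominus>\<^bsub>S\<^esub> b) \<oplus>\<^bsub>S\<^esub> b \<in> P" using assms(2) a P.a_closed by blast
  then show "a \<in> P" using a P.Icarr[OF a(2)] by (simp add: a_minus_def S.a_assoc S.l_neg)
qed (use assms in \<open>auto simp: phi_def ideal.Icarr\<close>)

lemma prime_phi: "primeideal Q T \<Longrightarrow> primeideal (phi Q) S"
  unfolding phi_def by (rule primeideal_vimage[OF S.cring_axioms])

lemma hpart_map: "a \<in> hpart S d \<Longrightarrow> h a \<in> hpart T d"
  unfolding hpart_image[symmetric] by (rule imageI)

lemma homs_lift: "t \<in> homs T \<Longrightarrow> \<exists>a\<in>homs S. h a = t"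
  by (auto simp flip: hpart_image)

lemma homogeneous_phi:
  assumes "homogeneous_ideal T Q" shows "homogeneous_ideal S (phi Q)"
proof -
  have Q: "ideal Q T" and gen: "Q = genideal T (Q \<inter> homs T)"
    using assms by (auto simp: homogeneous_ideal_def)
  have id: "ideal (phi Q) S" by (rule ideal_phi[OF Q])
  define J where "J = genideal S (phi Q \<inter> homs S)"
  have sub: "phi Q \<inter> homs S \<subseteq> carrier S" by (auto simp: phi_def)
  have J: "ideal J S" unfolding J_def by (rule S.genideal_ideal[OF sub])
  have JQ: "J \<subseteq> phi Q" unfolding J_def using id by (rule S.genideal_minimal) blast
  have subJ: "phi Q \<inter> homs S \<subseteq> J" unfolding J_def by (rule S.genideal_self[OF sub])
  have "K \<subseteq> J"
  proof (subst ker_homogeneous, rule S.genideal_minimal[OF J])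
    show "K \<inter> homs S \<subseteq> J" using subJ K_subset_phi[OF Q] by blast
  qed
  have "Q \<inter> homs T \<subseteq> h ` J"
  proof
    fix t assume t: "t \<in> Q \<inter> homs T"
    then obtain a where "a \<in> homs S" "h a = t" using homs_lift by blast
    then show "t \<in> h ` J" using t subJ S.hpart_carrier by (auto simp: phi_def)
  qed
  then have "Q \<subseteq> h ` J"
    by (subst gen) (rule T.genideal_minimal[OF ideal_image[OF ring_hom_ring_axioms surj J]])
  then have "phi Q \<subseteq> phi (h ` J)" by (auto simp: phi_def)
  then have "phi Q \<subseteq> J" using phi_image[OF J \<open>K \<subseteq> J\<close>] by simp
  then show ?thesis using JQ id by (auto simp: homogeneous_ideal_def J_def)
qed

lemma irrelevant_phi:
  assumes "ideal Q T" "irrelevant_ideal S \<subseteq> phi Q" shows "irrelevant_ideal T \<subseteq> Q"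
  unfolding irrelevant_ideal_def
proof (rule T.genideal_minimal[OF assms(1)], rule UN_least)
  fix d :: nat assume d: "d \<in> {0<..}"
  have "(\<Union>d\<in>{0<..}. hpart S d) \<subseteq> carrier S" using S.hpart_carrier by blast
  then have "hpart S d \<subseteq> phi Q"
    using S.genideal_self assms(2) d unfolding irrelevant_ideal_def by blast
  then show "hpart T d \<subseteq> Q" unfolding hpart_image[symmetric] by (auto simp: phi_def)
qed

lemma phi_proj: "Q \<in> proj_set T \<Longrightarrow> phi Q \<in> proj_set S"
  using prime_phi homogeneous_phi irrelevant_phi[of Q] primeideal.axioms(1)[of Q T]
  by (auto simp: proj_set_def spec_def)

lemma proj_ideal: "Q \<in> proj_set T \<Longrightarrow> ideal Q T" "P \<in> proj_set S \<Longrightarrow> ideal P S"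
  by (auto simp: proj_set_def spec_def intro: primeideal.axioms(1))

text \<open>Since \<open>K\<close> lies in \<open>P\<close>, \<open>h a\<close> belongs to the image
  of \<open>P\<close> only if \<open>a\<close> belongs to \<open>P\<close> (\<open>memb\<close>).
  Properness, primality and avoidance of the irrelevant ideal are all pulled back to
  \<open>P\<close> through this.\<close>

lemma image_proj:
  assumes P: "P \<in> proj_set S" and KP: "K \<subseteq> P" shows "h ` P \<in> proj_set T"
proof -
  interpret P: primeideal P S using P by (simp add: proj_set_def spec_def)
  have id: "ideal (h ` P) T" by (rule ideal_image[OF ring_hom_ring_axioms surj P.ideal_axioms])
  have eq: "phi (h ` P) = P" by (rule phi_image[OF P.ideal_axioms KP])
  have memb: "a \<in> P" if "a \<in> carrier S" "h a \<in> h ` P" for a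
    using that eq by (auto simp: phi_def)
  have "primeideal (h ` P) T"
  proof (rule primeidealI[OF id T.cring_axioms])
    show "carrier T \<noteq> h ` P"
    proof
      assume "carrier T = h ` P"
      then have "carrier S \<subseteq> P" using memb hom_closed by blast
      then show False using P.I_notcarr P.Icarr by blast
    qed
    fix x y assume "x \<in> carrier T" "y \<in> carrier T" and xy: "x \<otimes>\<^bsub>T\<^esub> y \<in> h ` P"
    then obtain a b where ab: "a \<in> carrier S" "x = h a" "b \<in> carrier S" "y = h b" using surj by blast
    then have "a \<otimes>\<^bsub>S\<^esub> b \<in> P" using xy by (intro memb) simp_all
    then show "x \<in> h ` P \<or> y \<in> h ` P" using P.I_prime ab by blast
  qed
  moreover have "homogeneous_ideal T (h ` P)"
  proof -
    have sub: "h ` P \<inter> homs T \<subseteq> carrier T" using P.Icarr by auto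
    define J where "J = genideal T (h ` P \<inter> homs T)"
    have J: "ideal J T" unfolding J_def by (rule T.genideal_ideal[OF sub])
    have "P = genideal S (P \<inter> homs S)" using P by (simp add: proj_set_def homogeneous_ideal_def)
    moreover have "genideal S (P \<inter> homs S) \<subseteq> phi J"
    proof (rule S.genideal_minimal[OF ideal_phi[OF J]])
      have "h a \<in> J" if "a \<in> P" "a \<in> homs S" for a
        using T.genideal_self[OF sub] that hpart_image unfolding J_def by blast
      then show "P \<inter> homs S \<subseteq> phi J" using P.Icarr by (auto simp: phi_def)
    qed
    ultimately have "h ` P \<subseteq> J" by (auto simp: phi_def)
    moreover have "J \<subseteq> h ` P" unfolding J_def by (rule T.genideal_minimal[OF id]) blast
    ultimately show ?thesis using id by (auto simp: homogeneous_ideal_def J_def)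
  qed
  moreover have "\<not> irrelevant_ideal T \<subseteq> h ` P"
  proof
    assume irr: "irrelevant_ideal T \<subseteq> h ` P"
    obtain g e where g: "g \<in> hpart S e" "0 < e" "g \<notin> P" using S.proj_setE_pos[OF P] .
    have "h g \<in> hpart T e" using g(1) hpart_image by blast
    moreover have "(\<Union>d\<in>{0<..}. hpart T d) \<subseteq> irrelevant_ideal T"
      unfolding irrelevant_ideal_def using T.hpart_carrier by (intro T.genideal_self) blast
    ultimately have "h g \<in> h ` P" using irr g(2) by auto
    then show False using memb[OF S.hpart_carrier[OF g(1)]] g(3) by blast
  qed
  ultimately show ?thesis by (simp add: proj_set_def spec_def)
qed

lemma phi_range: "phi ` proj_set T = {P \<in> proj_set S. K \<subseteq> P}"
proof (intro equalityI subsetI)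
  fix P assume "P \<in> {P \<in> proj_set S. K \<subseteq> P}"
  then show "P \<in> phi ` proj_set T"
    using image_proj[of P] phi_image[of P] proj_ideal(2)[of P] by (intro image_eqI[of _ _ "h ` P"]) auto
qed (use phi_proj K_subset_phi proj_ideal(1) in blast)

lemma inj_phi: "inj_on phi (proj_set T)"
proof (rule inj_onI)
  fix Q Q' assume Q: "Q \<in> proj_set T" "Q' \<in> proj_set T" "phi Q = phi Q'"
  have "h ` phi Q = h ` phi Q'" using Q by simp
  then show "Q = Q'"
    unfolding image_phi[OF proj_ideal(1)[OF Q(1)]] image_phi[OF proj_ideal(1)[OF Q(2)]] .
qed

section \<open>Topology of the induced map\<close>

lemma open_pre:
  assumes "openin (proj_top S) U" shows "openin (proj_top T) (pre U)"
proof -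
  obtain E where E: "E \<subseteq> carrier S" "U = {P \<in> proj_set S. \<not> E \<subseteq> P}"
    using assms unfolding openin_proj_top by blast
  then have "pre U = {Q \<in> proj_set T. \<not> h ` E \<subseteq> Q}"
    using phi_proj by (auto simp: pre_def phi_def)
  moreover have "h ` E \<subseteq> carrier T" using E(1) by auto
  ultimately show ?thesis unfolding openin_proj_top by blast
qed

text \<open>Shows that the topology of the source is induced. The full preimage \<open>E\<close> of
  \<open>F\<close> works: by surjectivity every element of \<open>F\<close> is hit, so
  \<open>E\<close> lies in \<open>phi Q\<close> exactly when \<open>F\<close> lies in
  \<open>Q\<close>.\<close>

lemma open_eq_pre:
  assumes "openin (proj_top T) W" obtains U where "openin (proj_top S) U" "pre U = W"
proof -
  obtain F where F: "F \<subseteq> carrier T" "W = {Q \<in> proj_set T. \<not> F \<subseteq> Q}"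
    using assms unfolding openin_proj_top by blast
  define E where "E = {a \<in> carrier S. h a \<in> F}"
  have "E \<subseteq> phi Q \<longleftrightarrow> F \<subseteq> Q" for Q
  proof
    assume EQ: "E \<subseteq> phi Q"
    show "F \<subseteq> Q"
    proof
      fix t assume t: "t \<in> F"
      then obtain a where "a \<in> carrier S" "t = h a" using F(1) surj by blast
      then show "t \<in> Q" using t EQ by (auto simp: E_def phi_def)
    qed
  qed (auto simp: E_def phi_def)
  then have "pre {P \<in> proj_set S. \<not> E \<subseteq> P} = W"
    using phi_proj F(2) by (auto simp: pre_def)
  moreover have "openin (proj_top S) {P \<in> proj_set S. \<not> E \<subseteq> P}"
    unfolding openin_proj_top by (intro exI[of _ E]) (simp add: E_def)
  ultimately show ?thesis using that by blast
qed

lemma continuous_phi: "continuous_map (proj_top T) (proj_top S) phi"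
  using phi_proj open_pre by (auto simp: continuous_map_def topspace_proj_top pre_def)

lemma embedding_phi: "embedding_map (proj_top T) (proj_top S) phi"
  unfolding embedding_map_def
proof (rule bijective_open_imp_homeomorphic_map)
  have im: "phi ` proj_set T \<subseteq> proj_set S" using phi_proj by blast
  then show "continuous_map (proj_top T) (subtopology (proj_top S) (phi ` topspace (proj_top T))) phi"
    using continuous_phi by (simp add: continuous_map_in_subtopology)
  show "phi ` topspace (proj_top T) = topspace (subtopology (proj_top S) (phi ` topspace (proj_top T)))"
    using im by (auto simp: topspace_proj_top topspace_subtopology)
  show "inj_on phi (topspace (proj_top T))" using inj_phi by (simp add: topspace_proj_top)
  show "open_map (proj_top T) (subtopology (proj_top S) (phi ` topspace (proj_top T))) phi"
    unfolding open_map_def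
  proof (intro allI impI)
    fix W assume W: "openin (proj_top T) W"
    then obtain U where U: "openin (proj_top S) U" "pre U = W" by (rule open_eq_pre)
    have "phi ` W = U \<inter> phi ` proj_set T" unfolding U(2)[symmetric] pre_def by auto
    then show "openin (subtopology (proj_top S) (phi ` topspace (proj_top T))) (phi ` W)"
      using U(1) by (auto simp: openin_subtopology topspace_proj_top)
  qed
qed

text \<open>By \<open>phi_range\<close> the complement of the image consists of the primes that do
  not contain \<open>K\<close>, an open condition.\<close>

lemma closed_phi: "closedin (proj_top S) (phi ` proj_set T)"
proof -
  have "proj_set S - phi ` proj_set T = {P \<in> proj_set S. \<not> K \<subseteq> P}" unfolding phi_range by blast
  moreover have "K \<subseteq> carrier S" by (auto simp: K_iff)
  ultimately have "openin (proj_top S) (proj_set S - phi ` proj_set T)"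
    unfolding openin_proj_top by blast
  then show ?thesis using phi_proj by (auto simp: closedin_def topspace_proj_top)
qed

section \<open>Induced maps on localizations, sections and stalks\<close>

lemma hpair_map: "hpair S (phi Q) a b \<Longrightarrow> hpair T Q (h a) (h b)"
  using hpart_map S.hpart_carrier unfolding hpair_def phi_def by blast

lemma prime_at: "Q \<in> proj_set T \<Longrightarrow> graded_prime T Q" "Q \<in> proj_set T \<Longrightarrow> graded_prime S (phi Q)"
  using T.proj_prime S.proj_prime phi_proj by blast+

text \<open>A witness \<open>u\<close> outside \<open>phi Q\<close> is mapped to a witness
  \<open>h u\<close> outside \<open>Q\<close>, so the image class does not depend on the
  representative.\<close>

lemma hm_hfrac:
  assumes Q: "Q \<in> proj_set T" and ab: "hpair S (phi Q) a b"
  shows "hm Q (hfrac S (phi Q) a b) = hfrac T Q (h a) (h b)"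
proof -
  interpret P: graded_prime S "phi Q" using prime_at Q by blast
  interpret Q: graded_prime T Q using prime_at Q by blast
  have "hfrac T Q (h c) (h e) = hfrac T Q (h a) (h b)" if ce: "(c, e) \<in> hfrac S (phi Q) a b" for c e
  proof -
    have hp: "hpair S (phi Q) c e" using ce by (rule P.hfrac_hpair)
    obtain u where u: "u \<in> homs S - phi Q" "u \<otimes>\<^bsub>S\<^esub> (a \<otimes>\<^bsub>S\<^esub> e) = u \<otimes>\<^bsub>S\<^esub> (c \<otimes>\<^bsub>S\<^esub> b)"
      using ce by (rule P.hfracE)
    have c: "a \<in> carrier S" "b \<in> carrier S" "c \<in> carrier S" "e \<in> carrier S" "u \<in> carrier S"
      using P.hpairD(1,2)[OF ab] P.hpairD(1,2)[OF hp] P.homs_carrier[OF u(1)] by blast+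
    have "h u \<otimes>\<^bsub>T\<^esub> (h a \<otimes>\<^bsub>T\<^esub> h e) = h u \<otimes>\<^bsub>T\<^esub> (h c \<otimes>\<^bsub>T\<^esub> h b)"
      using arg_cong[OF u(2), of h] c by simp
    moreover have "h u \<in> homs T - Q"
    proof -
      have "h u \<notin> Q" using u(1) c(5) unfolding phi_def by blast
      moreover have "h u \<in> homs T" using u(1) hpart_map by blast
      ultimately show ?thesis by blast
    qed
    ultimately show ?thesis
      using Q.hfrac_eq_iff[OF hpair_map[OF ab] hpair_map[OF hp]] by metis
  qed
  then show ?thesis unfolding hm_def using P.hfrac_refl[OF ab] by fast
qed

lemma hm_ring_hom:
  assumes Q: "Q \<in> proj_set T"
  shows "hm Q \<in> ring_hom (hlocalization S (phi Q)) (hlocalization T Q)"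
proof -
  interpret P: graded_prime S "phi Q" using prime_at Q by blast
  interpret Q: graded_prime T Q using prime_at Q by blast
  note [simp] = hm_hfrac[OF Q] P.hpair_mult P.hpair_add P.L_mult P.L_add Q.L_mult Q.L_add hpair_map
    P.L_one Q.L_one P.hpair_one
  show ?thesis
  proof (rule ring_hom_memI)
    fix v assume "v \<in> carrier (hlocalization S (phi Q))"
    then obtain a b where "hpair S (phi Q) a b" "v = hfrac S (phi Q) a b" by (rule P.L_carrierE)
    then show "hm Q v \<in> carrier (hlocalization T Q)" by (simp add: Q.L_carrierI)
  next
    fix v w assume v: "v \<in> carrier (hlocalization S (phi Q))" and w: "w \<in> carrier (hlocalization S (phi Q))"
    obtain a b where ab: "hpair S (phi Q) a b" "v = hfrac S (phi Q) a b" using v by (rule P.L_carrierE)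
    obtain c e where ce: "hpair S (phi Q) c e" "w = hfrac S (phi Q) c e" using w by (rule P.L_carrierE)
    show "hm Q (v \<otimes>\<^bsub>hlocalization S (phi Q)\<^esub> w) = hm Q v \<otimes>\<^bsub>hlocalization T Q\<^esub> hm Q w"
      "hm Q (v \<oplus>\<^bsub>hlocalization S (phi Q)\<^esub> w) = hm Q v \<oplus>\<^bsub>hlocalization T Q\<^esub> hm Q w"
      using ab ce P.hpairD(1,2)[OF ab(1)] P.hpairD(1,2)[OF ce(1)] by simp_all
  qed simp
qed

lemma comorph_section:
  assumes U: "openin (proj_top S) U" and s: "s \<in> carrier (proj_sections S U)"
  shows "(\<lambda>Q\<in>pre U. hm Q (s (phi Q))) \<in> carrier (proj_sections T (pre U))"
  unfolding sections_iff
proof (intro conjI ballI)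
  fix Q assume Q: "Q \<in> pre U"
  then have "phi Q \<in> U" by (simp add: pre_def)
  with s have "locally_fraction S U s (phi Q)" by (rule sections_locally_fraction)
  then obtain V a b where V: "openin (proj_top S) V" "phi Q \<in> V" "V \<subseteq> U"
    and ab: "\<And>P. P \<in> V \<Longrightarrow> hpair S P a b" "\<And>P. P \<in> V \<Longrightarrow> s P = hfrac S P a b"
    by (rule locally_fractionE) blast
  show "locally_fraction T (pre U) (\<lambda>Q\<in>pre U. hm Q (s (phi Q))) Q"
  proof (rule locally_fractionI)
    show "openin (proj_top T) (pre V)" using V by (simp add: open_pre)
    show "Q \<in> pre V" "pre V \<subseteq> pre U" using V Q by (auto simp: pre_def)
    fix Q' assume Q': "Q' \<in> pre V"
    then have "phi Q' \<in> V" "Q' \<in> proj_set T" "Q' \<in> pre U" using V(3) by (auto simp: pre_def)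
    then show "hpair T Q' (h a) (h b)" "(\<lambda>Q\<in>pre U. hm Q (s (phi Q))) Q' = hfrac T Q' (h a) (h b)"
      using ab by (simp_all add: hpair_map hm_hfrac)
  qed
qed simp

lemma comorph_ring_hom:
  assumes U: "openin (proj_top S) U"
  shows "comorph f U \<in> ring_hom (proj_sections S U) (proj_sections T (pre U))"
proof (rule ring_hom_memI)
  have hm: "hm Q \<in> ring_hom (hlocalization S (phi Q)) (hlocalization T Q)" "phi Q \<in> U" if "Q \<in> pre U" for Q
    using that hm_ring_hom by (auto simp: pre_def)
  show "comorph f U s \<in> carrier (proj_sections T (pre U))" if "s \<in> carrier (proj_sections S U)" for s
    using comorph_section[OF U that] by (simp add: Proj_map_simps)
  show "comorph f U \<one>\<^bsub>proj_sections S U\<^esub> = \<one>\<^bsub>proj_sections T (pre U)\<^esub>"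
    using hm ring_hom_one[OF hm(1)] by (simp add: Proj_map_simps cong: restrict_cong)
  fix s t assume s: "s \<in> carrier (proj_sections S U)" and t: "t \<in> carrier (proj_sections S U)"
  show "comorph f U (s \<otimes>\<^bsub>proj_sections S U\<^esub> t) = comorph f U s \<otimes>\<^bsub>proj_sections T (pre U)\<^esub> comorph f U t"
    using hm ring_hom_mult[OF hm(1)] sections_in_L[OF s] sections_in_L[OF t]
    by (simp add: Proj_map_simps cong: restrict_cong)
  show "comorph f U (s \<oplus>\<^bsub>proj_sections S U\<^esub> t) = comorph f U s \<oplus>\<^bsub>proj_sections T (pre U)\<^esub> comorph f U t"
    using hm ring_hom_add[OF hm(1)] sections_in_L[OF s] sections_in_L[OF t]
    by (simp add: Proj_map_simps cong: restrict_cong)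
qed

lemma comorph_restrict:
  assumes "V \<subseteq> U"
  shows "comorph f V (restrict s V) = restrict (comorph f U s) (pre V)"
proof -
  have "pre U \<inter> pre V = pre V" using assms by (auto simp: pre_def)
  moreover have "phi Q \<in> V" "Q \<in> pre U" if "Q \<in> pre V" for Q using that assms by (auto simp: pre_def)
  ultimately show ?thesis by (simp add: Proj_map_simps cong: restrict_cong)
qed

text \<open>After evaluation at points the stalk map becomes \<open>hm z\<close>, so that its
  properties can be checked on fractions.\<close>

lemma stalk_map_germ:
  assumes z: "z \<in> proj_set T" and v: "v \<in> carrier (hlocalization S (phi z))"
  shows "stalk_map (Proj T) f z (S.germ_of (phi z) v) = T.germ_of z (hm z v)"
proof -
  have *: "germ (Proj T) z (preim (Proj T) f U) (comorph f U s) = T.germ_of z (hm z v)"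
    if us: "(U, s) \<in> S.germ_of (phi z) v" for U s
  proof -
    have U: "openin (proj_top S) U" "phi z \<in> U" "s \<in> carrier (proj_sections S U)" "s (phi z) = v"
      using us by (simp_all add: S.mem_germ_of)
    have zU: "z \<in> pre U" using z U(2) by (simp add: pre_def)
    show ?thesis
      using T.germ_Proj[OF open_pre[OF U(1)] zU comorph_section[OF U(1,3)]] zU U(4)
      by (simp add: Proj_map_simps)
  qed
  obtain U s where "(U, s) \<in> S.germ_of (phi z) v"
    using S.germ_of_nonempty[OF phi_proj[OF z] v] S.mem_germ_of by metis
  then show ?thesis unfolding stalk_map_def using * by fast
qed

text \<open>Locality is built into \<open>phi\<close>: a fraction at \<open>phi z\<close> whose
  numerator lies in \<open>phi z\<close> is sent to one whose numerator lies in
  \<open>z\<close>.\<close>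

lemma local_hom_stalk:
  assumes z: "z \<in> proj_set T"
  shows "local_hom (stalk (Proj S) (phi z)) (stalk (Proj T) z) (stalk_map (Proj T) f z)"
proof -
  interpret P: graded_prime S "phi z" using prime_at z by blast
  interpret Q: graded_prime T z using prime_at z by blast
  interpret LP: cring "hlocalization S (phi z)" by (rule P.L_cring)
  note si = ring_iso_memE[OF S.stalk_iso(1)[OF phi_proj[OF z]]]
  note ti = ring_iso_memE[OF T.stalk_iso(1)[OF z]]
  note hm = ring_hom_memE[OF hm_ring_hom[OF z]]
  have im: "carrier (stalk (Proj S) (phi z)) = S.germ_of (phi z) ` carrier (hlocalization S (phi z))"
    using si(5) by (simp add: bij_betw_def)
  have "stalk_map (Proj T) f z \<in> ring_hom (stalk (Proj S) (phi z)) (stalk (Proj T) z)"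
  proof (rule ring_hom_memI)
    fix A assume "A \<in> carrier (stalk (Proj S) (phi z))"
    then obtain v where "v \<in> carrier (hlocalization S (phi z))" "A = S.germ_of (phi z) v" using im by blast
    then show "stalk_map (Proj T) f z A \<in> carrier (stalk (Proj T) z)"
      by (simp add: stalk_map_germ[OF z] ti(1) hm(1))
  next
    fix A B assume A: "A \<in> carrier (stalk (Proj S) (phi z))" and B: "B \<in> carrier (stalk (Proj S) (phi z))"
    obtain v where v: "v \<in> carrier (hlocalization S (phi z))" "A = S.germ_of (phi z) v"
      using A unfolding im by (rule imageE)
    obtain w where w: "w \<in> carrier (hlocalization S (phi z))" "B = S.germ_of (phi z) w"
      using B unfolding im by (rule imageE)
    show "stalk_map (Proj T) f z (A \<otimes>\<^bsub>stalk (Proj S) (phi z)\<^esub> B) =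
        stalk_map (Proj T) f z A \<otimes>\<^bsub>stalk (Proj T) z\<^esub> stalk_map (Proj T) f z B"
      unfolding v(2) w(2) si(2)[OF v(1) w(1), symmetric]
      using v(1) w(1) by (simp add: stalk_map_germ[OF z] hm ti(2))
    show "stalk_map (Proj T) f z (A \<oplus>\<^bsub>stalk (Proj S) (phi z)\<^esub> B) =
        stalk_map (Proj T) f z A \<oplus>\<^bsub>stalk (Proj T) z\<^esub> stalk_map (Proj T) f z B"
      unfolding v(2) w(2) si(3)[OF v(1) w(1), symmetric]
      using v(1) w(1) by (simp add: stalk_map_germ[OF z] hm ti(3))
  next
    show "stalk_map (Proj T) f z \<one>\<^bsub>stalk (Proj S) (phi z)\<^esub> = \<one>\<^bsub>stalk (Proj T) z\<^esub>"
      unfolding si(4)[symmetric] by (simp add: stalk_map_germ[OF z] hm(4) ti(4))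
  qed
  moreover have "stalk_map (Proj T) f z ` (S.germ_of (phi z) ` P.L_max) \<subseteq> T.germ_of z ` Q.L_max"
  proof (clarify)
    fix v assume "v \<in> P.L_max"
    then obtain a b where ab: "hpair S (phi z) a b" "v = hfrac S (phi z) a b" "a \<in> phi z"
      unfolding P.L_max_def by blast
    have "h a \<in> z" using ab(3) unfolding phi_def by blast
    then have "hm z v \<in> Q.L_max"
      using ab(2) hm_hfrac[OF z ab(1)] Q.mem_L_max[OF hpair_map[OF ab(1)]] by simp
    moreover have "v \<in> carrier (hlocalization S (phi z))" using ab P.L_carrierI by blast
    ultimately show "stalk_map (Proj T) f z (S.germ_of (phi z) v) \<in> T.germ_of z ` Q.L_max"
      by (simp add: stalk_map_germ[OF z])
  qed
  ultimately show ?thesis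
    unfolding local_hom_def S.stalk_maximalideal[OF phi_proj[OF z]] T.stalk_maximalideal[OF z] by blast
qed

lemma lrs_morphism_Proj_map: "lrs_morphism (Proj T) (Proj S) f"
  unfolding lrs_morphism_def
  using S.locally_ringed_Proj T.locally_ringed_Proj continuous_phi comorph_ring_hom comorph_restrict
    local_hom_stalk
  by (simp add: Proj_map_simps(1,3) topspace_proj_top)

text \<open>Away from the closed image a neighbourhood with empty preimage exists, where any section
  will do. On the image, \<open>t\<close> is locally a fraction; its numerator and denominator are
  lifted in the same degree, and the neighbourhood is shrunk so that the lifted denominator avoids
  all its primes.\<close>

lemma comorph_locally_surj:
  assumes U: "openin (proj_top S) U" and t: "t \<in> carrier (proj_sections T (pre U))" and x: "x \<in> U"
  shows "\<exists>V. openin (proj_top S) V \<and> x \<in> V \<and> V \<subseteq> U \<and>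
    (\<exists>s\<in>carrier (proj_sections S V). comorph f V s = restrict t (pre V))"
proof (cases "x \<in> phi ` proj_set T")
  case False
  define V where "V = U \<inter> (proj_set S - phi ` proj_set T)"
  have V: "openin (proj_top S) V"
    unfolding V_def using U closed_phi by (simp add: closedin_def topspace_proj_top openin_Int)
  interpret cring "proj_sections S V" by (rule S.sections_cring[OF V])
  have "pre V = {}" by (auto simp: V_def pre_def)
  then have "comorph f V \<zero>\<^bsub>proj_sections S V\<^esub> = restrict t (pre V)"
    by (simp add: Proj_map_simps fun_eq_iff)
  moreover have "x \<in> V" using False x openin_proj_subset[OF U] by (auto simp: V_def)
  ultimately show ?thesis using V zero_closed V_def by blast
next
  case True
  then obtain Q where Q: "Q \<in> proj_set T" "x = phi Q" by blast
  then have QU: "Q \<in> pre U" using x by (simp add: pre_def)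
  obtain W a b where W: "openin (proj_top T) W" "Q \<in> W" "W \<subseteq> pre U"
    and ab: "\<And>P. P \<in> W \<Longrightarrow> hpair T P a b" "\<And>P. P \<in> W \<Longrightarrow> t P = hfrac T P a b"
    using sections_locally_fraction[OF t QU] by (rule locally_fractionE) blast
  obtain U' where U': "openin (proj_top S) U'" "pre U' = W" using W(1) by (rule open_eq_pre)
  obtain d where "a \<in> hpart T d" "b \<in> hpart T d" "b \<notin> Q" using ab(1)[OF W(2)] unfolding hpair_def by blast
  then obtain a' b' where a': "a' \<in> hpart S d" "a = h a'" and b': "b' \<in> hpart S d" "b = h b'"
    unfolding hpart_image[symmetric] by blast
  define V where "V = U \<inter> U' \<inter> {P \<in> proj_set S. b' \<notin> P}"
  have V: "openin (proj_top S) V"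
    unfolding V_def using U U'(1) openin_proj_basic[OF S.hpart_carrier[OF b'(1)]] by blast
  have "phi Q \<in> U'" using W(2) U'(2) by (auto simp: pre_def)
  then have xV: "x \<in> V"
    using x Q phi_proj \<open>b \<notin> Q\<close> b' by (auto simp: V_def phi_def)
  have pair: "hpair S P a' b'" if "P \<in> V" for P
    using that a' b' by (auto simp: V_def hpair_def)
  have s: "(\<lambda>P\<in>V. hfrac S P a' b') \<in> carrier (proj_sections S V)"
    by (rule frac_section[OF V pair])
  have "hm Q' (hfrac S (phi Q') a' b') = t Q'" if "Q' \<in> pre V" for Q'
  proof -
    have "Q' \<in> proj_set T" "phi Q' \<in> V" "Q' \<in> W"
      using that U'(2) by (auto simp: pre_def V_def)
    then show ?thesis using hm_hfrac pair ab(2) a' b' by simp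
  qed
  then have "comorph f V (\<lambda>P\<in>V. hfrac S P a' b') = restrict t (pre V)"
    by (auto simp: Proj_map_simps pre_def intro!: restrict_ext)
  then show ?thesis using V xV s V_def by blast
qed

text \<open>At a point of the image, vanishing upstairs gives a homogeneous \<open>u'\<close> that
  kills \<open>h a\<close>, and \<open>u'\<close> lifts. At any other point the kernel itself, being
  generated by homogeneous elements, has a homogeneous element outside \<open>y\<close>.\<close>

lemma hom_annihilator:
  assumes V: "openin (proj_top S) V" and y: "y \<in> V" and ab: "hpair S y a b"
    and s: "s y = hfrac S y a b" "comorph f V s = \<zero>\<^bsub>proj_sections T (pre V)\<^esub>"
  shows "\<exists>u\<in>homs S - y. u \<otimes>\<^bsub>S\<^esub> a \<in> K"
proof (cases "y \<in> phi ` proj_set T")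
  case True
  then obtain Q where Q: "Q \<in> proj_set T" "y = phi Q" by blast
  interpret Q: graded_prime T Q using prime_at Q by blast
  have "hfrac T Q (h a) (h b) = \<zero>\<^bsub>hlocalization T Q\<^esub>"
    using fun_cong[OF s(2), of Q] Q y s(1) hm_hfrac[OF Q(1)] ab by (simp add: Proj_map_simps pre_def)
  then obtain u' where u': "u' \<in> homs T - Q" "u' \<otimes>\<^bsub>T\<^esub> h a = \<zero>\<^bsub>T\<^esub>"
    using Q.hfrac_eq_zero_iff[OF hpair_map[OF ab[unfolded Q(2)]]] by blast
  then obtain u where u: "u \<in> homs S" "h u = u'" using homs_lift by blast
  have "u \<in> carrier S" "a \<in> carrier S" using u(1) ab S.hpart_carrier by (auto simp: hpair_def)
  then have "u \<otimes>\<^bsub>S\<^esub> a \<in> K" using u u' by (simp add: K_iff)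
  moreover have "u \<notin> y" using u u' Q by (simp add: phi_def)
  ultimately show ?thesis using u by blast
next
  case False
  have yS: "y \<in> proj_set S" using y openin_proj_subset[OF V] by blast
  have "\<not> K \<inter> homs S \<subseteq> y"
  proof
    assume sub: "K \<inter> homs S \<subseteq> y"
    have "K \<subseteq> y"
      by (subst ker_homogeneous) (rule S.genideal_minimal[OF proj_ideal(2)[OF yS] sub])
    then show False using False phi_range yS by blast
  qed
  then obtain u where u: "u \<in> K" "u \<in> homs S - y" by blast
  have "a \<in> carrier S" using ab S.hpart_carrier by (auto simp: hpair_def)
  then have "u \<otimes>\<^bsub>S\<^esub> a \<in> K" using u(1) by (simp add: K_iff)
  then show ?thesis using u by blast
qed

text \<open>If \<open>g \<notin> x\<close> is homogeneous of degree \<open>e > 0\<close>, then near \<open>x\<close> the ideal sheaf is generated by the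
  fractions \<open>a / g\<^sup>k\<close> with \<open>a\<close> in the kernel: if \<open>u a\<close> lies in the kernel and \<open>D\<close> is the degree of
  \<open>q = u b\<close>, then \<open>a / b = (u a q\<^sup>e\<^sup>-\<^sup>1 / g\<^sup>D) (g\<^sup>D / q\<^sup>e)\<close>.\<close>

lemma kernel_locally_generated:
  assumes x: "x \<in> proj_set S"
  shows "\<exists>U. openin (proj_top S) U \<and> x \<in> U \<and>
        (\<exists>G \<subseteq> comorph_kernel (Proj T) (Proj S) f U.
           \<forall>V s y. openin (proj_top S) V \<and> V \<subseteq> U \<and> s \<in> comorph_kernel (Proj T) (Proj S) f V \<and> y \<in> V \<longrightarrow>
             (\<exists>W. openin (proj_top S) W \<and> y \<in> W \<and> W \<subseteq> V \<and>
                restrict s W \<in> genideal (proj_sections S W) ((\<lambda>s. restrict s W) ` G)))"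
proof -
  obtain g e where g: "g \<in> hpart S e" "0 < e" "g \<notin> x" using S.proj_setE_pos[OF x] .
  define U where "U = {P \<in> proj_set S. g \<notin> P}"
  have gc: "g \<in> carrier S" using g(1) by (rule S.hpart_carrier)
  have U: "openin (proj_top S) U" "x \<in> U"
    using openin_proj_basic[OF gc] g(3) x by (simp_all add: U_def)
  define G where "G = {\<lambda>P\<in>U. hfrac S P a (g [^]\<^bsub>S\<^esub> k) | a k. a \<in> K \<and> a \<in> hpart S (k * e)}"
  have gpow: "g [^]\<^bsub>S\<^esub> k \<in> hpart S (k * e)" for k :: nat using g(1) by (rule S.hpart_pow)
  have pow_notin: "c [^]\<^bsub>S\<^esub> (k::nat) \<notin> P" if P: "P \<in> proj_set S" and c: "c \<notin> P" "c \<in> carrier S" for P c k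
  proof (induction k)
    interpret P: graded_prime S P using S.proj_prime[OF P] .
    case 0 show ?case using P.one_notin by simp
    case (Suc k) then show ?case using P.I_prime[of "c [^]\<^bsub>S\<^esub> k" c] c by auto
  qed
  have pairG: "hpair S P a (g [^]\<^bsub>S\<^esub> k)" if "P \<in> U" "a \<in> hpart S (k * e)" for P a k
    using that gpow[of k] pow_notin[of P g k] gc by (auto simp: hpair_def U_def)
  have G_sub: "G \<subseteq> comorph_kernel (Proj T) (Proj S) f U"
  proof
    fix \<gamma> assume "\<gamma> \<in> G"
    then obtain a k where ak: "\<gamma> = (\<lambda>P\<in>U. hfrac S P a (g [^]\<^bsub>S\<^esub> k))" "a \<in> K" "a \<in> hpart S (k * e)"
      unfolding G_def by blast
    have "hm Q (hfrac S (phi Q) a (g [^]\<^bsub>S\<^esub> k)) = \<zero>\<^bsub>hlocalization T Q\<^esub>" if "Q \<in> pre U" for Q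
    proof -
      have Q: "Q \<in> proj_set T" "phi Q \<in> U" using that by (simp_all add: pre_def)
      interpret Q: graded_prime T Q using prime_at Q by blast
      have p: "hpair S (phi Q) a (g [^]\<^bsub>S\<^esub> k)" using pairG Q(2) ak(3) by blast
      have "\<one>\<^bsub>T\<^esub> \<otimes>\<^bsub>T\<^esub> h a = \<zero>\<^bsub>T\<^esub>" using ak(2) by (simp add: K_iff)
      then show ?thesis
        using hm_hfrac[OF Q(1) p] Q.hfrac_eq_zero_iff[OF hpair_map[OF p]] Q.homs_one by auto
    qed
    then have "comorph f U \<gamma> = \<zero>\<^bsub>proj_sections T (pre U)\<^esub>"
      unfolding ak(1) by (auto simp: Proj_map_simps pre_def intro!: restrict_ext)
    moreover have "\<gamma> \<in> carrier (proj_sections S U)"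
      unfolding ak(1) using frac_section[OF U(1)] pairG ak(3) by blast
    ultimately show "\<gamma> \<in> comorph_kernel (Proj T) (Proj S) f U"
      by (simp add: comorph_kernel_def Proj_map_simps(3))
  qed
  have gen: "\<exists>W. openin (proj_top S) W \<and> y \<in> W \<and> W \<subseteq> V \<and>
        restrict s W \<in> genideal (proj_sections S W) ((\<lambda>s. restrict s W) ` G)"
    if V: "openin (proj_top S) V" "V \<subseteq> U" and s: "s \<in> comorph_kernel (Proj T) (Proj S) f V" and y: "y \<in> V"
    for V s y
  proof -
    have sV: "s \<in> carrier (proj_sections S V)" "comorph f V s = \<zero>\<^bsub>proj_sections T (pre V)\<^esub>"
      using s by (simp_all add: comorph_kernel_def Proj_map_simps(3))
    obtain W1 a b where W1: "openin (proj_top S) W1" "y \<in> W1" "W1 \<subseteq> V"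
      and ab: "\<And>Q. Q \<in> W1 \<Longrightarrow> hpair S Q a b" "\<And>Q. Q \<in> W1 \<Longrightarrow> s Q = hfrac S Q a b"
      using sections_locally_fraction[OF sV(1) y] by (rule locally_fractionE) blast
    obtain u where u: "u \<in> homs S - y" "u \<otimes>\<^bsub>S\<^esub> a \<in> K"
      using hom_annihilator[of V y a b s] V y ab[OF W1(2)] sV(2) by blast
    obtain d1 d2 where d: "u \<in> hpart S d1" "a \<in> hpart S d2" "b \<in> hpart S d2" "b \<notin> y"
      using u(1) ab(1)[OF W1(2)] unfolding hpair_def by blast
    define D where "D = d1 + d2"
    define p q where "p = u \<otimes>\<^bsub>S\<^esub> a" and "q = u \<otimes>\<^bsub>S\<^esub> b"
    have c: "u \<in> carrier S" "a \<in> carrier S" "b \<in> carrier S" "p \<in> carrier S" "q \<in> carrier S"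
      using d S.hpart_carrier unfolding p_def q_def by blast+
    have pq: "p \<in> hpart S D" "q \<in> hpart S D" unfolding p_def q_def D_def using d S.hpart_mult by blast+
    \<comment> \<open>On \<open>W1\<close> the primes avoid \<open>b\<close>; avoiding
      \<open>u\<close> as well makes \<open>q = u b\<close> and its powers admissible
      denominators.\<close>
    define W where "W = W1 \<inter> {P \<in> proj_set S. u \<notin> P}"
    have W: "openin (proj_top S) W" "y \<in> W" "W \<subseteq> V"
      unfolding W_def using W1 openin_proj_basic[OF c(1)] u(1) openin_proj_subset[OF V(1)] y by auto
    define n where "n = p \<otimes>\<^bsub>S\<^esub> q [^]\<^bsub>S\<^esub> (e - 1)"
    have nK: "n \<in> K" using u(2) c unfolding n_def p_def[symmetric] by (simp add: K_iff)
    have "D + (e - 1) * D = D * e" using g(2) by (cases e) (simp_all add: algebra_simps)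
    then have nD: "n \<in> hpart S (D * e)"
      unfolding n_def using S.hpart_mult[OF pq(1) S.hpart_pow[OF pq(2), of "e - 1"]] by simp
    have qe: "q [^]\<^bsub>S\<^esub> e = q [^]\<^bsub>S\<^esub> (e - 1) \<otimes>\<^bsub>S\<^esub> q" using g(2) by (cases e) simp_all
    define \<gamma> where "\<gamma> = (\<lambda>P\<in>U. hfrac S P n (g [^]\<^bsub>S\<^esub> D))"
    define r where "r = (\<lambda>P\<in>W. hfrac S P (g [^]\<^bsub>S\<^esub> D) (q [^]\<^bsub>S\<^esub> e))"
    have \<gamma>G: "\<gamma> \<in> G" unfolding G_def \<gamma>_def using nK nD by blast
    have pairr: "hpair S P (g [^]\<^bsub>S\<^esub> D) (q [^]\<^bsub>S\<^esub> e)" if P: "P \<in> W" for P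
    proof -
      have PS: "P \<in> proj_set S" "P \<in> W1" "u \<notin> P" using P by (auto simp: W_def)
      interpret P: graded_prime S P using S.proj_prime[OF PS(1)] .
      have "b \<notin> P" using ab(1)[OF PS(2)] by (simp add: hpair_def)
      then have "q \<notin> P" using P.I_prime PS(3) c unfolding q_def by blast
      then have "q [^]\<^bsub>S\<^esub> e \<notin> P" using pow_notin PS(1) c(5) by blast
      moreover have "q [^]\<^bsub>S\<^esub> e \<in> hpart S (D * e)" using S.hpart_pow[OF pq(2), of e] by (simp add: mult.commute)
      ultimately show ?thesis unfolding hpair_def using gpow by blast
    qed
    have r: "r \<in> carrier (proj_sections S W)" unfolding r_def by (rule frac_section[OF W(1) pairr])
    have "restrict s W = restrict \<gamma> W \<otimes>\<^bsub>proj_sections S W\<^esub> r"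
    proof -
      have "s P = \<gamma> P \<otimes>\<^bsub>hlocalization S P\<^esub> r P" if P: "P \<in> W" for P
      proof -
        have PS: "P \<in> proj_set S" "P \<in> W1" "P \<in> U" using P W(3) V(2) by (auto simp: W_def)
        interpret P: graded_prime S P using S.proj_prime[OF PS(1)] .
        have pg: "hpair S P n (g [^]\<^bsub>S\<^esub> D)" using pairG PS(3) nD by blast
        have "hfrac S P a b = hfrac S P (n \<otimes>\<^bsub>S\<^esub> g [^]\<^bsub>S\<^esub> D) (g [^]\<^bsub>S\<^esub> D \<otimes>\<^bsub>S\<^esub> q [^]\<^bsub>S\<^esub> e)"
        proof (rule P.hfrac_cross_eq[OF ab(1)[OF PS(2)] P.hpair_mult[OF pg pairr[OF P]]])
          show "a \<otimes>\<^bsub>S\<^esub> (g [^]\<^bsub>S\<^esub> D \<otimes>\<^bsub>S\<^esub> q [^]\<^bsub>S\<^esub> e) = n \<otimes>\<^bsub>S\<^esub> g [^]\<^bsub>S\<^esub> D \<otimes>\<^bsub>S\<^esub> b"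
            unfolding qe n_def using c gc by (simp add: p_def q_def S.m_ac)
        qed
        then show ?thesis
          using P.L_mult[OF pg pairr[OF P]] ab(2)[OF PS(2)] P PS(3) by (simp add: \<gamma>_def r_def)
      qed
      then show ?thesis by (auto intro!: restrict_ext)
    qed
    moreover have "restrict \<gamma> W \<otimes>\<^bsub>proj_sections S W\<^esub> r \<in> genideal (proj_sections S W) ((\<lambda>s. restrict s W) ` G)"
    proof -
      interpret O: cring "proj_sections S W" by (rule S.sections_cring[OF W(1)])
      have sub: "(\<lambda>s. restrict s W) ` G \<subseteq> carrier (proj_sections S W)"
      proof
        fix \<delta> assume "\<delta> \<in> (\<lambda>s. restrict s W) ` G"
        then obtain \<gamma>' where \<gamma>': "\<gamma>' \<in> G" "\<delta> = restrict \<gamma>' W" by blast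
        then have "\<gamma>' \<in> carrier (proj_sections S U)"
          using G_sub by (auto simp: comorph_kernel_def)
        then show "\<delta> \<in> carrier (proj_sections S W)"
          unfolding \<gamma>'(2) by (rule restrict_section[OF _ W(1)]) (use W(3) V(2) in blast)
      qed
      interpret I: ideal "genideal (proj_sections S W) ((\<lambda>s. restrict s W) ` G)" "proj_sections S W"
        by (rule O.genideal_ideal[OF sub])
      have "restrict \<gamma> W \<in> genideal (proj_sections S W) ((\<lambda>s. restrict s W) ` G)"
        using O.genideal_self[OF sub] \<gamma>G by blast
      then show ?thesis using r by (rule I.I_r_closed)
    qed
    ultimately have "restrict s W \<in> genideal (proj_sections S W) ((\<lambda>s. restrict s W) ` G)" by simp
    with W show ?thesis by blast
  qed
  show ?thesis
  proof (rule exI[of _ U], intro conjI U, rule exI[of _ G], intro conjI G_sub allI impI, elim conjE)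
    fix V s y
    assume "openin (proj_top S) V" "V \<subseteq> U" "s \<in> comorph_kernel (Proj T) (Proj S) f V" "y \<in> V"
    then show "\<exists>W. openin (proj_top S) W \<and> y \<in> W \<and> W \<subseteq> V \<and>
        restrict s W \<in> genideal (proj_sections S W) ((\<lambda>s. restrict s W) ` G)" by (rule gen)
  qed
qed

theorem closed_immersion_Proj_map: "closed_immersion (Proj T) (Proj S) f"
proof -
  \<comment> \<open>In \<open>closed_immersion\<close> the map \<open>restr\<close> also occurs
    unapplied, under an image, where the simplification rule for applied restrictions does not
    fire.\<close>
  have restr: "restr (Proj S) U W = (\<lambda>s. restrict s W)" for U W by (simp add: fun_eq_iff)
  show ?thesis
    unfolding closed_immersion_def restr Proj_map_simps(1,3) Proj_simps topspace_proj_top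
  proof (intro conjI lrs_morphism_Proj_map embedding_phi closed_phi)
    show "\<forall>U t x. openin (proj_top S) U \<and> t \<in> carrier (proj_sections T (pre U)) \<and> x \<in> U \<longrightarrow>
        (\<exists>V. openin (proj_top S) V \<and> x \<in> V \<and> V \<subseteq> U \<and>
          (\<exists>s\<in>carrier (proj_sections S V). comorph f V s = restrict t (pre V)))"
      using comorph_locally_surj by simp
  qed (use kernel_locally_generated in simp)
qed

end

section \<open>Polynomial rings\<close>

text \<open>A submultiset of \<open>add_mset x m\<close> either contains \<open>x\<close>, and is
  one of \<open>m\<close> with \<open>x\<close> added, or already lies in \<open>m\<close>.\<close>

lemma finite_submultisets: "finite {k. k \<subseteq># m}"
proof (induction m)
  case (add x m)
  have "{k. k \<subseteq># add_mset x m} \<subseteq> {k. k \<subseteq># m} \<union> add_mset x ` {k. k \<subseteq># m}"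
  proof
    fix k assume "k \<in> {k. k \<subseteq># add_mset x m}"
    then have k: "k \<subseteq># add_mset x m" by simp
    show "k \<in> {k. k \<subseteq># m} \<union> add_mset x ` {k. k \<subseteq># m}"
    proof (cases "x \<in># k")
      case True
      then obtain l where "k = add_mset x l" by (metis mset_add)
      then show ?thesis using k by auto
    next
      case False
      have "k \<subseteq># m"
      proof (rule mset_subset_eqI)
        fix a show "count k a \<le> count m a"
          using mset_subset_eq_count[OF k, of a] False by (cases "a = x") (auto simp: not_in_iff)
      qed
      then show ?thesis by simp
    qed
  qed
  then show ?case using add.IH by (meson finite_UnI finite_imageI finite_subset)
qed simp

lemma (in cring) finsum_swap:
  assumes "finite A" "finite B" "\<And>i j. i \<in> A \<Longrightarrow> j \<in> B \<Longrightarrow> F i j \<in> carrier R"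
  shows "(\<Oplus>i\<in>A. \<Oplus>j\<in>B. F i j) = (\<Oplus>j\<in>B. \<Oplus>i\<in>A. F i j)"
  using assms(1,3)
proof (induction A rule: finite_induct)
  case (insert x A)
  have "(\<Oplus>i\<in>insert x A. \<Oplus>j\<in>B. F i j) = (\<Oplus>j\<in>B. F x j) \<oplus> (\<Oplus>j\<in>B. \<Oplus>i\<in>A. F i j)"
    using insert by (subst finsum_insert) auto
  also have "\<dots> = (\<Oplus>j\<in>B. F x j \<oplus> (\<Oplus>i\<in>A. F i j))"
    using insert by (subst finsum_addf) auto
  also have "\<dots> = (\<Oplus>j\<in>B. \<Oplus>i\<in>insert x A. F i j)"
    using insert by (intro finsum_cong') auto
  finally show ?case .
qed simp

text \<open>Valid for every index set, since \<open>finsum\<close> over an infinite set is zero by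
  convention.\<close>

lemma (in ideal) finsum_in:
  assumes "\<And>i. i \<in> A \<Longrightarrow> F i \<in> I" shows "(\<Oplus>i\<in>A. F i) \<in> I"
  using assms
proof (induction A rule: infinite_finite_induct)
  case (insert x A)
  then show ?case by (subst finsum_insert) (auto simp: Icarr)
qed simp_all

section \<open>Ring axioms and grading of the polynomial ring\<close>

lemma mpoly_ring_simps:
  "p \<in> carrier (mpoly_ring R n) \<longleftrightarrow> (\<forall>m. p m \<in> carrier R) \<and> finite {m. p m \<noteq> \<zero>\<^bsub>R\<^esub>} \<and>
      (\<forall>m. p m \<noteq> \<zero>\<^bsub>R\<^esub> \<longrightarrow> set_mset m \<subseteq> {0..n})"
  "p \<otimes>\<^bsub>mpoly_ring R n\<^esub> q = (\<lambda>m. \<Oplus>\<^bsub>R\<^esub>k\<in>{k. k \<subseteq># m}. p k \<otimes>\<^bsub>R\<^esub> q (m - k))"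
  "\<one>\<^bsub>mpoly_ring R n\<^esub> = (\<lambda>m. if m = {#} then \<one>\<^bsub>R\<^esub> else \<zero>\<^bsub>R\<^esub>)"
  "\<zero>\<^bsub>mpoly_ring R n\<^esub> = (\<lambda>m. \<zero>\<^bsub>R\<^esub>)"
  "p \<oplus>\<^bsub>mpoly_ring R n\<^esub> q = (\<lambda>m. p m \<oplus>\<^bsub>R\<^esub> q m)"
  "p \<in> hpart (mpoly_ring R n) d \<longleftrightarrow> p \<in> carrier (mpoly_ring R n) \<and> (\<forall>m. p m \<noteq> \<zero>\<^bsub>R\<^esub> \<longrightarrow> size m = d)"
  by (simp_all add: mpoly_ring_def Let_def)

lemma mpoly_coeff: "p \<in> carrier (mpoly_ring R n) \<Longrightarrow> p m \<in> carrier R"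
  and mpoly_finite: "p \<in> carrier (mpoly_ring R n) \<Longrightarrow> finite {m. p m \<noteq> \<zero>\<^bsub>R\<^esub>}"
  and mpoly_vars: "p \<in> carrier (mpoly_ring R n) \<Longrightarrow> p m \<noteq> \<zero>\<^bsub>R\<^esub> \<Longrightarrow> set_mset m \<subseteq> {0..n}"
  by (simp_all add: mpoly_ring_simps)

lemma mpoly_carrierI:
  assumes "\<And>m. p m \<in> carrier R" "finite A" "\<And>m. p m \<noteq> \<zero>\<^bsub>R\<^esub> \<Longrightarrow> m \<in> A"
    "\<And>m. p m \<noteq> \<zero>\<^bsub>R\<^esub> \<Longrightarrow> set_mset m \<subseteq> {0..n}"
  shows "p \<in> carrier (mpoly_ring R n)"
proof -
  have "finite {m. p m \<noteq> \<zero>\<^bsub>R\<^esub>}" by (rule finite_subset[OF _ assms(2)]) (use assms(3) in blast)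
  then show ?thesis using assms unfolding mpoly_ring_simps by blast
qed

context cring
begin

abbreviation "M n \<equiv> mpoly_ring R n"

text \<open>Finiteness of the support of a product, the bound on its variables and the additivity of
  degrees are all read off from this splitting.\<close>

lemma mpoly_mult_support:
  assumes p: "p \<in> carrier (M n)" and q: "q \<in> carrier (M n)" and nz: "(p \<otimes>\<^bsub>M n\<^esub> q) m \<noteq> \<zero>"
  obtains k l where "m = k + l" "p k \<noteq> \<zero>" "q l \<noteq> \<zero>"
proof -
  have "\<exists>k. k \<subseteq># m \<and> p k \<otimes> q (m - k) \<noteq> \<zero>"
  proof (rule ccontr)
    assume "\<nexists>k. k \<subseteq># m \<and> p k \<otimes> q (m - k) \<noteq> \<zero>"
    then have "(\<Oplus>k\<in>{k. k \<subseteq># m}. p k \<otimes> q (m - k)) = \<zero>" by (intro add.finprod_one_eqI) auto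
    then show False using nz by (simp add: mpoly_ring_simps)
  qed
  then obtain k where k: "k \<subseteq># m" "p k \<otimes> q (m - k) \<noteq> \<zero>" by blast
  have "p k \<noteq> \<zero>" "q (m - k) \<noteq> \<zero>"
    using k(2) mpoly_coeff[OF p] mpoly_coeff[OF q] by auto
  moreover have "m = k + (m - k)" using k(1) by simp
  ultimately show ?thesis using that by blast
qed

lemma mpoly_mult_closed:
  assumes p: "p \<in> carrier (M n)" and q: "q \<in> carrier (M n)"
  shows "p \<otimes>\<^bsub>M n\<^esub> q \<in> carrier (M n)"
proof (rule mpoly_carrierI[of _ _ "(\<lambda>(k, l). k + l) ` ({m. p m \<noteq> \<zero>} \<times> {m. q m \<noteq> \<zero>})"])
  show "(p \<otimes>\<^bsub>M n\<^esub> q) m \<in> carrier R" for m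
    unfolding mpoly_ring_simps using mpoly_coeff[OF p] mpoly_coeff[OF q] by (intro finsum_closed) auto
  show "finite ((\<lambda>(k, l). k + l) ` ({m. p m \<noteq> \<zero>} \<times> {m. q m \<noteq> \<zero>}))"
    using mpoly_finite[OF p] mpoly_finite[OF q] by blast
  fix m assume "(p \<otimes>\<^bsub>M n\<^esub> q) m \<noteq> \<zero>"
  then obtain k l where kl: "m = k + l" "p k \<noteq> \<zero>" "q l \<noteq> \<zero>" by (rule mpoly_mult_support[OF p q])
  show "m \<in> (\<lambda>(k, l). k + l) ` ({m. p m \<noteq> \<zero>} \<times> {m. q m \<noteq> \<zero>})"
    using kl by (intro image_eqI[of _ _ "(k, l)"]) auto
  show "set_mset m \<subseteq> {0..n}"
    using mpoly_vars[OF p kl(2)] mpoly_vars[OF q kl(3)] kl(1) by simp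
qed

lemma mpoly_add_closed:
  assumes p: "p \<in> carrier (M n)" and q: "q \<in> carrier (M n)"
  shows "p \<oplus>\<^bsub>M n\<^esub> q \<in> carrier (M n)"
proof (rule mpoly_carrierI[of _ _ "{m. p m \<noteq> \<zero>} \<union> {m. q m \<noteq> \<zero>}"])
  show "finite ({m. p m \<noteq> \<zero>} \<union> {m. q m \<noteq> \<zero>})"
    using mpoly_finite[OF p] mpoly_finite[OF q] by blast
  show "(p \<oplus>\<^bsub>M n\<^esub> q) m \<in> carrier R" for m
    using mpoly_coeff[OF p] mpoly_coeff[OF q] by (simp add: mpoly_ring_simps)
  fix m assume nz: "(p \<oplus>\<^bsub>M n\<^esub> q) m \<noteq> \<zero>"
  have *: "p m \<noteq> \<zero> \<or> q m \<noteq> \<zero>"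
  proof (rule ccontr)
    assume "\<not> (p m \<noteq> \<zero> \<or> q m \<noteq> \<zero>)"
    then show False using nz by (simp add: mpoly_ring_simps(5))
  qed
  then show "m \<in> {m. p m \<noteq> \<zero>} \<union> {m. q m \<noteq> \<zero>}" by simp
  show "set_mset m \<subseteq> {0..n}" using * mpoly_vars[OF p] mpoly_vars[OF q] by blast
qed

lemma mpoly_uminus_closed:
  assumes p: "p \<in> carrier (M n)" shows "(\<lambda>m. \<ominus> p m) \<in> carrier (M n)"
proof (rule mpoly_carrierI[OF _ mpoly_finite[OF p]])
  fix m assume "\<ominus> p m \<noteq> \<zero>"
  then have "p m \<noteq> \<zero>" by auto
  then show "m \<in> {m. p m \<noteq> \<zero>}" "set_mset m \<subseteq> {0..n}" using mpoly_vars[OF p] by auto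
qed (simp add: mpoly_coeff[OF p])

lemma mpoly_one_closed: "\<one>\<^bsub>M n\<^esub> \<in> carrier (M n)"
  by (rule mpoly_carrierI[of _ _ "{{#}}"]) (auto simp: mpoly_ring_simps(3) split: if_splits)

lemma mpoly_zero_closed: "\<zero>\<^bsub>M n\<^esub> \<in> carrier (M n)"
  by (simp add: mpoly_ring_simps)

text \<open>The involution \<open>k \<mapsto> m - k\<close> on the submultisets of \<open>m\<close>
  interchanges the two factors of the convolution.\<close>

lemma mpoly_m_comm:
  assumes p: "p \<in> carrier (M n)" and q: "q \<in> carrier (M n)"
  shows "p \<otimes>\<^bsub>M n\<^esub> q = q \<otimes>\<^bsub>M n\<^esub> p"
proof
  fix m :: "nat multiset"
  have inj: "inj_on (\<lambda>k. m - k) {k. k \<subseteq># m}"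
    by (rule inj_onI) (metis mem_Collect_eq subset_mset.add_diff_inverse subset_mset.diff_diff_right add_diff_cancel_left')
  have im: "(\<lambda>k. m - k) ` {k. k \<subseteq># m} = {k. k \<subseteq># m}"
  proof (intro equalityI subsetI)
    fix k assume "k \<in> {k. k \<subseteq># m}"
    then show "k \<in> (\<lambda>k. m - k) ` {k. k \<subseteq># m}"
      by (intro image_eqI[of _ _ "m - k"]) (auto simp: multiset_eq_iff subseteq_mset_def)
  qed auto
  have c: "p k \<in> carrier R" "q k \<in> carrier R" for k using mpoly_coeff p q by blast+
  have "(q \<otimes>\<^bsub>M n\<^esub> p) m = (\<Oplus>k\<in>(\<lambda>k. m - k) ` {k. k \<subseteq># m}. q k \<otimes> p (m - k))"
    unfolding im by (simp add: mpoly_ring_simps)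
  also have "\<dots> = (\<Oplus>k\<in>{k. k \<subseteq># m}. q (m - k) \<otimes> p (m - (m - k)))"
    by (rule finsum_reindex[OF _ inj]) (use c in auto)
  also have "\<dots> = (\<Oplus>k\<in>{k. k \<subseteq># m}. p k \<otimes> q (m - k))"
  proof (rule finsum_cong')
    fix k assume "k \<in> {k. k \<subseteq># m}"
    then have "m - (m - k) = k" by (auto simp: multiset_eq_iff subseteq_mset_def)
    then show "q (m - k) \<otimes> p (m - (m - k)) = p k \<otimes> q (m - k)" using c m_comm by simp
  qed (use c in auto)
  finally show "(p \<otimes>\<^bsub>M n\<^esub> q) m = (q \<otimes>\<^bsub>M n\<^esub> p) m" by (simp add: mpoly_ring_simps)
qed

text \<open>Both sides sum over chains \<open>l \<subseteq># k \<subseteq># m\<close>. The inner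
  range depends on \<open>k\<close>, so \<open>?F\<close> pads it with zeros to all submultisets of
  \<open>m\<close>; then the sums can be exchanged, and \<open>k = l + j\<close> reindexes the new
  inner sum.\<close>

lemma mpoly_m_assoc:
  assumes p: "p \<in> carrier (M n)" and q: "q \<in> carrier (M n)" and r: "r \<in> carrier (M n)"
  shows "p \<otimes>\<^bsub>M n\<^esub> q \<otimes>\<^bsub>M n\<^esub> r = p \<otimes>\<^bsub>M n\<^esub> (q \<otimes>\<^bsub>M n\<^esub> r)"
proof
  fix m
  let ?S = "\<lambda>m. {k. k \<subseteq># m}"
  have c: "p k \<in> carrier R" "q k \<in> carrier R" "r k \<in> carrier R" for k using mpoly_coeff p q r by blast+
  note fin = finite_submultisets
  let ?F = "\<lambda>k l. if l \<subseteq># k then p l \<otimes> q (k - l) \<otimes> r (m - k) else \<zero>"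
  have "(p \<otimes>\<^bsub>M n\<^esub> q \<otimes>\<^bsub>M n\<^esub> r) m = (\<Oplus>k\<in>?S m. (\<Oplus>l\<in>?S k. p l \<otimes> q (k - l)) \<otimes> r (m - k))"
    by (simp add: mpoly_ring_simps)
  also have "\<dots> = (\<Oplus>k\<in>?S m. \<Oplus>l\<in>?S m. ?F k l)"
  proof (rule finsum_cong')
    fix k assume k: "k \<in> ?S m"
    have "(\<Oplus>l\<in>?S k. p l \<otimes> q (k - l)) \<otimes> r (m - k) = (\<Oplus>l\<in>?S k. p l \<otimes> q (k - l) \<otimes> r (m - k))"
      using c by (intro finsum_ldistr fin) auto
    also have "\<dots> = (\<Oplus>l\<in>?S m. ?F k l)"
      using k c by (intro add.finprod_mono_neutral_cong_left fin) (auto intro: subset_mset.order_trans)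
    finally show "(\<Oplus>l\<in>?S k. p l \<otimes> q (k - l)) \<otimes> r (m - k) = (\<Oplus>l\<in>?S m. ?F k l)" .
  qed (use c in auto)
  also have "\<dots> = (\<Oplus>l\<in>?S m. \<Oplus>k\<in>?S m. ?F k l)"
    using c by (intro finsum_swap fin) auto
  also have "\<dots> = (\<Oplus>l\<in>?S m. p l \<otimes> (\<Oplus>j\<in>?S (m - l). q j \<otimes> r (m - l - j)))"
  proof (rule finsum_cong')
    fix l assume l: "l \<in> ?S m"
    have im: "(\<lambda>j. l + j) ` ?S (m - l) = {k. l \<subseteq># k \<and> k \<subseteq># m}"
    proof (intro equalityI subsetI)
      fix k assume k: "k \<in> {k. l \<subseteq># k \<and> k \<subseteq># m}"
      then have "k - l \<subseteq># m - l" by (auto simp: subseteq_mset_def intro: diff_le_mono)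
      then show "k \<in> (\<lambda>j. l + j) ` ?S (m - l)"
        using k by (intro image_eqI[of _ _ "k - l"]) auto
    next
      fix k assume "k \<in> (\<lambda>j. l + j) ` ?S (m - l)"
      then show "k \<in> {k. l \<subseteq># k \<and> k \<subseteq># m}"
        using l by (auto simp: subset_mset.le_diff_conv2 add.commute)
    qed
    have "(\<Oplus>k\<in>?S m. ?F k l) = (\<Oplus>k\<in>{k. l \<subseteq># k \<and> k \<subseteq># m}. p l \<otimes> q (k - l) \<otimes> r (m - k))"
      using c by (intro add.finprod_mono_neutral_cong_right fin) auto
    also have "\<dots> = (\<Oplus>j\<in>?S (m - l). p l \<otimes> q (l + j - l) \<otimes> r (m - (l + j)))"
      unfolding im[symmetric] by (rule finsum_reindex) (use c in \<open>auto simp: inj_on_def\<close>)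
    also have "\<dots> = (\<Oplus>j\<in>?S (m - l). p l \<otimes> (q j \<otimes> r (m - l - j)))"
      using c by (intro finsum_cong') (auto simp: m_assoc)
    also have "\<dots> = p l \<otimes> (\<Oplus>j\<in>?S (m - l). q j \<otimes> r (m - l - j))"
      using c by (intro finsum_rdistr[symmetric] fin) auto
    finally show "(\<Oplus>k\<in>?S m. ?F k l) = p l \<otimes> (\<Oplus>j\<in>?S (m - l). q j \<otimes> r (m - l - j))" .
  qed (use c in auto)
  also have "\<dots> = (p \<otimes>\<^bsub>M n\<^esub> (q \<otimes>\<^bsub>M n\<^esub> r)) m"
    by (simp add: mpoly_ring_simps)
  finally show "(p \<otimes>\<^bsub>M n\<^esub> q \<otimes>\<^bsub>M n\<^esub> r) m = (p \<otimes>\<^bsub>M n\<^esub> (q \<otimes>\<^bsub>M n\<^esub> r)) m" .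
qed

lemma mpoly_l_one:
  assumes p: "p \<in> carrier (M n)" shows "\<one>\<^bsub>M n\<^esub> \<otimes>\<^bsub>M n\<^esub> p = p"
proof
  fix m
  have c: "p k \<in> carrier R" for k using mpoly_coeff p by blast
  have "(\<one>\<^bsub>M n\<^esub> \<otimes>\<^bsub>M n\<^esub> p) m = (\<Oplus>k\<in>{k. k \<subseteq># m}. if {#} = k then p (m - k) else \<zero>)"
    unfolding mpoly_ring_simps using c by (intro finsum_cong') auto
  also have "\<dots> = p (m - {#})"
    by (rule add.finprod_singleton) (use c finite_submultisets in auto)
  finally show "(\<one>\<^bsub>M n\<^esub> \<otimes>\<^bsub>M n\<^esub> p) m = p m" by simp
qed

lemma mpoly_l_distr:
  assumes p: "p \<in> carrier (M n)" and q: "q \<in> carrier (M n)" and r: "r \<in> carrier (M n)"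
  shows "(p \<oplus>\<^bsub>M n\<^esub> q) \<otimes>\<^bsub>M n\<^esub> r = p \<otimes>\<^bsub>M n\<^esub> r \<oplus>\<^bsub>M n\<^esub> q \<otimes>\<^bsub>M n\<^esub> r"
proof
  fix m
  have c: "p k \<in> carrier R" "q k \<in> carrier R" "r k \<in> carrier R" for k using mpoly_coeff p q r by blast+
  have "(\<Oplus>k\<in>{k. k \<subseteq># m}. (p k \<oplus> q k) \<otimes> r (m - k)) =
      (\<Oplus>k\<in>{k. k \<subseteq># m}. p k \<otimes> r (m - k) \<oplus> q k \<otimes> r (m - k))"
    using c by (intro finsum_cong') (auto simp: l_distr)
  also have "\<dots> = (\<Oplus>k\<in>{k. k \<subseteq># m}. p k \<otimes> r (m - k)) \<oplus> (\<Oplus>k\<in>{k. k \<subseteq># m}. q k \<otimes> r (m - k))"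
    using c by (intro finsum_addf) auto
  finally show "((p \<oplus>\<^bsub>M n\<^esub> q) \<otimes>\<^bsub>M n\<^esub> r) m = (p \<otimes>\<^bsub>M n\<^esub> r \<oplus>\<^bsub>M n\<^esub> q \<otimes>\<^bsub>M n\<^esub> r) m"
    by (simp add: mpoly_ring_simps)
qed

lemma mpoly_uminus_add:
  assumes "p \<in> carrier (M n)" shows "(\<lambda>m. \<ominus> p m) \<oplus>\<^bsub>M n\<^esub> p = \<zero>\<^bsub>M n\<^esub>"
  using mpoly_coeff[OF assms] by (simp add: mpoly_ring_simps l_neg)

lemma mpoly_cring: "cring (M n)"
proof (intro cringI abelian_groupI comm_monoidI mpoly_add_closed mpoly_mult_closed mpoly_zero_closed
    mpoly_one_closed mpoly_m_comm mpoly_m_assoc mpoly_l_one mpoly_l_distr)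
  fix p assume p: "p \<in> carrier (M n)"
  show "\<zero>\<^bsub>M n\<^esub> \<oplus>\<^bsub>M n\<^esub> p = p" using mpoly_coeff[OF p] by (simp add: mpoly_ring_simps)
  show "\<exists>q\<in>carrier (M n). q \<oplus>\<^bsub>M n\<^esub> p = \<zero>\<^bsub>M n\<^esub>"
    using mpoly_uminus_closed[OF p] mpoly_uminus_add[OF p] by blast
next
  fix p q assume pq: "p \<in> carrier (M n)" "q \<in> carrier (M n)"
  then show "p \<oplus>\<^bsub>M n\<^esub> q = q \<oplus>\<^bsub>M n\<^esub> p"
    using mpoly_coeff[OF pq(1)] mpoly_coeff[OF pq(2)] by (simp add: mpoly_ring_simps a_comm)
  fix r assume r: "r \<in> carrier (M n)"
  then show "p \<oplus>\<^bsub>M n\<^esub> q \<oplus>\<^bsub>M n\<^esub> r = p \<oplus>\<^bsub>M n\<^esub> (q \<oplus>\<^bsub>M n\<^esub> r)"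
    using mpoly_coeff[OF pq(1)] mpoly_coeff[OF pq(2)] mpoly_coeff[OF r] by (simp add: mpoly_ring_simps a_assoc)
qed

lemma mpoly_uminus:
  assumes p: "p \<in> carrier (M n)" shows "\<ominus>\<^bsub>M n\<^esub> p = (\<lambda>m. \<ominus> p m)"
proof -
  interpret M: cring "M n" by (rule mpoly_cring)
  show ?thesis by (rule M.minus_equality[OF mpoly_uminus_add[OF p] p mpoly_uminus_closed[OF p]])
qed

lemma mpoly_graded: "graded_cring (M n)"
proof -
  interpret M: cring "M n" by (rule mpoly_cring)
  show ?thesis
  proof (unfold_locales)
    fix p d assume p: "p \<in> hpart (M n) d"
    then show pc: "p \<in> carrier (M n)" by (simp add: mpoly_ring_simps(6))
    have "size m = d" if "\<ominus> p m \<noteq> \<zero>" for m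
    proof -
      have "p m \<noteq> \<zero>" using that by auto
      then show ?thesis using p by (simp add: mpoly_ring_simps(6))
    qed
    then show "\<ominus>\<^bsub>M n\<^esub> p \<in> hpart (M n) d"
      using mpoly_uminus_closed[OF pc] mpoly_uminus[OF pc] by (simp add: mpoly_ring_simps(6))
    fix q e assume q: "q \<in> hpart (M n) e"
    then have qc: "q \<in> carrier (M n)" by (simp add: mpoly_ring_simps(6))
    have "size m = d + e" if nz: "(p \<otimes>\<^bsub>M n\<^esub> q) m \<noteq> \<zero>" for m
    proof -
      obtain k l where "m = k + l" "p k \<noteq> \<zero>" "q l \<noteq> \<zero>" using mpoly_mult_support[OF pc qc nz] .
      then show ?thesis using p q by (simp add: mpoly_ring_simps(6))
    qed
    then show "p \<otimes>\<^bsub>M n\<^esub> q \<in> hpart (M n) (d + e)"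
      unfolding mpoly_ring_simps(6) using mpoly_mult_closed[OF pc qc] by blast
  next
    fix p q d assume p: "p \<in> hpart (M n) d" and q: "q \<in> hpart (M n) d"
    have pq: "p \<in> carrier (M n)" "q \<in> carrier (M n)" using p q by (simp_all add: mpoly_ring_simps(6))
    have "size m = d" if "(p \<oplus>\<^bsub>M n\<^esub> q) m \<noteq> \<zero>" for m
    proof (rule ccontr)
      assume "size m \<noteq> d"
      then have "p m = \<zero>" "q m = \<zero>" using p q by (auto simp: mpoly_ring_simps(6))
      then show False using that by (simp add: mpoly_ring_simps(5))
    qed
    then show "p \<oplus>\<^bsub>M n\<^esub> q \<in> hpart (M n) d"
      unfolding mpoly_ring_simps(6) using mpoly_add_closed[OF pq] by blast
  next
    show "\<zero>\<^bsub>M n\<^esub> \<in> hpart (M n) d" for d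
      using mpoly_zero_closed by (simp add: mpoly_ring_simps)
    show "\<one>\<^bsub>M n\<^esub> \<in> hpart (M n) 0"
      unfolding mpoly_ring_simps(6) using mpoly_one_closed by (auto simp: mpoly_ring_simps(3) split: if_splits)
  qed
qed

text \<open>The extended ideal \<open>I[x_0, ..., x_n]\<close>, described by coefficients. It occurs
  in two roles: at primes it gives the generic points of the fibres, and at a general
  \<open>I\<close> the kernel of reduction modulo \<open>I\<close>.\<close>

definition coeff_ideal :: "nat \<Rightarrow> 'a set \<Rightarrow> (nat multiset \<Rightarrow> 'a) set" where
  "coeff_ideal n I = {p \<in> carrier (M n). \<forall>m. p m \<in> I}"

definition monom :: "'a \<Rightarrow> nat multiset \<Rightarrow> nat multiset \<Rightarrow> 'a" where
  "monom c k = (\<lambda>m. if m = k then c else \<zero>)"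

text \<open>The bound on the variables is asked only for nonzero \<open>c\<close>, so that
  \<open>monom (f m) m\<close> qualifies for every multiset \<open>m\<close>: where \<open>m\<close>
  involves an index beyond \<open>n\<close>, the coefficient is zero.\<close>

lemma monom_hpart:
  assumes "c \<in> carrier R" "c \<noteq> \<zero> \<Longrightarrow> set_mset k \<subseteq> {0..n}"
  shows "monom c k \<in> hpart (M n) (size k)"
proof -
  have "monom c k \<in> carrier (M n)"
    by (rule mpoly_carrierI[of _ _ "{k}"]) (use assms in \<open>auto simp: monom_def split: if_splits\<close>)
  then show ?thesis by (simp add: mpoly_ring_simps(6) monom_def)
qed

text \<open>A polynomial is the finite sum of its monomials; the induction runs over truncations of
  \<open>f\<close> to finite sets of exponents.\<close>

lemma monom_span:
  assumes f: "f \<in> carrier (M n)" and J: "ideal J (M n)" and monom: "\<And>m. monom (f m) m \<in> J"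
  shows "f \<in> J"
proof -
  have "(\<lambda>m. if m \<in> A then f m else \<zero>) \<in> J" if "finite A" for A
    using that
  proof (induction A rule: finite_induct)
    case empty
    then show ?case
      using additive_subgroup.zero_closed[OF ideal.axioms(1)[OF J]] by (simp add: mpoly_ring_simps(4))
  next
    case (insert k A)
    have "(\<lambda>m. if m \<in> insert k A then f m else \<zero>) =
        monom (f k) k \<oplus>\<^bsub>M n\<^esub> (\<lambda>m. if m \<in> A then f m else \<zero>)"
      using insert.hyps mpoly_coeff[OF f] by (auto simp: mpoly_ring_simps(5) monom_def fun_eq_iff)
    then show ?case
      using additive_subgroup.a_closed[OF ideal.axioms(1)[OF J] monom insert.IH] by simp
  qed
  moreover have "(\<lambda>m. if m \<in> {m. f m \<noteq> \<zero>} then f m else \<zero>) = f" by (auto simp: fun_eq_iff)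
  ultimately show ?thesis using mpoly_finite[OF f] by metis
qed

lemma coeff_ideal_ideal:
  assumes "ideal I R" shows "ideal (coeff_ideal n I) (M n)"
proof -
  interpret I: ideal I R by fact
  interpret M: cring "M n" by (rule mpoly_cring)
  have mult: "p \<otimes>\<^bsub>M n\<^esub> q \<in> coeff_ideal n I" if p: "p \<in> coeff_ideal n I" and q: "q \<in> carrier (M n)" for p q
  proof -
    have pc: "p \<in> carrier (M n)" "\<And>m. p m \<in> I" using p by (simp_all add: coeff_ideal_def)
    have "(p \<otimes>\<^bsub>M n\<^esub> q) m \<in> I" for m
      unfolding mpoly_ring_simps by (rule I.finsum_in) (rule I.I_r_closed[OF pc(2) mpoly_coeff[OF q]])
    then show ?thesis using mpoly_mult_closed[OF pc(1) q] by (simp add: coeff_ideal_def)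
  qed
  show ?thesis
  proof (intro idealI M.ring_axioms)
    show "subgroup (coeff_ideal n I) (add_monoid (M n))"
    proof (rule M.add.subgroupI)
      show "coeff_ideal n I \<subseteq> carrier (M n)" by (auto simp: coeff_ideal_def)
      have "\<zero>\<^bsub>M n\<^esub> \<in> coeff_ideal n I"
        using mpoly_zero_closed I.zero_closed unfolding coeff_ideal_def by (simp add: mpoly_ring_simps(4))
      then show "coeff_ideal n I \<noteq> {}" by blast
      show "\<ominus>\<^bsub>M n\<^esub> p \<in> coeff_ideal n I" if "p \<in> coeff_ideal n I" for p
        using that mpoly_uminus_closed by (simp add: coeff_ideal_def mpoly_uminus I.a_inv_closed)
      show "p \<oplus>\<^bsub>M n\<^esub> q \<in> coeff_ideal n I" if "p \<in> coeff_ideal n I" "q \<in> coeff_ideal n I" for p q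
        using that mpoly_add_closed[of p n q] unfolding coeff_ideal_def by (simp add: mpoly_ring_simps(5))
    qed
    fix p q assume p: "p \<in> coeff_ideal n I" and q: "q \<in> carrier (M n)"
    show "p \<otimes>\<^bsub>M n\<^esub> q \<in> coeff_ideal n I" by (rule mult[OF p q])
    moreover have "p \<in> carrier (M n)" using p by (simp add: coeff_ideal_def)
    ultimately show "q \<otimes>\<^bsub>M n\<^esub> p \<in> coeff_ideal n I" using mpoly_m_comm q by simp
  qed
qed

lemma monom_coeff_ideal:
  assumes I: "ideal I R" and f: "f \<in> coeff_ideal n I"
  shows "monom (f m) m \<in> coeff_ideal n I \<inter> homs (M n)"
proof -
  interpret I: ideal I R by fact
  have fc: "f \<in> carrier (M n)" "f m \<in> I" using f by (simp_all add: coeff_ideal_def)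
  have "monom (f m) m \<in> hpart (M n) (size m)"
    using mpoly_coeff[OF fc(1)] mpoly_vars[OF fc(1)] by (intro monom_hpart) auto
  moreover from this have "monom (f m) m \<in> coeff_ideal n I"
    using fc(2) I.zero_closed by (simp add: coeff_ideal_def mpoly_ring_simps(6) monom_def)
  ultimately show ?thesis by blast
qed

text \<open>The monomials of a member are homogeneous and again have their coefficients in
  \<open>I\<close>, so they generate.\<close>

lemma coeff_ideal_homogeneous:
  assumes I: "ideal I R" shows "homogeneous_ideal (M n) (coeff_ideal n I)"
proof -
  interpret M: cring "M n" by (rule mpoly_cring)
  have id: "ideal (coeff_ideal n I) (M n)" by (rule coeff_ideal_ideal[OF I])
  let ?G = "coeff_ideal n I \<inter> homs (M n)"
  have sub: "?G \<subseteq> carrier (M n)" by (auto simp: coeff_ideal_def)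
  have "coeff_ideal n I \<subseteq> genideal (M n) ?G"
  proof
    fix f assume f: "f \<in> coeff_ideal n I"
    then have "f \<in> carrier (M n)" by (simp add: coeff_ideal_def)
    then show "f \<in> genideal (M n) ?G"
      using monom_span[OF _ M.genideal_ideal[OF sub]] monom_coeff_ideal[OF I f] M.genideal_self[OF sub] by blast
  qed
  moreover have "genideal (M n) ?G \<subseteq> coeff_ideal n I" by (rule M.genideal_minimal[OF id]) blast
  ultimately show ?thesis using id by (auto simp: homogeneous_ideal_def)
qed

text \<open>Here \<open><\<close> is the multiset extension of the order on indices, a linear order
  compatible with addition. The exponent \<open>m\<close> is the largest one with coefficient
  outside \<open>I\<close>, i.e. that of the leading term of \<open>f\<close> modulo
  \<open>I\<close>.\<close>

lemma leading_coeff: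
  assumes I: "ideal I R" and f: "f \<in> carrier (M n)" "f \<notin> coeff_ideal n I"
  obtains m where "f m \<notin> I" "\<And>k. m < k \<Longrightarrow> f k \<in> I"
proof -
  interpret I: ideal I R by fact
  let ?A = "{m. f m \<notin> I}"
  have fin: "finite ?A"
    by (rule finite_subset[OF _ mpoly_finite[OF f(1)]]) (use I.zero_closed in auto)
  have ne: "?A \<noteq> {}" using f by (auto simp: coeff_ideal_def)
  have "f (Max ?A) \<notin> I" using Max_in[OF fin ne] by simp
  moreover have "f k \<in> I" if "Max ?A < k" for k using Max_ge[OF fin, of k] that by force
  ultimately show ?thesis using that by blast
qed

text \<open>In the coefficient at \<open>a + b = k + l\<close>, each term with \<open>k\<close>
  different from \<open>a\<close> has \<open>a < k\<close>, or else \<open>k < a\<close> and then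
  \<open>b < l\<close>, since the order is compatible with addition. All these terms lie in
  \<open>I\<close>, and only the product of leading coefficients remains.\<close>

lemma leading_coeff_mult:
  assumes I: "ideal I R" and f: "f \<in> carrier (M n)" and g: "g \<in> carrier (M n)"
    and a: "\<And>k. a < k \<Longrightarrow> f k \<in> I" and b: "\<And>k. b < k \<Longrightarrow> g k \<in> I"
    and fg: "(f \<otimes>\<^bsub>M n\<^esub> g) (a + b) \<in> I"
  shows "f a \<otimes> g b \<in> I"
proof -
  interpret I: ideal I R by fact
  have c: "f k \<in> carrier R" "g k \<in> carrier R" for k using mpoly_coeff f g by blast+
  let ?S = "{k. k \<subseteq># a + b}" and ?F = "\<lambda>k. f k \<otimes> g (a + b - k)"
  have rest: "finsum R ?F (?S - {a}) \<in> I"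
  proof (rule I.finsum_in)
    fix k assume k: "k \<in> ?S - {a}"
    show "f k \<otimes> g (a + b - k) \<in> I"
    proof (cases "a < k")
      case True
      then show ?thesis using a c I.I_r_closed by blast
    next
      case False
      then have ka: "k < a" using k by auto
      obtain l where l: "a + b = k + l" using k by (auto simp: subset_mset.le_iff_add)
      have "b < l"
      proof (rule ccontr)
        assume "\<not> b < l"
        then have "k + l < a + b" using ka by (intro add_less_le_mono) auto
        then show False using l by simp
      qed
      then have "g (a + b - k) \<in> I" using b l by simp
      then show ?thesis using c I.I_l_closed by blast
    qed
  qed
  have "?S = insert a (?S - {a})" by auto
  then have "(f \<otimes>\<^bsub>M n\<^esub> g) (a + b) = finsum R ?F (insert a (?S - {a}))"
    unfolding mpoly_ring_simps by simp
  also have "\<dots> = ?F a \<oplus> finsum R ?F (?S - {a})"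
    using c finite_submultisets by (intro finsum_insert) auto
  finally have eq: "(f \<otimes>\<^bsub>M n\<^esub> g) (a + b) = f a \<otimes> g b \<oplus> finsum R ?F (?S - {a})" by simp
  have rc: "finsum R ?F (?S - {a}) \<in> carrier R" using rest by (rule I.Icarr)
  have "f a \<otimes> g b = (f \<otimes>\<^bsub>M n\<^esub> g) (a + b) \<oplus> \<ominus> finsum R ?F (?S - {a})"
    unfolding eq using c rc by (simp add: a_assoc r_neg)
  then show ?thesis using I.a_closed[OF fg I.a_inv_closed[OF rest]] by simp
qed

text \<open>Gauss's argument: if both factors have a coefficient outside \<open>P\<close>, their
  leading coefficients modulo \<open>P\<close> have a product outside \<open>P\<close>, although
  every coefficient of \<open>f g\<close> lies in \<open>P\<close>.\<close>

lemma coeff_ideal_prime: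
  assumes P: "primeideal P R" shows "primeideal (coeff_ideal n P) (M n)"
proof -
  interpret P: primeideal P R by fact
  note id = P.ideal_axioms
  show ?thesis
  proof (rule primeidealI[OF coeff_ideal_ideal[OF id] mpoly_cring])
    have "\<one> \<notin> P" using P.one_imp_carrier P.I_notcarr by blast
    then have "\<one>\<^bsub>M n\<^esub> \<notin> coeff_ideal n P" by (auto simp: coeff_ideal_def mpoly_ring_simps(3))
    then show "carrier (M n) \<noteq> coeff_ideal n P" using mpoly_one_closed by blast
    fix f g assume fg: "f \<in> carrier (M n)" "g \<in> carrier (M n)" "f \<otimes>\<^bsub>M n\<^esub> g \<in> coeff_ideal n P"
    show "f \<in> coeff_ideal n P \<or> g \<in> coeff_ideal n P"
    proof (rule ccontr)
      assume neg: "\<not> ?thesis"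
      obtain a where a: "f a \<notin> P" "\<And>k. a < k \<Longrightarrow> f k \<in> P" using leading_coeff[OF id fg(1)] neg by blast
      obtain b where b: "g b \<notin> P" "\<And>k. b < k \<Longrightarrow> g k \<in> P" using leading_coeff[OF id fg(2)] neg by blast
      have "(f \<otimes>\<^bsub>M n\<^esub> g) (a + b) \<in> P" using fg(3) unfolding coeff_ideal_def by blast
      then have "f a \<otimes> g b \<in> P" using leading_coeff_mult[OF id fg(1,2) a(2) b(2)] by blast
      then show False using P.I_prime[OF mpoly_coeff[OF fg(1)] mpoly_coeff[OF fg(2)]] a(1) b(1) by blast
    qed
  qed
qed

text \<open>The same argument relative to the zero ideal: the leading coefficient of a nonzero
  \<open>f\<close> would be nonzero with square zero.\<close>

lemma mpoly_square_zero:
  assumes red: "\<And>a. a \<in> carrier R \<Longrightarrow> a \<otimes> a = \<zero> \<Longrightarrow> a = \<zero>"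
    and f: "f \<in> carrier (M n)" "f \<otimes>\<^bsub>M n\<^esub> f = \<zero>\<^bsub>M n\<^esub>"
  shows "f = \<zero>\<^bsub>M n\<^esub>"
proof (rule ccontr)
  assume "f \<noteq> \<zero>\<^bsub>M n\<^esub>"
  then have "f \<notin> coeff_ideal n {\<zero>}" by (auto simp: coeff_ideal_def mpoly_ring_simps(4))
  then obtain a where a: "f a \<notin> {\<zero>}" "\<And>k. a < k \<Longrightarrow> f k \<in> {\<zero>}"
    using leading_coeff[OF zeroideal f(1)] by blast
  have "(f \<otimes>\<^bsub>M n\<^esub> f) (a + a) \<in> {\<zero>}" unfolding f(2) by (simp add: mpoly_ring_simps(4))
  then have "f a \<otimes> f a \<in> {\<zero>}" using leading_coeff_mult[OF zeroideal f(1,1) a(2) a(2)] by blast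
  then show False using red[OF mpoly_coeff[OF f(1)]] a(1) by blast
qed

end

section \<open>Constants, extension and contraction of ideals\<close>

context cring
begin

abbreviation const :: "'a \<Rightarrow> nat multiset \<Rightarrow> 'a" where "const c \<equiv> monom c {#}"

lemma const_carrier: "c \<in> carrier R \<Longrightarrow> const c \<in> carrier (M n)"
  using monom_hpart[of c "{#}" n] by (simp add: mpoly_ring_simps(6))

lemma const_mult:
  assumes c: "c \<in> carrier R" and p: "p \<in> carrier (M n)"
  shows "const c \<otimes>\<^bsub>M n\<^esub> p = (\<lambda>m. c \<otimes> p m)"
proof
  fix m
  have pc: "p k \<in> carrier R" for k using mpoly_coeff p by blast
  have "(const c \<otimes>\<^bsub>M n\<^esub> p) m = (\<Oplus>k\<in>{k. k \<subseteq># m}. if {#} = k then c \<otimes> p (m - k) else \<zero>)"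
    unfolding mpoly_ring_simps monom_def using pc c by (intro finsum_cong') auto
  also have "\<dots> = c \<otimes> p (m - {#})"
    by (rule add.finprod_singleton) (use c pc finite_submultisets in auto)
  finally show "(const c \<otimes>\<^bsub>M n\<^esub> p) m = c \<otimes> p m" by simp
qed

lemma const_ring_hom: "const \<in> ring_hom R (M n)"
proof (rule ring_hom_memI)
  fix c d assume c: "c \<in> carrier R" and d: "d \<in> carrier R"
  show "const c \<in> carrier (M n)" by (rule const_carrier[OF c])
  show "const (c \<otimes> d) = const c \<otimes>\<^bsub>M n\<^esub> const d"
    unfolding const_mult[OF c const_carrier[OF d]] using c by (simp add: monom_def fun_eq_iff)
  show "const (c \<oplus> d) = const c \<oplus>\<^bsub>M n\<^esub> const d"
    by (simp add: monom_def mpoly_ring_simps(5) fun_eq_iff)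
qed (simp add: monom_def mpoly_ring_simps(3))

lemma const_ring_hom_ring: "ring_hom_ring R (M n) const"
  using ring_axioms cring.axioms(1)[OF mpoly_cring] const_ring_hom by (rule ring_hom_ringI2)

text \<open>The constants from \<open>I\<close> generate the extended ideal, since
  \<open>monom c m\<close> is the product of \<open>const c\<close> and
  \<open>monom \<one> m\<close>.\<close>

lemma coeff_ideal_subset_iff:
  assumes I: "ideal I R" and J: "ideal J (M n)"
  shows "coeff_ideal n I \<subseteq> J \<longleftrightarrow> (\<forall>c\<in>I. const c \<in> J)"
proof
  assume sub: "coeff_ideal n I \<subseteq> J"
  show "\<forall>c\<in>I. const c \<in> J"
  proof
    fix c assume c: "c \<in> I"
    have "const c \<in> carrier (M n)" using const_carrier ideal.Icarr[OF I c] by blast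
    then have "const c \<in> coeff_ideal n I"
      using c additive_subgroup.zero_closed[OF ideal.axioms(1)[OF I]] by (simp add: coeff_ideal_def monom_def)
    then show "const c \<in> J" using sub by blast
  qed
next
  assume J_const: "\<forall>c\<in>I. const c \<in> J"
  show "coeff_ideal n I \<subseteq> J"
  proof
    fix f assume f: "f \<in> coeff_ideal n I"
    then have fc: "f \<in> carrier (M n)" by (simp add: coeff_ideal_def)
    have "monom (f m) m \<in> J" for m
    \<comment> \<open>A vanishing coefficient is treated apart because \<open>m\<close> may then
      contain indices beyond \<open>n\<close>, and \<open>monom \<one> m\<close> need not be a
      polynomial in the given variables.\<close>
    proof (cases "f m = \<zero>")
      case True
      then have "monom (f m) m = \<zero>\<^bsub>M n\<^esub>" by (simp add: monom_def mpoly_ring_simps(4) fun_eq_iff)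
      then show ?thesis using additive_subgroup.zero_closed[OF ideal.axioms(1)[OF J]] by simp
    next
      case False
      have "monom \<one> m \<in> hpart (M n) (size m)"
        using mpoly_vars[OF fc False] by (intro monom_hpart) auto
      then have m: "monom \<one> m \<in> carrier (M n)" by (simp add: mpoly_ring_simps(6))
      have "const (f m) \<in> J" using f J_const by (simp add: coeff_ideal_def)
      then have "const (f m) \<otimes>\<^bsub>M n\<^esub> monom \<one> m \<in> J" by (rule ideal.I_r_closed[OF J _ m])
      moreover have "const (f m) \<otimes>\<^bsub>M n\<^esub> monom \<one> m = monom (f m) m"
        unfolding const_mult[OF mpoly_coeff[OF fc] m] using mpoly_coeff[OF fc] by (simp add: monom_def fun_eq_iff)
      ultimately show ?thesis by simp
    qed
    then show "f \<in> J" by (rule monom_span[OF fc J])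
  qed
qed

section \<open>The structure morphism on points\<close>

definition base :: "(nat multiset \<Rightarrow> 'a) set \<Rightarrow> 'a set" where
  "base P = {c \<in> carrier R. const c \<in> P}"

lemma proj_setD: "P \<in> proj_set (M n) \<Longrightarrow> primeideal P (M n)" "P \<in> proj_set (M n) \<Longrightarrow> ideal P (M n)"
  by (auto simp: proj_set_def spec_def intro: primeideal.axioms(1))

lemma base_spec: "P \<in> proj_set (M n) \<Longrightarrow> base P \<in> spec R"
  using ring_hom_ring.primeideal_vimage[OF const_ring_hom_ring is_cring proj_setD(1)]
  by (simp add: spec_def base_def)

text \<open>Adjunction of extension and contraction. It identifies the preimage of
  \<open>V(I)\<close> with the image of the closed immersion; for \<open>I = base P\<close> it says
  that \<open>P\<close> contains the generic point of its fibre.\<close>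

lemma subset_base_iff:
  assumes P: "P \<in> proj_set (M n)" and I: "ideal I R"
  shows "I \<subseteq> base P \<longleftrightarrow> coeff_ideal n I \<subseteq> P"
  unfolding coeff_ideal_subset_iff[OF I proj_setD(2)[OF P]] using ideal.Icarr[OF I] by (auto simp: base_def)

lemma continuous_base: "continuous_map (proj_top (M n)) (spec_top R) base"
  unfolding continuous_map_def topspace_proj_top topspace_spec_top
proof (intro conjI allI impI)
  show "base \<in> proj_set (M n) \<rightarrow> spec R" using base_spec by blast
  fix U assume "openin (spec_top R) U"
  then obtain E where E: "E \<subseteq> carrier R" "U = spec R - zero_locus R E" unfolding openin_spec_top by blast
  have "{P \<in> proj_set (M n). base P \<in> U} = {P \<in> proj_set (M n). \<not> const ` E \<subseteq> P}"
    using base_spec E by (auto simp: zero_locus_def base_def)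
  moreover have "const ` E \<subseteq> carrier (M n)" using E(1) const_carrier by blast
  ultimately show "openin (proj_top (M n)) {P \<in> proj_set (M n). base P \<in> U}"
    unfolding openin_proj_top by blast
qed

lemma coeff_ideal_proj:
  assumes p: "p \<in> spec R" shows "coeff_ideal n p \<in> proj_set (M n)"
proof -
  interpret p: primeideal p R using p by (simp add: spec_def)
  interpret M: cring "M n" by (rule mpoly_cring)
  have "\<not> irrelevant_ideal (M n) \<subseteq> coeff_ideal n p"
  proof
    assume irr: "irrelevant_ideal (M n) \<subseteq> coeff_ideal n p"
    \<comment> \<open>The variable \<open>x_0\<close> exists for every \<open>n\<close> and has
      degree one; its coefficient one lies in no prime.\<close>
    have "monom \<one> {#0#} \<in> hpart (M n) 1" using monom_hpart[of \<one> "{#0#}" n] by simp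
    moreover have "(\<Union>d\<in>{0<..}. hpart (M n) d) \<subseteq> irrelevant_ideal (M n)"
      unfolding irrelevant_ideal_def by (rule M.genideal_self) (auto simp: mpoly_ring_simps(6))
    ultimately have "monom \<one> {#0#} \<in> coeff_ideal n p" using irr by auto
    then have "monom \<one> {#0#} {#0#} \<in> p" unfolding coeff_ideal_def by blast
    then have "\<one> \<in> p" by (simp add: monom_def)
    then show False using p.one_imp_carrier p.I_notcarr by simp
  qed
  then show ?thesis
    using coeff_ideal_prime[OF p.primeideal] coeff_ideal_homogeneous[OF p.ideal_axioms]
    by (simp add: proj_set_def spec_def)
qed

lemma base_coeff_ideal:
  assumes p: "p \<in> spec R" shows "base (coeff_ideal n p) = p"
proof -
  interpret p: primeideal p R using p by (simp add: spec_def)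
  have z: "\<zero> \<in> p" by (rule additive_subgroup.zero_closed[OF ideal.axioms(1)[OF p.ideal_axioms]])
  then show ?thesis
    using const_carrier p.Icarr by (auto simp: base_def coeff_ideal_def monom_def)
qed

lemma continuous_coeff_ideal: "continuous_map (spec_top R) (proj_top (M n)) (coeff_ideal n)"
  unfolding continuous_map_def topspace_proj_top topspace_spec_top
proof (intro conjI allI impI)
  show "coeff_ideal n \<in> spec R \<rightarrow> proj_set (M n)" using coeff_ideal_proj by blast
  fix U assume "openin (proj_top (M n)) U"
  then obtain F where F: "F \<subseteq> carrier (M n)" "U = {P \<in> proj_set (M n). \<not> F \<subseteq> P}"
    unfolding openin_proj_top by blast
  \<comment> \<open>All coefficients occurring in \<open>F\<close>: the extended prime contains
    \<open>F\<close> exactly when \<open>p\<close> contains them, which makes the preimage of a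
    standard open set standard open.\<close>
  define E where "E = {f m | f m. f \<in> F}"
  have "F \<subseteq> coeff_ideal n p \<longleftrightarrow> E \<subseteq> p" for p
    using F(1) unfolding coeff_ideal_def E_def by blast
  then have "{p \<in> spec R. coeff_ideal n p \<in> U} = spec R - zero_locus R E"
    using coeff_ideal_proj F(2) by (auto simp: zero_locus_def)
  moreover have "E \<subseteq> carrier R" using F(1) mpoly_coeff[of _ R n] unfolding E_def by blast
  ultimately show "openin (spec_top R) {p \<in> spec R. coeff_ideal n p \<in> U}"
    unfolding openin_spec_top by blast
qed

text \<open>The generic points of the fibres form a continuous section \<open>p \<mapsto> p[x\<^sub>0, \<dots>, x\<^sub>n]\<close> of the
  structure morphism, and every point is a specialization of the generic point of its fibre; hence the
  preimage of a connected set lies between a connected set and its closure.\<close>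

lemma connectedin_base_vimage:
  assumes D: "connectedin (spec_top R) D"
  shows "connectedin (proj_top (M n)) {P \<in> proj_set (M n). base P \<in> D}"
proof (rule connectedin_intermediate_closure_of)
  have DR: "D \<subseteq> spec R" using connectedin_subset_topspace[OF D] by (simp add: topspace_spec_top)
  show "connectedin (proj_top (M n)) (coeff_ideal n ` D)"
    by (rule connectedin_continuous_map_image[OF continuous_coeff_ideal D])
  show "coeff_ideal n ` D \<subseteq> {P \<in> proj_set (M n). base P \<in> D}"
  proof
    fix P assume "P \<in> coeff_ideal n ` D"
    then obtain p where p: "p \<in> D" "P = coeff_ideal n p" by blast
    then show "P \<in> {P \<in> proj_set (M n). base P \<in> D}"
      using base_coeff_ideal[of p n] coeff_ideal_proj[of p n] DR by auto
  qed
  show "{P \<in> proj_set (M n). base P \<in> D} \<subseteq> proj_top (M n) closure_of (coeff_ideal n ` D)"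
  proof
    fix P assume "P \<in> {P \<in> proj_set (M n). base P \<in> D}"
    then have P: "P \<in> proj_set (M n)" "base P \<in> D" by simp_all
    have id: "ideal (base P) R" using base_spec[OF P(1)] by (simp add: spec_def primeideal.axioms(1))
    have sub: "coeff_ideal n (base P) \<subseteq> P" using subset_base_iff[OF P(1) id] by blast
    have "\<exists>Q. Q \<in> coeff_ideal n ` D \<and> Q \<in> T" if T: "P \<in> T" "openin (proj_top (M n)) T" for T
    proof (intro exI conjI)
      show "coeff_ideal n (base P) \<in> coeff_ideal n ` D" using P(2) by (rule imageI)
      obtain F where F: "T = {P \<in> proj_set (M n). \<not> F \<subseteq> P}" using T(2) unfolding openin_proj_top by blast
      show "coeff_ideal n (base P) \<in> T"
        using T(1) sub coeff_ideal_proj[of "base P" n] P(2) DR unfolding F by blast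
    qed
    then show "P \<in> proj_top (M n) closure_of (coeff_ideal n ` D)"
      using P(1) unfolding in_closure_of topspace_proj_top by blast
  qed
qed

end

text \<open>The image of a component \<open>C\<close> is connected, hence inside the component
  \<open>D\<close> that it meets; the preimage of \<open>D\<close> is connected by assumption, hence
  inside \<open>C\<close>. Surjectivity ensures that every \<open>D\<close> is met.\<close>

lemma connected_components_vimage:
  assumes f: "continuous_map X Y f"
    and conn: "\<And>D. connectedin Y D \<Longrightarrow> connectedin X {x \<in> topspace X. f x \<in> D}"
    and surj: "f ` topspace X = topspace Y"
  shows "connected_components_of X = (\<lambda>D. {x \<in> topspace X. f x \<in> D}) ` connected_components_of Y"
proof -
  have comp: "C = {x \<in> topspace X. f x \<in> D}"
    if C: "C \<in> connected_components_of X" and D: "D \<in> connected_components_of Y"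
      and x: "x \<in> C" "f x \<in> D" for C D x
  proof
    have "connectedin Y (f ` C)"
      by (rule connectedin_continuous_map_image[OF f connectedin_connected_components_of[OF C]])
    then have "f ` C \<subseteq> D" using x by (intro connected_components_of_maximal[OF D]) (auto simp: disjnt_def)
    then show "C \<subseteq> {x \<in> topspace X. f x \<in> D}" using connected_components_of_subset[OF C] by blast
    have "x \<in> topspace X" using x connected_components_of_subset[OF C] by blast
    then show "{x \<in> topspace X. f x \<in> D} \<subseteq> C"
      using x by (intro connected_components_of_maximal[OF C] conn connectedin_connected_components_of[OF D])
        (auto simp: disjnt_def)
  qed
  show ?thesis
  proof (intro equalityI subsetI)
    fix C assume C: "C \<in> connected_components_of X"
    then obtain x where x: "x \<in> C" using nonempty_connected_components_of by blast
    then have "f x \<in> topspace Y" using connected_components_of_subset[OF C] surj by blast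
    then obtain D where "D \<in> connected_components_of Y" "f x \<in> D"
      using Union_connected_components_of[of Y] by blast
    then show "C \<in> (\<lambda>D. {x \<in> topspace X. f x \<in> D}) ` connected_components_of Y"
      using comp[OF C _ x] by blast
  next
    fix C assume "C \<in> (\<lambda>D. {x \<in> topspace X. f x \<in> D}) ` connected_components_of Y"
    then obtain D where D: "D \<in> connected_components_of Y" "C = {x \<in> topspace X. f x \<in> D}" by blast
    then obtain y where y: "y \<in> D" using nonempty_connected_components_of by blast
    then have "y \<in> f ` topspace X" using connected_components_of_subset[OF D(1)] surj by auto
    then obtain x where x: "x \<in> topspace X" "f x = y" by blast
    then obtain C' where C': "C' \<in> connected_components_of X" "x \<in> C'"
      using Union_connected_components_of[of X] by blast
    then show "C \<in> connected_components_of X" using comp[OF C'(1) D(1) C'(2)] x y D(2) by simp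
  qed
qed

text \<open>Surjectivity of \<open>base\<close> is witnessed by its section
  \<open>coeff_ideal n\<close>.\<close>

lemma (in cring) components_projective_space:
  "connected_components_of (points (projective_space R n)) =
    (\<lambda>D. {P \<in> proj_set (M n). base P \<in> D}) ` connected_components_of (spec_top R)"
proof -
  have "base ` topspace (proj_top (M n)) = topspace (spec_top R)"
    unfolding topspace_proj_top topspace_spec_top
  proof (intro equalityI subsetI)
    fix p assume "p \<in> spec R"
    then show "p \<in> base ` proj_set (M n)"
      using base_coeff_ideal coeff_ideal_proj by (intro image_eqI[of _ _ "coeff_ideal n p"]) simp_all
  qed (use base_spec in blast)
  from connected_components_vimage[OF continuous_base _ this]
  show ?thesis using connectedin_base_vimage by (simp add: projective_space_def topspace_proj_top)
qed

section \<open>Reduction of coefficients\<close>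

lemma mpoly_graded_surj:
  assumes "ring_hom_cring R S h" and surj: "h ` carrier R = carrier S"
  shows "graded_surj (mpoly_ring R n) (mpoly_ring S n) (\<lambda>p m. h (p m))"
    and "a_kernel (mpoly_ring R n) (mpoly_ring S n) (\<lambda>p m. h (p m)) = cring.coeff_ideal R n (a_kernel R S h)"
proof -
  let ?M = "mpoly_ring R n" and ?N = "mpoly_ring S n"
  define H where "H = (\<lambda>p (m :: nat multiset). h (p m))"
  interpret h: ring_hom_cring R S h by fact
  have R: "cring R" and S: "cring S" by unfold_locales
  interpret M: graded_cring ?M by (rule cring.mpoly_graded[OF R])
  interpret N: graded_cring ?N by (rule cring.mpoly_graded[OF S])
  have H_closed: "H p \<in> carrier ?N" if p: "p \<in> carrier ?M" for p
  proof (rule mpoly_carrierI[OF _ mpoly_finite[OF p]])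
    fix m
    show "H p m \<in> carrier S" using mpoly_coeff[OF p] by (simp add: H_def)
    assume "H p m \<noteq> \<zero>\<^bsub>S\<^esub>"
    then have "p m \<noteq> \<zero>\<^bsub>R\<^esub>" by (auto simp: H_def)
    then show "m \<in> {m. p m \<noteq> \<zero>\<^bsub>R\<^esub>}" "set_mset m \<subseteq> {0..n}" using mpoly_vars[OF p] by auto
  qed
  have H: "ring_hom_ring ?M ?N H"
  proof (rule ring_hom_ringI2[OF M.ring_axioms N.ring_axioms], rule ring_hom_memI)
    fix p q assume p: "p \<in> carrier ?M" and q: "q \<in> carrier ?M"
    have c: "p m \<in> carrier R" "q m \<in> carrier R" for m using mpoly_coeff p q by blast+
    have "h (\<Oplus>\<^bsub>R\<^esub>k\<in>{k. k \<subseteq># m}. p k \<otimes>\<^bsub>R\<^esub> q (m - k)) =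
        (\<Oplus>\<^bsub>S\<^esub>k\<in>{k. k \<subseteq># m}. h (p k) \<otimes>\<^bsub>S\<^esub> h (q (m - k)))" for m
      using c by (subst h.hom_finsum) (auto simp: o_def)
    then show "H (p \<otimes>\<^bsub>?M\<^esub> q) = H p \<otimes>\<^bsub>?N\<^esub> H q" by (simp add: H_def mpoly_ring_simps(2))
    show "H (p \<oplus>\<^bsub>?M\<^esub> q) = H p \<oplus>\<^bsub>?N\<^esub> H q" using c by (simp add: H_def mpoly_ring_simps(5))
  qed (simp_all add: H_closed, simp add: H_def mpoly_ring_simps(3) fun_eq_iff)
  interpret H: ring_hom_ring ?M ?N H by (rule H)
  have lift: "\<exists>p\<in>carrier ?M. H p = q \<and> (\<forall>m. p m \<noteq> \<zero>\<^bsub>R\<^esub> \<longrightarrow> q m \<noteq> \<zero>\<^bsub>S\<^esub>)" if q: "q \<in> carrier ?N" for q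
  proof -
    \<comment> \<open>Zero coefficients are lifted to zero and not to an arbitrary element of the
      kernel; this keeps the support finite, the variables in range and the degree
      unchanged.\<close>
    define p where "p = (\<lambda>m. if q m = \<zero>\<^bsub>S\<^esub> then \<zero>\<^bsub>R\<^esub> else SOME a. a \<in> carrier R \<and> h a = q m)"
    have p: "p m \<in> carrier R \<and> h (p m) = q m" for m
    proof (cases "q m = \<zero>\<^bsub>S\<^esub>")
      case False
      have "q m \<in> h ` carrier R" using mpoly_coeff[OF q] surj by simp
      then have "\<exists>a. a \<in> carrier R \<and> h a = q m" by auto
      from someI_ex[OF this] show ?thesis using False by (simp add: p_def)
    qed (simp add: p_def)
    have nz: "p m \<noteq> \<zero>\<^bsub>R\<^esub> \<Longrightarrow> q m \<noteq> \<zero>\<^bsub>S\<^esub>" for m by (auto simp: p_def)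
    have "p \<in> carrier ?M"
      by (rule mpoly_carrierI[OF _ mpoly_finite[OF q]]) (use p nz mpoly_vars[OF q] in auto)
    moreover have "H p = q" using p by (simp add: H_def)
    ultimately show ?thesis using nz by blast
  qed
  have hpart: "H ` hpart ?M d = hpart ?N d" for d
  proof (intro equalityI subsetI)
    fix q assume "q \<in> H ` hpart ?M d"
    then obtain p where p: "p \<in> hpart ?M d" "q = H p" by blast
    have "size m = d" if "H p m \<noteq> \<zero>\<^bsub>S\<^esub>" for m
    proof -
      have "p m \<noteq> \<zero>\<^bsub>R\<^esub>" using that by (auto simp: H_def)
      then show ?thesis using p(1) by (simp add: mpoly_ring_simps(6))
    qed
    then show "q \<in> hpart ?N d" using p H_closed[of p] unfolding mpoly_ring_simps(6) by blast
  next
    fix q assume q: "q \<in> hpart ?N d"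
    then have "q \<in> carrier ?N" by (simp add: mpoly_ring_simps(6))
    then obtain p where p: "p \<in> carrier ?M" "H p = q" "\<forall>m. p m \<noteq> \<zero>\<^bsub>R\<^esub> \<longrightarrow> q m \<noteq> \<zero>\<^bsub>S\<^esub>" using lift by blast
    then have "p \<in> hpart ?M d" using q unfolding mpoly_ring_simps(6) by blast
    then show "q \<in> H ` hpart ?M d" using p(2) by blast
  qed
  have ker: "a_kernel ?M ?N H = cring.coeff_ideal R n (a_kernel R S h)"
  proof -
    have "H p = \<zero>\<^bsub>?N\<^esub> \<longleftrightarrow> (\<forall>m. p m \<in> a_kernel R S h)" if "p \<in> carrier ?M" for p
      using mpoly_coeff[OF that] unfolding a_kernel_def' mpoly_ring_simps(4) H_def by (simp add: fun_eq_iff)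
    then show ?thesis
      unfolding cring.coeff_ideal_def[OF R] a_kernel_def'[of ?M] by blast
  qed
  have surjM: "H ` carrier ?M = carrier ?N" using H_closed lift by blast
  have "ideal (a_kernel R S h) R"
    using ring_hom_ring.kernel_is_ideal[of R S h] h.homh h.R.ring_axioms h.S.ring_axioms ring_hom_ringI2 by blast
  \<comment> \<open>The kernel is an extended ideal, and those are homogeneous: this discharges the
    assumption \<open>ker_homogeneous\<close>.\<close>
  from cring.coeff_ideal_homogeneous[OF R this]
  have hom: "a_kernel ?M ?N H = genideal ?M (a_kernel ?M ?N H \<inter> homs ?M)"
    unfolding homogeneous_ideal_def ker by blast
  show "graded_surj ?M ?N (\<lambda>p m. h (p m))"
    using graded_surj.intro[OF M.graded_cring_axioms N.graded_cring_axioms H graded_surj_axioms.intro[OF hpart surjM hom]]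
    unfolding H_def .
  show "a_kernel ?M ?N (\<lambda>p m. h (p m)) = cring.coeff_ideal R n (a_kernel R S h)"
    using ker unfolding H_def .
qed

text \<open>A prime contains every root of each of its elements. Nonemptiness of \<open>D\<close>
  keeps the intersection inside the carrier, the empty one being \<open>UNIV\<close>.\<close>

lemma (in cring) radical_ideal_Inter_primes:
  assumes D: "D \<subseteq> spec R" "D \<noteq> {}" shows "radical_ideal (\<Inter>D) R"
proof -
  have "ideal (\<Inter>D) R"
    using D by (intro i_Intersect) (auto simp: spec_def intro: primeideal.axioms(1))
  moreover have "a \<in> P" if P: "P \<in> D" and a: "a \<in> carrier R" "a [^] (k::nat) \<in> P" for a k P
  proof -
    interpret P: primeideal P R using P D by (auto simp: spec_def)
    show ?thesis using a(2)
    proof (induction k)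
      case 0
      then show ?case using P.one_imp_carrier P.I_notcarr by simp
    next
      case (Suc k)
      then show ?case using P.I_prime[of "a [^] k" a] a(1) by auto
    qed
  qed
  ultimately show ?thesis unfolding radical_ideal_def by blast
qed

lemma FactRing_carrier_zero:
  "carrier (R Quot I) = (+>\<^bsub>R\<^esub>) I ` carrier R" "\<zero>\<^bsub>R Quot I\<^esub> = I"
  by (auto simp: FactRing_def A_RCOSETS_def')

text \<open>Radicality of \<open>I\<close> is used for reducedness of the source: an element of
  \<open>R/I\<close> with square zero has a representative \<open>a\<close> with \<open>a^2\<close>
  in \<open>I\<close>. Both directions of the final equivalence apply this to the same canonical
  morphism.\<close>

lemma (in cring) reduced_induced_projective_space:
  assumes I: "radical_ideal I R"
  shows "reduced_induced_subscheme (projective_space R n)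
      {P \<in> proj_set (M n). base P \<in> zero_locus R I}
      (projective_space (R Quot I) n) (projective_space_incl R I n)"
proof -
  have id: "ideal I R" using I by (simp add: radical_ideal_def)
  interpret I: ideal I R by (rule id)
  interpret q: ring_hom_cring R "R Quot I" "(+>) I" by (rule I.rcos_ring_hom_cring[OF is_cring])
  have surj: "(+>) I ` carrier R = carrier (R Quot I)"
    by (rule FactRing_carrier_zero(1)[symmetric])
  have mem: "I +> a = \<zero>\<^bsub>R Quot I\<^esub> \<longleftrightarrow> a \<in> I" if "a \<in> carrier R" for a
    unfolding FactRing_carrier_zero(2) using I.rcos_const_imp_mem[OF that] a_rcos_zero[OF id] by blast
  have ker: "a_kernel R (R Quot I) ((+>) I) = I"
    using mem I.Icarr unfolding a_kernel_def' by blast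
  note gs = mpoly_graded_surj[OF q.ring_hom_cring_axioms surj, of n, unfolded ker]
  interpret G: graded_surj "M n" "mpoly_ring (R Quot I) n" "\<lambda>p m. I +> p m" by (rule gs(1))
  have "closed_immersion (projective_space (R Quot I) n) (projective_space R n) (projective_space_incl R I n)"
    using G.closed_immersion_Proj_map by (simp add: projective_space_def projective_space_incl_def)
  moreover have "reduced_space (projective_space (R Quot I) n)"
    unfolding projective_space_def
  proof (rule G.T.reduced_Proj, rule cring.mpoly_square_zero[OF q.S.is_cring])
    fix v assume v: "v \<in> carrier (R Quot I)" "v \<otimes>\<^bsub>R Quot I\<^esub> v = \<zero>\<^bsub>R Quot I\<^esub>"
    then obtain a where a: "a \<in> carrier R" "v = I +> a" using surj by blast
    then have sq: "I +> (a \<otimes> a) = \<zero>\<^bsub>R Quot I\<^esub>" using v(2) by simp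
    have "a \<otimes> a \<in> carrier R" using a(1) by simp
    then have "a \<otimes> a \<in> I" using mem sq by blast
    moreover have "a \<otimes> a = a [^] (2::nat)" using a(1) by (simp add: numeral_2_eq_2)
    ultimately have "a \<in> I" using I a(1) unfolding radical_ideal_def by metis
    then show "v = \<zero>\<^bsub>R Quot I\<^esub>" using mem[OF a(1)] a(2) by blast
  qed
  moreover have "pt_map (projective_space_incl R I n) ` topspace (points (projective_space (R Quot I) n)) =
      {P \<in> proj_set (M n). base P \<in> zero_locus R I}"
  proof -
    have "{P \<in> proj_set (M n). base P \<in> zero_locus R I} = {P \<in> proj_set (M n). coeff_ideal n I \<subseteq> P}"
      using subset_base_iff[OF _ id] base_spec by (auto simp: zero_locus_def)
    then show ?thesis
      using G.phi_range
      by (simp add: projective_space_def projective_space_incl_def G.Proj_map_simps topspace_proj_top gs(2))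
  qed
  ultimately show ?thesis by (simp add: reduced_induced_subscheme_def)
qed

theorem corollary4p10:
  fixes R :: "('a, 'm) ring_scheme" and n :: nat
  assumes "cring R"
  shows "(\<forall>C \<in> connected_components_of (points (projective_space R n)).
            \<exists>I. radical_ideal I R \<and>
                zero_locus R I \<in> connected_components_of (spec_top R) \<and>
                reduced_induced_subscheme (projective_space R n) C
                  (projective_space (R Quot I) n) (projective_space_incl R I n)) \<and>
         (\<forall>I. radical_ideal I R \<and> zero_locus R I \<in> connected_components_of (spec_top R) \<longrightarrow>
            (\<exists>C \<in> connected_components_of (points (projective_space R n)).
                reduced_induced_subscheme (projective_space R n) C
                  (projective_space (R Quot I) n) (projective_space_incl R I n)))"
proof -
  interpret cring R by fact
  show ?thesis
  proof (intro conjI ballI allI impI)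
    fix C assume "C \<in> connected_components_of (points (projective_space R n))"
    then obtain D where D: "D \<in> connected_components_of (spec_top R)"
      and C: "C = {P \<in> proj_set (M n). base P \<in> D}"
      unfolding components_projective_space by blast
    have "D \<subseteq> spec R" "D \<noteq> {}"
      using connected_components_of_subset[OF D] nonempty_connected_components_of[OF D]
      by (simp_all add: topspace_spec_top)
    \<comment> \<open>The intersection of the primes in \<open>D\<close> is the largest ideal
      contained in all of them, and thus the natural candidate for the radical ideal of
      \<open>D\<close>.\<close>
    note I = radical_ideal_Inter_primes[OF this]
    have "closedin (spec_top R) D" by (rule closedin_connected_components_of[OF D])
    then have "openin (spec_top R) (spec R - D)" by (simp add: closedin_def topspace_spec_top)
    then obtain E where "spec R - D = spec R - zero_locus R E" unfolding openin_spec_top by blast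
    moreover have "zero_locus R E \<subseteq> spec R" by (auto simp: zero_locus_def)
    ultimately have E: "D = zero_locus R E" using \<open>D \<subseteq> spec R\<close> by blast
    \<comment> \<open>This is where closedness of components enters: \<open>D\<close> is the locus
      of some \<open>E\<close>, every prime in \<open>D\<close> contains \<open>E\<close>, and so a
      prime above \<open>\<Inter>D\<close> contains \<open>E\<close> and lies in
      \<open>D\<close>.\<close>
    have "zero_locus R (\<Inter>D) = D"
    proof
      have "E \<subseteq> \<Inter>D" unfolding E by (auto simp: zero_locus_def)
      then show "zero_locus R (\<Inter>D) \<subseteq> D" by (subst (2) E) (auto simp: zero_locus_def)
      show "D \<subseteq> zero_locus R (\<Inter>D)" using \<open>D \<subseteq> spec R\<close> by (auto simp: zero_locus_def)
    qed
    then show "\<exists>I. radical_ideal I R \<and> zero_locus R I \<in> connected_components_of (spec_top R) \<and>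
        reduced_induced_subscheme (projective_space R n) C
          (projective_space (R Quot I) n) (projective_space_incl R I n)"
      using I D C reduced_induced_projective_space[OF I, of n] by (intro exI[of _ "\<Inter>D"]) simp
  next
    fix I assume "radical_ideal I R \<and> zero_locus R I \<in> connected_components_of (spec_top R)"
    then show "\<exists>C\<in>connected_components_of (points (projective_space R n)).
        reduced_induced_subscheme (projective_space R n) C
          (projective_space (R Quot I) n) (projective_space_incl R I n)"
      unfolding components_projective_space using reduced_induced_projective_space by blast
  qed
qed

end
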